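(* Let $X$ be a zero-dimensional metric space, let $X'$ be its derived set, and let $C_k(X,2)$ be the space of continuous functions $X\to 2=\{0,1\}$ with the compact-open topology. Then: (i) The following are equivalent: $C_k(X,2)$ is an Ascoli space; $C_k(X,2)$ is a $k_{\mathbb{R}}$-space; either $X$ is locally compact, or $X$ is not locally compact but $X'$ is compact. (ii) $C_k(X,2)$ is a $k$-space if and only if either $X=L\cup D$ is a topological sum of a separable metrizable locally compact space $L$ and a discrete space $D$, or $X$ is not locally compact but $X'$ is compact. (iii) $C_k(X,2)$ is a sequential space if and only if $X$ is a Polish space and either $X$ is locally compact or $X$ is not locally compact but $X'$ is compact. (iv) The following are equivalent: $C_k(X,2)$ is a Fréchet–Urysohn space; $C_k(X,2)$ is a Polish space; $X$ is a Polish locally compact space.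
   Context: Zero-dimensional means having a base of clopen sets. The derived set $X'$ is the set of all non-isolated points of $X$. $2=\{0,1\}$ is the two-point discrete space. For topological spaces $X,Y$, $C_k(X,Y)$ is the set of continuous functions $X\to Y$ with the compact-open topology; $C_k(Z):=C_k(Z,\mathbb{R})$. A topological space $Z$ is: Fréchet–Urysohn if for any cluster point $a\in Z$ of a subset $A\subset Z$ there is a sequence in $A$ converging to $a$; sequential if for each non-closed $A\subset Z$ there is a sequence in $A$ converging to some point of $\overline{A}\setminus A$; a $k$-space if for each non-closed $A\subset Z$ there is a compact $K\subset Z$ such that $A\cap K$ is not closed in $K$; a $k_{\mathbb{R}}$-space if a real-valued function $f$ on $Z$ is continuous if and only if its restriction $f|_K$ is continuous for every compact $K\subset Z$. A regular Hausdorff space $Z$ is an Ascoli space if each compact subset $\mathcal{K}$ of $C_k(Z)$ is evenly continuous, i.e. the evaluation map $Z\times\mathcal{K}\to\mathbb{R}$, $(z,f)\mapsto f(z)$, is jointly continuous. *)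

theory Defs
  imports "HOL-Analysis.Analysis"
begin

definition zero_dimensional_space :: "'a topology \<Rightarrow> bool"
  where "zero_dimensional_space X \<longleftrightarrow>
    (\<exists>\<B>. (\<forall>V \<in> \<B>. openin X V \<and> closedin X V) \<and>
         (\<forall>U x. openin X U \<and> x \<in> U \<longrightarrow> (\<exists>V \<in> \<B>. x \<in> V \<and> V \<subseteq> U)))"

(* Continuous maps between carrier-based spaces are represented by functions that are
   undefined outside the carrier, so that maps agreeing on the space are equal. *)
definition continuous_maps :: "'a topology \<Rightarrow> 'b topology \<Rightarrow> ('a \<Rightarrow> 'b) set"
  where "continuous_maps X Y = {f \<in> extensional (topspace X). continuous_map X Y f}"

definition compact_open_topology :: "'a topology \<Rightarrow> 'b topology \<Rightarrow> ('a \<Rightarrow> 'b) topology"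
  where "compact_open_topology X Y = topology_generated_by
    {{f \<in> continuous_maps X Y. f ` K \<subseteq> U} | K U. compactin X K \<and> openin Y U}"

lemma topspace_compact_open_topology [simp]:
  "topspace (compact_open_topology X Y) = continuous_maps X Y"
proof -
  have "continuous_maps X Y \<in>
      {{f \<in> continuous_maps X Y. f ` K \<subseteq> U} | K U. compactin X K \<and> openin Y U}"
    by (rule CollectI, intro exI[where x="{}"]) auto
  then show ?thesis
    unfolding compact_open_topology_def topology_generated_by_topspace by blast
qed

definition Ck :: "'a topology \<Rightarrow> ('a \<Rightarrow> real) topology"
  where "Ck Z = compact_open_topology Z euclideanreal"

definition Ck2 :: "'a topology \<Rightarrow> ('a \<Rightarrow> nat) topology"
  where "Ck2 X = compact_open_topology X (discrete_topology {0, 1})"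

(* A cluster point of A is a point of the closure of A.  Reading it as an accumulation point
   gives the same notion: for a point of A itself the constant sequence converges. *)
definition Frechet_Urysohn_space :: "'a topology \<Rightarrow> bool"
  where "Frechet_Urysohn_space Z \<longleftrightarrow>
    (\<forall>A a. A \<subseteq> topspace Z \<and> a \<in> Z closure_of A \<longrightarrow>
      (\<exists>s :: nat \<Rightarrow> 'a. range s \<subseteq> A \<and> limitin Z s a sequentially))"

definition sequential_space :: "'a topology \<Rightarrow> bool"
  where "sequential_space Z \<longleftrightarrow>
    (\<forall>A. A \<subseteq> topspace Z \<and> \<not> closedin Z A \<longrightarrow>
      (\<exists>s :: nat \<Rightarrow> 'a. \<exists>a \<in> Z closure_of A - A. range s \<subseteq> A \<and> limitin Z s a sequentially))"

definition kR_space :: "'a topology \<Rightarrow> bool"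
  where "kR_space Z \<longleftrightarrow>
    (\<forall>f :: 'a \<Rightarrow> real. continuous_map Z euclideanreal f \<longleftrightarrow>
      (\<forall>K. compactin Z K \<longrightarrow> continuous_map (subtopology Z K) euclideanreal f))"

definition evenly_continuous :: "'a topology \<Rightarrow> ('a \<Rightarrow> real) set \<Rightarrow> bool"
  where "evenly_continuous Z \<K> \<longleftrightarrow>
    continuous_map (prod_topology Z (subtopology (Ck Z) \<K>)) euclideanreal (\<lambda>(z, f). f z)"

definition Ascoli_space :: "'a topology \<Rightarrow> bool"
  where "Ascoli_space Z \<longleftrightarrow> regular_space Z \<and> Hausdorff_space Z \<and>
    (\<forall>\<K>. compactin (Ck Z) \<K> \<longrightarrow> evenly_continuous Z \<K>)"

definition Polish_space :: "'a topology \<Rightarrow> bool"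
  where "Polish_space X \<longleftrightarrow> separable_space X \<and> completely_metrizable_space X"

definition topological_sum_of :: "'a topology \<Rightarrow> 'a set \<Rightarrow> 'a set \<Rightarrow> bool"
  where "topological_sum_of X L D \<longleftrightarrow> topspace X = L \<union> D \<and> L \<inter> D = {} \<and>
    (\<forall>U \<subseteq> topspace X. openin X U \<longleftrightarrow>
      openin (subtopology X L) (U \<inter> L) \<and> openin (subtopology X D) (U \<inter> D))"

end

theory Submission
  imports Defs
begin

text \<open>The sets \<open>agree X K f\<close> of maps that coincide with \<open>f\<close> on a compact set \<open>K\<close> form a base of
  clopen neighbourhoods of \<open>f\<close> in \<open>Ck2 X\<close>. A compact set of maps is equicontinuous: near each point
  of \<open>X\<close> all its members are constant on a common ball; conversely, the maps that are constant on
  prescribed neighbourhoods form a compact set.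

  If \<open>X\<close> fails to be locally compact at \<open>x\<^sub>0\<close> and \<open>X'\<close> contains a closed discrete sequence
  \<open>y\<^sub>n\<close>, then maps that see both a closed discrete sequence near \<open>x\<^sub>0\<close> and a sequence converging
  to \<open>y\<^sub>n\<close> form clopen sets which accumulate at the zero map although each compact set meets only
  finitely many of them; their indicators contradict the Ascoli property. Every k-space is a
  \<open>k\<^sub>R\<close>-space, and regular Hausdorff \<open>k\<^sub>R\<close>-spaces are Ascoli. A locally compact \<open>X\<close> splits into compact
  open blocks, and \<open>Ck2 X\<close> behaves like a product of discrete spaces, which is a \<open>k\<^sub>R\<close>-space by Noble's
  argument; it contains the non-k-space \<open>\<nat>\<^bsup>\<omega>1\<^esup>\<close>, in effect, unless \<open>X'\<close> is separable. If \<open>X'\<close> is compact,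
  the maps that agree with \<open>f\<close> on \<open>1/n\<close>-neighbourhoods of \<open>X'\<close> form an increasing sequence of compact
  sets which determines the topology near \<open>f\<close>.\<close>

text \<open>The openness proofs share one device. Let \<open>W\<close> have open trace on every
  compact \<open>Q\<close>, so that \<open>Q - W\<close> is compact. If for every finite set of
  points \<open>Q - W\<close> contains a map that agrees with \<open>f\<close> there, it contains
  one that agrees with \<open>f\<close> at all points in question; when such agreement forces
  membership in \<open>W\<close>, this is a contradiction. The work lies in placing the
  approximating maps in one compact \<open>Q\<close>, which is why compact sets of maps are produced
  from prescribed neighbourhoods of constancy.

  If \<open>X'\<close> is compact, its \<open>1/n\<close>-neighbourhoods suffice because two
  continuous two-valued maps that are equal on \<open>X'\<close> are equal on an open set around it.
  Only isolated points lie outside such a neighbourhood, and each stage controls finitely many of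
  them.

  Separability separates the sequential case from the k-space case: a countable dense subset of
  \<open>X\<close> reduces the conditions on maps in a compact set to countably many, while an
  uncountable separated set yields a sequentially closed set of maps that is not closed.\<close>

section \<open>Finite covers and neighbourhoods in the compact-open topology\<close>

lemma compactin_finite_cover:
  assumes K: "compactin X K" and U: "\<forall>x \<in> K. openin X (U x) \<and> x \<in> U x"
  shows "\<exists>F. finite F \<and> F \<subseteq> K \<and> K \<subseteq> \<Union>(U ` F)"
proof -
  have "\<And>T. T \<in> U ` K \<Longrightarrow> openin X T" "K \<subseteq> \<Union>(U ` K)" using U by auto
  from compactinD[OF K this] obtain \<F> where \<F>: "finite \<F>" "\<F> \<subseteq> U ` K" "K \<subseteq> \<Union>\<F>"
    by blast
  from finite_subset_image[OF \<F>(1,2)] obtain F where "F \<subseteq> K" "finite F" "\<F> = U ` F"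
    by blast
  with \<F>(3) show ?thesis by blast
qed

text \<open>A subbasic condition at \<open>f\<close> depends only on the values on its compact set,
  and a finite intersection of conditions is handled by the union of their compact sets. The target
  \<open>Y\<close> is arbitrary here; that agreement is itself an open condition is a feature of
  discrete targets (\<open>openin_agree\<close>).\<close>

lemma compact_open_nbhd:
  assumes "openin (compact_open_topology X Y) W" "f \<in> W"
  shows "\<exists>K. compactin X K \<and> (\<forall>g \<in> continuous_maps X Y. (\<forall>x \<in> K. g x = f x) \<longrightarrow> g \<in> W)"
proof -
  let ?S = "{{f \<in> continuous_maps X Y. f ` K \<subseteq> U} | K U. compactin X K \<and> openin Y U}"
  have "generate_topology_on ?S W"
    using assms(1) by (simp add: compact_open_topology_def openin_topology_generated_by)
  then have "f \<in> W \<longrightarrow> (\<exists>K. compactin X K \<and>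
      (\<forall>g \<in> continuous_maps X Y. (\<forall>x \<in> K. g x = f x) \<longrightarrow> g \<in> W))"
  proof (induction rule: generate_topology_on.induct)
    case (Int a b)
    show ?case
    proof
      assume "f \<in> a \<inter> b"
      then obtain K L where "compactin X K" "compactin X L"
        "\<forall>g \<in> continuous_maps X Y. (\<forall>x \<in> K. g x = f x) \<longrightarrow> g \<in> a"
        "\<forall>g \<in> continuous_maps X Y. (\<forall>x \<in> L. g x = f x) \<longrightarrow> g \<in> b"
        using Int by blast
      then show "\<exists>K. compactin X K \<and>
          (\<forall>g \<in> continuous_maps X Y. (\<forall>x \<in> K. g x = f x) \<longrightarrow> g \<in> a \<inter> b)"
        by (intro exI[of _ "K \<union> L"]) (auto simp: compactin_Un)
    qed
  next
    case (UN \<K>)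
    show ?case
    proof
      assume "f \<in> \<Union>\<K>"
      then obtain k where k: "k \<in> \<K>" "f \<in> k" by auto
      show "\<exists>K. compactin X K \<and>
          (\<forall>g \<in> continuous_maps X Y. (\<forall>x \<in> K. g x = f x) \<longrightarrow> g \<in> \<Union>\<K>)"
        using UN.IH[OF k(1)] k by auto
    qed
  next
    case (Basis s)
    then obtain K U where s: "compactin X K" "s = {f \<in> continuous_maps X Y. f ` K \<subseteq> U}"
      by blast
    show ?case
      using s by (auto intro!: exI[of _ K] simp: image_subset_iff)
  qed simp
  with assms(2) show ?thesis by simp
qed

text \<open>The general target lets this serve twice: for sequences of two-valued maps on
  \<open>X\<close> and for indicator functions on \<open>Ck2 X\<close>. In both cases the terms
  become equal to the limit on each compact set.\<close>

lemma limitin_compact_open: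
  assumes "g \<in> continuous_maps X Y" "\<And>n. s n \<in> continuous_maps X Y"
    and ev: "\<And>K. compactin X K \<Longrightarrow> \<forall>\<^sub>F n in sequentially. \<forall>x \<in> K. s n x = g x"
  shows "limitin (compact_open_topology X Y) s g sequentially"
  unfolding limitin_def
proof (intro conjI allI impI)
  fix W assume "openin (compact_open_topology X Y) W \<and> g \<in> W"
  then obtain K where K: "compactin X K"
    "\<forall>h \<in> continuous_maps X Y. (\<forall>x \<in> K. h x = g x) \<longrightarrow> h \<in> W"
    using compact_open_nbhd[of X Y W g] by auto
  show "\<forall>\<^sub>F n in sequentially. s n \<in> W"
    using ev[OF K(1)] by eventually_elim (simp add: K(2) assms(2))
qed (use assms in simp)

section \<open>Two-valued maps and the clopen base of \<open>Ck2 X\<close>\<close>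

abbreviation maps2 :: "'a topology \<Rightarrow> ('a \<Rightarrow> nat) set"
  where "maps2 X \<equiv> continuous_maps X (discrete_topology {0, 1})"

definition agree :: "'a topology \<Rightarrow> 'a set \<Rightarrow> ('a \<Rightarrow> nat) \<Rightarrow> ('a \<Rightarrow> nat) set"
  where "agree X K f = {g \<in> maps2 X. \<forall>x \<in> K. g x = f x}"

definition clopen_ind :: "'a topology \<Rightarrow> 'a set \<Rightarrow> 'a \<Rightarrow> nat"
  where "clopen_ind X V = (\<lambda>x \<in> topspace X. if x \<in> V then 1 else 0)"

lemma topspace_Ck2 [simp]: "topspace (Ck2 X) = maps2 X"
  by (simp add: Ck2_def)

lemma maps2_value: "\<lbrakk>f \<in> maps2 X; x \<in> topspace X\<rbrakk> \<Longrightarrow> f x = 0 \<or> f x = 1"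
  by (force simp: continuous_maps_def continuous_map_def)

lemma maps2_ext: "\<lbrakk>f \<in> maps2 X; g \<in> maps2 X; \<And>x. x \<in> topspace X \<Longrightarrow> f x = g x\<rbrakk> \<Longrightarrow> f = g"
  by (auto simp: continuous_maps_def intro: extensionalityI)

lemma openin_maps2:
  assumes "f \<in> maps2 X" shows "openin X {x \<in> topspace X. f x \<in> U}"
proof -
  have f: "continuous_map X (discrete_topology {0,1}) f"
    using assms by (simp add: continuous_maps_def)
  have "openin X {x \<in> topspace X. f x \<in> U \<inter> {0,1}}"
    by (rule openin_continuous_map_preimage[OF f]) auto
  moreover have "{x \<in> topspace X. f x \<in> U \<inter> {0,1}} = {x \<in> topspace X. f x \<in> U}"
    using maps2_value[OF assms] by auto
  ultimately show ?thesis by simp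
qed

lemma closedin_maps2:
  assumes "f \<in> maps2 X" shows "closedin X {x \<in> topspace X. f x \<in> U}"
proof -
  have "topspace X - {x \<in> topspace X. f x \<in> U} = {x \<in> topspace X. f x \<in> - U}" by auto
  then show ?thesis
    using openin_maps2[OF assms, of "- U"] by (auto simp: closedin_def)
qed

lemma maps2I:
  assumes "f \<in> extensional (topspace X)" "\<And>x. x \<in> topspace X \<Longrightarrow> f x = 0 \<or> f x = 1"
    and loc: "\<And>x. x \<in> topspace X \<Longrightarrow> \<exists>U. openin X U \<and> x \<in> U \<and> (\<forall>y \<in> U. f y = f x)"
  shows "f \<in> maps2 X"
proof -
  have "openin X {x \<in> topspace X. f x \<in> U}" for U
  proof (subst openin_subopen, clarify)
    fix x assume x: "x \<in> topspace X" "f x \<in> U"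
    obtain V where V: "openin X V" "x \<in> V" "\<forall>y \<in> V. f y = f x"
      using loc[OF x(1)] by auto
    have "V \<subseteq> {x \<in> topspace X. f x \<in> U}"
    proof
      fix y assume y: "y \<in> V"
      then have "f y = f x" using V(3) by blast
      with x(2) y openin_subset[OF V(1)] show "y \<in> {x \<in> topspace X. f x \<in> U}" by auto
    qed
    with V(1,2) show "\<exists>T. openin X T \<and> x \<in> T \<and> T \<subseteq> {x \<in> topspace X. f x \<in> U}"
      by blast
  qed
  moreover have "f \<in> topspace X \<rightarrow> {0, 1}"
    using assms(2) by blast
  ultimately show ?thesis
    using assms(1) by (simp add: continuous_maps_def continuous_map_def)
qed

lemma maps2_combine:
  assumes "f \<in> maps2 X" "g \<in> maps2 X" "openin X V" "closedin X V"
  shows "(\<lambda>x \<in> topspace X. if x \<in> V then f x else g x) \<in> maps2 X" (is "?h \<in> _")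
proof (rule maps2I)
  fix x assume x: "x \<in> topspace X"
  show "?h x = 0 \<or> ?h x = 1"
    using maps2_value[OF assms(1) x] maps2_value[OF assms(2) x] x by auto
  show "\<exists>U. openin X U \<and> x \<in> U \<and> (\<forall>y \<in> U. ?h y = ?h x)"
  proof (cases "x \<in> V")
    case True
    have "openin X ({y \<in> topspace X. f y \<in> {f x}} \<inter> V)"
      using assms openin_maps2 by blast
    with x True show ?thesis
      by (intro exI[of _ "{y \<in> topspace X. f y \<in> {f x}} \<inter> V"]) auto
  next
    case False
    have "openin X ({y \<in> topspace X. g y \<in> {g x}} - V)"
      using assms openin_maps2 by blast
    with x False show ?thesis
      by (intro exI[of _ "{y \<in> topspace X. g y \<in> {g x}} - V"]) auto
  qed
qed simp

lemma clopen_ind_maps2: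
  assumes "openin X V" "closedin X V" shows "clopen_ind X V \<in> maps2 X"
proof -
  have c: "(\<lambda>x \<in> topspace X. c) \<in> maps2 X" if "c = 0 \<or> c = 1" for c :: nat
    using that by (intro maps2I) auto
  have "clopen_ind X V = (\<lambda>x \<in> topspace X. if x \<in> V then (\<lambda>x \<in> topspace X. 1) x else (\<lambda>x \<in> topspace X. 0) x)"
    by (auto simp: clopen_ind_def restrict_def)
  with maps2_combine[OF c[of 1] c[of 0] assms] show ?thesis by simp
qed

lemma agree_self: "f \<in> maps2 X \<Longrightarrow> f \<in> agree X K f"
  by (simp add: agree_def)

text \<open>\<open>f\<close> splits \<open>K\<close> into the compact parts where it is 0 and where
  it is 1. Agreement with \<open>f\<close> on \<open>K\<close> means that each part is sent into the
  open singleton of its value, which is a pair of subbasic conditions.\<close>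

lemma openin_agree:
  assumes K: "compactin X K" and f: "f \<in> maps2 X"
  shows "openin (Ck2 X) (agree X K f)"
proof -
  let ?B = "\<lambda>c. {g \<in> maps2 X. g ` (K \<inter> {x \<in> topspace X. f x \<in> {c}}) \<subseteq> {c}}"
  have KX: "K \<subseteq> topspace X" by (rule compactin_subset_topspace[OF K])
  have "compactin X (K \<inter> {x \<in> topspace X. f x \<in> {c}})" for c
    using closed_Int_compactin[OF closedin_maps2[OF f, of "{c}"] K] by (simp add: Int_commute)
  moreover have "openin (discrete_topology {0, 1}) {c}" if "c \<in> {0,1}" for c :: nat
    using that by simp
  ultimately have "openin (Ck2 X) (?B c)" if "c \<in> {0,1}" for c
    unfolding Ck2_def compact_open_topology_def using that
    by (intro topology_generated_by_Basis CollectI exI conjI) auto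
  then have "openin (Ck2 X) (?B 0 \<inter> ?B 1)"
    by (intro openin_Int) auto
  moreover have "?B 0 \<inter> ?B 1 = agree X K f"
    using KX maps2_value[OF f] by (fastforce simp: agree_def)
  ultimately show ?thesis by simp
qed

lemma openin_Ck2:
  "openin (Ck2 X) W \<longleftrightarrow>
    W \<subseteq> maps2 X \<and> (\<forall>f \<in> W. \<exists>K. compactin X K \<and> agree X K f \<subseteq> W)"
proof
  assume L: "openin (Ck2 X) W"
  have "\<exists>K. compactin X K \<and> agree X K f \<subseteq> W" if "f \<in> W" for f
    using compact_open_nbhd[OF L[unfolded Ck2_def] that] unfolding agree_def by blast
  with openin_subset[OF L] show "W \<subseteq> maps2 X \<and> (\<forall>f \<in> W. \<exists>K. compactin X K \<and> agree X K f \<subseteq> W)"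
    by simp
next
  assume R: "W \<subseteq> maps2 X \<and> (\<forall>f \<in> W. \<exists>K. compactin X K \<and> agree X K f \<subseteq> W)"
  show "openin (Ck2 X) W"
  proof (subst openin_subopen, intro ballI)
    fix f assume "f \<in> W"
    with R obtain K where "compactin X K" "agree X K f \<subseteq> W" "f \<in> maps2 X" by blast
    then show "\<exists>T. openin (Ck2 X) T \<and> f \<in> T \<and> T \<subseteq> W"
      by (meson openin_agree agree_self)
  qed
qed

text \<open>A finite set is compact, and agreement on \<open>F\<close> preserves the condition. As
  \<open>P\<close> is an arbitrary predicate, the complement has the same form; such sets are
  therefore clopen, which makes their indicators continuous in the Ascoli argument.\<close>

lemma openin_Ck2_finite_cond:
  assumes "finite F" "F \<subseteq> topspace X"
  shows "openin (Ck2 X) {h \<in> maps2 X. P (restrict h F)}"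
  unfolding openin_Ck2
proof (intro conjI ballI)
  fix h assume h: "h \<in> {h \<in> maps2 X. P (restrict h F)}"
  have "g \<in> {h \<in> maps2 X. P (restrict h F)}" if "g \<in> agree X F h" for g
  proof -
    have "restrict g F = restrict h F" using that by (auto simp: agree_def)
    with that h show ?thesis by (auto simp: agree_def)
  qed
  then show "\<exists>K. compactin X K \<and> agree X K h \<subseteq> {h \<in> maps2 X. P (restrict h F)}"
    using assms by (intro exI[of _ F]) (auto intro: finite_imp_compactin)
qed auto

lemma closedin_Ck2_finite_cond:
  assumes "finite F" "F \<subseteq> topspace X"
  shows "closedin (Ck2 X) {h \<in> maps2 X. P (restrict h F)}"
proof -
  have "maps2 X - {h \<in> maps2 X. P (restrict h F)} = {h \<in> maps2 X. \<not> P (restrict h F)}" by auto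
  then show ?thesis
    using openin_Ck2_finite_cond[OF assms, of "\<lambda>u. \<not> P u"] by (auto simp: closedin_def)
qed

text \<open>An intersection of conditions at single points, each of them clopen. \<open>S\<close>
  may be non-compact; the k-space proofs use open sets such as
  \<open>\<Union>(range K)\<close>.\<close>

lemma closedin_Ck2_points:
  assumes "S \<subseteq> topspace X" "f \<in> maps2 X"
  shows "closedin (Ck2 X) (agree X S f)"
proof -
  have *: "closedin (Ck2 X) {h \<in> maps2 X. h x = f x}" if "x \<in> topspace X" for x
    using closedin_Ck2_finite_cond[of "{x}" X "\<lambda>u. u x = f x"] that by simp
  show ?thesis
  proof (cases "S = {}")
    case True
    then show ?thesis
      using closedin_topspace[of "Ck2 X"] by (simp add: agree_def)
  next
    case False
    then have "agree X S f = (\<Inter>x \<in> S. {h \<in> maps2 X. h x = f x})"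
      by (auto simp: agree_def)
    moreover have "closedin (Ck2 X) (\<Inter>x \<in> S. {h \<in> maps2 X. h x = f x})"
      using False * assms(1) by (intro closedin_INT) (use subsetD in \<open>fastforce+\<close>)
    ultimately show ?thesis by simp
  qed
qed

lemma Hausdorff_Ck2: "Hausdorff_space (Ck2 X)"
  unfolding Hausdorff_space_def
proof (intro allI impI, elim conjE)
  fix f g assume fg: "f \<in> topspace (Ck2 X)" "g \<in> topspace (Ck2 X)" "f \<noteq> g"
  then obtain x where x: "x \<in> topspace X" "f x \<noteq> g x"
    using maps2_ext[of f X g] by auto
  show "\<exists>U V. openin (Ck2 X) U \<and> openin (Ck2 X) V \<and> f \<in> U \<and> g \<in> V \<and> disjnt U V"
    using x fg openin_agree[of X "{x}" f] openin_agree[of X "{x}" g]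
    by (intro exI[of _ "agree X {x} f"] exI[of _ "agree X {x} g"])
      (auto simp: agree_def disjnt_def)
qed

lemma regular_Ck2: "regular_space (Ck2 X)"
  unfolding regular_space_def
proof (intro allI impI, elim conjE)
  fix C f assume C: "closedin (Ck2 X) C" "f \<in> topspace (Ck2 X) - C"
  have "openin (Ck2 X) (maps2 X - C)"
    using C(1) by (metis openin_diff openin_topspace topspace_Ck2)
  moreover have "f \<in> maps2 X - C" using C(2) by simp
  ultimately obtain K where K: "compactin X K" "agree X K f \<subseteq> maps2 X - C"
    unfolding openin_Ck2 by blast
  have f: "f \<in> maps2 X" using C by simp
  have "closedin (Ck2 X) (agree X K f)"
    by (rule closedin_Ck2_points[OF compactin_subset_topspace[OF K(1)] f])
  then have "openin (Ck2 X) (maps2 X - agree X K f)"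
    by (metis openin_diff openin_topspace topspace_Ck2)
  moreover have "C \<subseteq> maps2 X - agree X K f"
    using closedin_subset[OF C(1)] K(2) by auto
  ultimately show "\<exists>U V. openin (Ck2 X) U \<and> openin (Ck2 X) V \<and> f \<in> U \<and> C \<subseteq> V \<and> disjnt U V"
    using openin_agree[OF K(1) f] agree_self[OF f]
    by (intro exI[of _ "agree X K f"] exI[of _ "maps2 X - agree X K f"]) (simp add: disjnt_def)
qed

lemma limitin_Ck2_agree:
  assumes lim: "limitin (Ck2 X) s f sequentially" and K: "compactin X K"
  shows "\<forall>\<^sub>F n in sequentially. \<forall>x \<in> K. s n x = f x"
proof -
  have f: "f \<in> maps2 X" using limitin_topspace[OF lim] by simp
  have "\<forall>\<^sub>F n in sequentially. s n \<in> agree X K f"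
    using lim openin_agree[OF K f] agree_self[OF f] by (auto simp: limitin_def)
  then show ?thesis by (auto simp: agree_def elim: eventually_mono)
qed

text \<open>The finite intersection property of the closed sets \<open>agree X {x} f\<close> inside
  \<open>Q\<close>. It turns approximation on finite sets into exact agreement on \<open>S\<close>,
  however large \<open>S\<close> is.\<close>

lemma compact_Ck2_pointwise:
  assumes Q: "compactin (Ck2 X) Q" and S: "S \<subseteq> topspace X" and f: "f \<in> maps2 X"
    and fin: "\<And>F. \<lbrakk>finite F; F \<subseteq> S\<rbrakk> \<Longrightarrow> \<exists>h \<in> Q. \<forall>x \<in> F. h x = f x"
  shows "\<exists>h \<in> Q. \<forall>x \<in> S. h x = f x"
proof (rule ccontr)
  assume neg: "\<not> ?thesis"
  have Qm: "Q \<subseteq> maps2 X" using compactin_subset_topspace[OF Q] by simp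
  define D where "D x = maps2 X - agree X {x} f" for x
  have "openin (Ck2 X) (D x)" if "x \<in> S" for x
    unfolding D_def using closedin_Ck2_points[of "{x}" X f] that S f
    by (metis empty_subsetI insert_subset openin_diff openin_topspace subsetD topspace_Ck2)
  moreover have "Q \<subseteq> \<Union>(D ` S)"
  proof
    fix h assume h: "h \<in> Q"
    with neg obtain x where "x \<in> S" "h x \<noteq> f x" by blast
    with h Qm show "h \<in> \<Union>(D ` S)" by (auto simp: D_def agree_def)
  qed
  ultimately obtain \<F> where "finite \<F>" "\<F> \<subseteq> D ` S" "Q \<subseteq> \<Union>\<F>"
    using compactinD[OF Q, of "D ` S"] by blast
  then obtain F where F: "finite F" "F \<subseteq> S" "Q \<subseteq> \<Union>(D ` F)"
    by (metis finite_subset_image)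
  with fin obtain h where h: "h \<in> Q" "\<forall>x \<in> F. h x = f x" by blast
  with F(3) show False by (auto simp: D_def agree_def)
qed

section \<open>Sequential, k-, \<open>k\<^sub>R\<close>- and Ascoli spaces\<close>

lemma continuous_map_real_iff:
  "continuous_map Z euclideanreal h \<longleftrightarrow>
    (\<forall>z \<in> topspace Z. \<forall>\<epsilon>>0. \<exists>U. openin Z U \<and> z \<in> U \<and> (\<forall>y \<in> U. \<bar>h y - h z\<bar> < \<epsilon>))"
  using Met_TC.continuous_map_to_metric[of Z h]
  by (simp add: dist_real_def abs_minus_commute)

lemma sequential_imp_k_space:
  assumes "sequential_space Z" shows "k_space Z"
  unfolding k_space
proof (intro allI impI, elim conjE)
  fix S assume S: "S \<subseteq> topspace Z"
    "\<forall>K. compactin Z K \<longrightarrow> closedin (subtopology Z K) (K \<inter> S)"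
  show "closedin Z S"
  proof (rule ccontr)
    assume "\<not> closedin Z S"
    with assms S(1) obtain s :: "nat \<Rightarrow> 'a" and a
      where sa: "a \<in> Z closure_of S - S" "range s \<subseteq> S" "limitin Z s a sequentially"
      unfolding sequential_space_def by meson
    \<comment> \<open>A convergent sequence together with its limit is the compact set on which the
      trace of \<open>S\<close> fails to be closed.\<close>
    let ?K = "insert a (range s)"
    have "compactin Z ?K"
      using sa S(1) by (intro compactin_sequence_with_limit) auto
    with S(2) have "closedin (subtopology Z ?K) (?K \<inter> S)" by blast
    moreover have "limitin (subtopology Z ?K) s a sequentially"
      using sa(3) by (simp add: limitin_subtopology)
    ultimately have "a \<in> ?K \<inter> S"
      using sa(2) limitin_closedin[of "subtopology Z ?K" s a sequentially "?K \<inter> S"]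
      by (simp add: image_subset_iff)
    with sa(1) show False by simp
  qed
qed

lemma k_space_imp_kR_space:
  assumes "k_space Z" shows "kR_space Z"
  unfolding kR_space_def
  using continuous_map_from_k_space[OF assms, where Y = euclideanreal] continuous_map_from_subtopology
  by blast

lemma Frechet_Urysohn_imp_sequential:
  assumes "Frechet_Urysohn_space Z" shows "sequential_space Z"
  unfolding sequential_space_def
proof (intro allI impI, elim conjE)
  fix A assume A: "A \<subseteq> topspace Z" "\<not> closedin Z A"
  then obtain a where "a \<in> Z closure_of A" "a \<notin> A"
    using closure_of_eq[of Z A] closure_of_subset[of A Z] by blast
  with assms A(1) show "\<exists>s :: nat \<Rightarrow> _. \<exists>a \<in> Z closure_of A - A. range s \<subseteq> A \<and> limitin Z s a sequentially"
    unfolding Frechet_Urysohn_space_def by blast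
qed

lemma metrizable_imp_Frechet_Urysohn:
  assumes "metrizable_space Z" shows "Frechet_Urysohn_space Z"
proof -
  obtain M d where Md: "Metric_space M d" and Z: "Z = Metric_space.mtopology M d"
    using assms unfolding metrizable_space_def by blast
  interpret Metric_space M d by fact
  show ?thesis
    unfolding Frechet_Urysohn_space_def Z closure_of_sequentially by auto
qed

lemma Ck_uniform_nbhd:
  assumes C: "compactin Z C" and g: "g \<in> continuous_maps Z euclideanreal" and "0 < \<epsilon>"
  obtains O' where "openin (Ck Z) O'" "g \<in> O'" "\<And>h x. h \<in> O' \<Longrightarrow> x \<in> C \<Longrightarrow> \<bar>h x - g x\<bar> < \<epsilon>"
proof -
  have gc: "continuous_map Z euclideanreal g"
    using g by (simp add: continuous_maps_def)
  have CZ: "C \<subseteq> topspace Z" by (rule compactin_subset_topspace[OF C])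
  define N where "N x = {z \<in> topspace Z. g z \<in> ball (g x) (\<epsilon>/3)}" for x
  have "openin Z (N x)" for x
    unfolding N_def by (rule openin_continuous_map_preimage[OF gc]) simp
  then have "\<forall>x \<in> C. openin Z (N x) \<and> x \<in> N x"
    using CZ \<open>0 < \<epsilon>\<close> by (auto simp: N_def)
  from compactin_finite_cover[OF C this] obtain F where F: "finite F" "F \<subseteq> C" "C \<subseteq> \<Union>(N ` F)"
    by blast
  \<comment> \<open>The closed ball of radius \<epsilon>/3 keeps \<open>P x\<close> compact, and the
    larger open ball of radius \<epsilon>/2 in \<open>B x\<close> makes \<open>g\<close> itself a
    member of \<open>B x\<close>. The two radii add up to less than \<epsilon>.\<close>
  define P where "P x = C \<inter> {z \<in> topspace Z. g z \<in> cball (g x) (\<epsilon>/3)}" for x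
  define B where "B x = {h \<in> continuous_maps Z euclideanreal. h ` P x \<subseteq> ball (g x) (\<epsilon>/2)}" for x
  have "closedin Z {z \<in> topspace Z. g z \<in> cball (g x) (\<epsilon>/3)}" for x
    by (rule closedin_continuous_map_preimage[OF gc]) simp
  then have "compactin Z (P x)" for x
    unfolding P_def Int_commute[of C] by (rule closed_Int_compactin[OF _ C])
  then have Bo: "openin (Ck Z) (B x)" for x
    unfolding Ck_def compact_open_topology_def B_def
    by (intro topology_generated_by_Basis) auto
  have gB: "g \<in> B x" for x
    using g \<open>0 < \<epsilon>\<close> by (auto simp: B_def P_def)
  show thesis
  proof
    show "openin (Ck Z) (continuous_maps Z euclideanreal \<inter> \<Inter>(B ` F))"
      using Bo F(1) openin_topspace[of "Ck Z"]
      by (cases "F = {}") (auto simp: Ck_def intro!: openin_Int openin_INT2)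
    show "g \<in> continuous_maps Z euclideanreal \<inter> \<Inter>(B ` F)"
      using g gB by blast
    show "\<bar>h x - g x\<bar> < \<epsilon>"
      if h: "h \<in> continuous_maps Z euclideanreal \<inter> \<Inter>(B ` F)" and x: "x \<in> C" for h x
    proof -
      obtain y where y: "y \<in> F" "x \<in> N y" using F(3) x by blast
      then have "x \<in> P y" using x by (auto simp: N_def P_def)
      moreover have "h \<in> B y" using h y by blast
      ultimately have "h x \<in> ball (g y) (\<epsilon>/2)" by (auto simp: B_def)
      then have "\<bar>g y - h x\<bar> < \<epsilon>/2" by (simp add: dist_real_def)
      moreover have "\<bar>g y - g x\<bar> < \<epsilon>/3" using y(2) by (simp add: N_def dist_real_def)
      ultimately show ?thesis using \<open>0 < \<epsilon>\<close> by linarith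
    qed
  qed
qed

text \<open>Noble's argument: for compact \<open>Q\<close>, the function \<open>z \<mapsto> sup {\<bar>g z - g z\<^sub>0\<bar>. g \<in> Q}\<close>
  is continuous on every compact set, hence continuous.\<close>

lemma kR_space_imp_Ascoli:
  assumes kR: "kR_space Z" and "regular_space Z" "Hausdorff_space Z"
  shows "Ascoli_space Z"
proof -
  have "evenly_continuous Z Q" if Q: "compactin (Ck Z) Q" for Q
  proof -
    let ?CM = "continuous_maps Z euclideanreal"
    have QC: "Q \<subseteq> ?CM"
      using compactin_subset_topspace[OF Q] by (simp add: Ck_def)
    \<comment> \<open>\<open>Q\<close> is totally bounded for the uniform distance on each compact
      set.\<close>
    have net: "\<exists>G. finite G \<and> G \<subseteq> Q \<and> (\<forall>h \<in> Q. \<exists>g \<in> G. \<forall>x \<in> C. \<bar>h x - g x\<bar> < \<epsilon>)"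
      if C: "compactin Z C" and "0 < \<epsilon>" for C \<epsilon>
    proof -
      have "\<exists>O'. openin (Ck Z) O' \<and> g \<in> O' \<and> (\<forall>h \<in> O'. \<forall>x \<in> C. \<bar>h x - g x\<bar> < \<epsilon>)"
        if "g \<in> Q" for g
      proof -
        have "g \<in> ?CM" using that QC by blast
        then show ?thesis using Ck_uniform_nbhd[OF C _ \<open>0 < \<epsilon>\<close>, of g] by metis
      qed
      then obtain O' where O': "\<And>g. g \<in> Q \<Longrightarrow> openin (Ck Z) (O' g)" "\<And>g. g \<in> Q \<Longrightarrow> g \<in> O' g"
        "\<And>g h x. g \<in> Q \<Longrightarrow> h \<in> O' g \<Longrightarrow> x \<in> C \<Longrightarrow> \<bar>h x - g x\<bar> < \<epsilon>"
        by metis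
      then have "\<forall>g \<in> Q. openin (Ck Z) (O' g) \<and> g \<in> O' g" by blast
      from compactin_finite_cover[OF Q this] obtain G where "finite G" "G \<subseteq> Q" "Q \<subseteq> \<Union>(O' ` G)"
        by blast
      with O'(3) show ?thesis by (intro exI[of _ G]) blast
    qed
    have "\<exists>U. openin (prod_topology Z (subtopology (Ck Z) Q)) U \<and> (z0, g0) \<in> U \<and>
            (\<forall>(z, g) \<in> U. \<bar>g z - g0 z0\<bar> < \<epsilon>)"
      if z0: "z0 \<in> topspace Z" and g0: "g0 \<in> Q" and "0 < \<epsilon>" for z0 g0 \<epsilon>
    proof -
      define H where "H z = (SUP g\<in>Q. \<bar>g z - g z0\<bar>)" for z
      \<comment> \<open>The supremum is finite by a 1-net on the two points \<open>z\<close> and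
        \<open>z0\<close>: replacing \<open>h\<close> by a net element costs less than 1 at each of
        them, hence the summand 2, and the sum over \<open>G\<close> bounds all net elements at
        once.\<close>
      have bdd: "bdd_above ((\<lambda>g. \<bar>g z - g z0\<bar>) ` Q)" if z: "z \<in> topspace Z" for z
      proof -
        have "compactin Z {z, z0}" using z z0 by (auto intro: finite_imp_compactin)
        then obtain G where G: "finite G" "\<forall>h \<in> Q. \<exists>g \<in> G. \<forall>x \<in> {z, z0}. \<bar>h x - g x\<bar> < 1"
          using net[of "{z, z0}" 1] by auto
        have "\<bar>h z - h z0\<bar> \<le> 2 + (\<Sum>g\<in>G. \<bar>g z - g z0\<bar>)" if "h \<in> Q" for h
        proof -
          obtain g where g: "g \<in> G" "\<bar>h z - g z\<bar> < 1" "\<bar>h z0 - g z0\<bar> < 1"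
            using G(2) \<open>h \<in> Q\<close> by auto
          have "\<bar>g z - g z0\<bar> \<le> (\<Sum>g\<in>G. \<bar>g z - g z0\<bar>)"
            by (rule member_le_sum[OF g(1) _ G(1)]) simp
          with g(2,3) show ?thesis by linarith
        qed
        then show ?thesis by (intro bdd_aboveI2)
      qed
      have "continuous_map (subtopology Z C) euclideanreal H" if C: "compactin Z C" for C
        unfolding continuous_map_real_iff
      proof (intro ballI allI impI)
        fix z1 and e :: real assume z1: "z1 \<in> topspace (subtopology Z C)" and "0 < e"
        then have z1C: "z1 \<in> C" "z1 \<in> topspace Z" by auto
        obtain G where G: "finite G" "G \<subseteq> Q" "\<forall>h \<in> Q. \<exists>g \<in> G. \<forall>x \<in> C. \<bar>h x - g x\<bar> < e/6"
          using net[OF C, of "e/6"] \<open>0 < e\<close> by auto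
        define V where "V = topspace Z \<inter> (\<Inter>g\<in>G. {z \<in> topspace Z. g z \<in> ball (g z1) (e/6)})"
        have "openin Z {z \<in> topspace Z. g z \<in> ball (g z1) (e/6)}" if "g \<in> G" for g
        proof -
          have "continuous_map Z euclideanreal g"
            using that G(2) QC by (auto simp: continuous_maps_def)
          then show ?thesis by (rule openin_continuous_map_preimage) simp
        qed
        then have V: "openin Z V"
          unfolding V_def using G(1) by (cases "G = {}") (auto intro!: openin_Int openin_INT2)
        have z1V: "z1 \<in> V" using z1C \<open>0 < e\<close> by (auto simp: V_def)
        \<comment> \<open>Three errors of e/6: two from the net, one from continuity of the net
          element. Passing to the supremum preserves the weak bound e/2, which is still below
          e.\<close>
        have close: "\<bar>h z - h z1\<bar> \<le> e/2" if z: "z \<in> C \<inter> V" and h: "h \<in> Q" for z h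
        proof -
          obtain g where g: "g \<in> G" "\<forall>x \<in> C. \<bar>h x - g x\<bar> < e/6" using G(3) h by blast
          have "\<bar>g z - g z1\<bar> < e/6"
            using z g(1) by (auto simp: V_def dist_real_def abs_minus_commute)
          moreover have "\<bar>h z - g z\<bar> < e/6" "\<bar>h z1 - g z1\<bar> < e/6" using g(2) z z1C by auto
          ultimately show ?thesis using \<open>0 < e\<close> by linarith
        qed
        have "\<bar>H z - H z1\<bar> < e" if z: "z \<in> C \<inter> V" for z
        proof -
          have zZ: "z \<in> topspace Z" using z by (simp add: V_def)
          have ne: "Q \<noteq> {}" using g0 by blast
          have "H z \<le> H z1 + e/2"
            unfolding H_def[of z]
          proof (rule cSUP_least[OF ne])
            fix h assume h: "h \<in> Q"
            have "\<bar>h z1 - h z0\<bar> \<le> H z1"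
              unfolding H_def by (rule cSUP_upper[OF h bdd[OF z1C(2)]])
            with close[OF z h] show "\<bar>h z - h z0\<bar> \<le> H z1 + e/2" by linarith
          qed
          moreover have "H z1 \<le> H z + e/2"
            unfolding H_def[of z1]
          proof (rule cSUP_least[OF ne])
            fix h assume h: "h \<in> Q"
            have "\<bar>h z - h z0\<bar> \<le> H z"
              unfolding H_def by (rule cSUP_upper[OF h bdd[OF zZ]])
            with close[OF z h] show "\<bar>h z1 - h z0\<bar> \<le> H z + e/2" by linarith
          qed
          ultimately show ?thesis using \<open>0 < e\<close> by linarith
        qed
        with V z1V z1C show "\<exists>U. openin (subtopology Z C) U \<and> z1 \<in> U \<and> (\<forall>y \<in> U. \<bar>H y - H z1\<bar> < e)"
          by (intro exI[of _ "C \<inter> V"]) (auto simp: openin_subtopology_Int2)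
      qed
      then have Hc: "continuous_map Z euclideanreal H"
        using kR by (simp add: kR_space_def)
      have H0: "H z0 = 0"
      proof -
        have "Q \<noteq> {}" using g0 by blast
        then show ?thesis unfolding H_def by simp
      qed
      obtain A where A: "openin Z A" "z0 \<in> A" "\<forall>z \<in> A. \<bar>H z - H z0\<bar> < \<epsilon>/2"
        using Hc[unfolded continuous_map_real_iff, rule_format, OF z0, of "\<epsilon>/2"] \<open>0 < \<epsilon>\<close>
        by auto
      have "compactin Z {z0}" "g0 \<in> ?CM" "0 < \<epsilon>/2" using z0 g0 QC \<open>0 < \<epsilon>\<close> by auto
      then obtain B where B: "openin (Ck Z) B" "g0 \<in> B"
        "\<And>h x. h \<in> B \<Longrightarrow> x \<in> {z0} \<Longrightarrow> \<bar>h x - g0 x\<bar> < \<epsilon>/2"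
        using Ck_uniform_nbhd[of Z "{z0}" g0 "\<epsilon>/2"] by blast
      \<comment> \<open>\<open>H\<close> bounds the change of \<open>g\<close> from
        \<open>z0\<close> to \<open>z\<close> uniformly over \<open>Q\<close>, while
        \<open>B\<close> bounds the distance of \<open>g\<close> from \<open>g0\<close> at the
        single point \<open>z0\<close>.\<close>
      have "\<bar>g z - g0 z0\<bar> < \<epsilon>" if z: "z \<in> A" and g: "g \<in> Q \<inter> B" for z g
      proof -
        have "z \<in> topspace Z" using openin_subset[OF A(1)] z by blast
        then have "\<bar>g z - g z0\<bar> \<le> H z"
          unfolding H_def using g by (intro cSUP_upper bdd) auto
        also have "\<dots> < \<epsilon>/2" using A(3) z H0 by fastforce
        finally show ?thesis using B(3)[of g z0] g by (smt (verit) IntD2 field_sum_of_halves singletonI)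
      qed
      then show ?thesis
        using A B(1,2) g0
        by (intro exI[of _ "A \<times> (Q \<inter> B)"]) (auto simp: openin_prod_Times_iff openin_subtopology_Int2)
    qed
    then show ?thesis
      unfolding evenly_continuous_def continuous_map_real_iff
      by (fastforce simp: Ck_def)
  qed
  with assms show ?thesis by (simp add: Ascoli_space_def)
qed

section \<open>Compact sets of maps and the k-property\<close>

lemma compactin_diff_open:
  assumes "compactin Z K" "openin Z W" shows "compactin Z (K - W)"
proof -
  have "compactin Z ((topspace Z - W) \<inter> K)"
    using assms by (intro closed_Int_compactin) auto
  moreover have "(topspace Z - W) \<inter> K = K - W"
    using compactin_subset_topspace[OF assms(1)] by auto
  ultimately show ?thesis by simp
qed

text \<open>On such a set the compact-open topology coincides with the product topology.\<close>

lemma compactin_Ck2_equicontinuous: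
  assumes U: "\<And>x. x \<in> topspace X \<Longrightarrow> openin X (U x)" "\<And>x. x \<in> topspace X \<Longrightarrow> x \<in> U x"
  shows "compactin (Ck2 X) {h \<in> maps2 X. \<forall>x \<in> topspace X. \<forall>y \<in> U x. h y = h x}" (is "compactin _ ?E")
proof -
  \<comment> \<open>The full product is compact by Tychonoff. Constancy on each \<open>U x\<close>
    is a family of equations between coordinates and already forces continuity, so \<open>?E\<close>
    is closed in the product.\<close>
  define P where "P = product_topology (\<lambda>_::'a. discrete_topology {0, 1::nat}) (topspace X)"
  have tP: "topspace P = (\<Pi>\<^sub>E x\<in>topspace X. {0, 1})" by (simp add: P_def)
  have cP: "compact_space P"
    unfolding P_def compact_space_product_topology by (simp add: compact_space_discrete_topology)
  have proj: "continuous_map P (discrete_topology {0, 1}) (\<lambda>h. h x)" if "x \<in> topspace X" for x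
    unfolding P_def using that by (rule continuous_map_product_projection)
  have UX: "y \<in> topspace X" if "x \<in> topspace X" "y \<in> U x" for x y
    using U(1)[OF that(1)] that openin_subset by blast
  have E_sub: "h \<in> ?E" if "h \<in> topspace P" "\<And>x y. x \<in> topspace X \<Longrightarrow> y \<in> U x \<Longrightarrow> h y = h x" for h
  proof -
    have "h \<in> maps2 X"
    proof (rule maps2I)
      show "h \<in> extensional (topspace X)" using that(1) by (simp add: tP PiE_def)
      show "h x = 0 \<or> h x = 1" if "x \<in> topspace X" for x
        using \<open>h \<in> topspace P\<close> that by (auto simp: tP PiE_def Pi_def)
      show "\<exists>V. openin X V \<and> x \<in> V \<and> (\<forall>y \<in> V. h y = h x)" if "x \<in> topspace X" for x
        using that U[OF that] \<open>\<And>x y. x \<in> topspace X \<Longrightarrow> y \<in> U x \<Longrightarrow> h y = h x\<close> by blast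
    qed
    with that(2) show ?thesis by blast
  qed
  have EP: "?E \<subseteq> topspace P"
    using maps2_value by (fastforce simp: tP PiE_def Pi_def continuous_maps_def)
  have "closedin P ?E"
  proof (subst closedin_def, intro conjI EP)
    show "openin P (topspace P - ?E)"
    proof (subst openin_subopen, intro ballI)
      fix h assume h: "h \<in> topspace P - ?E"
      then obtain x y where xy: "x \<in> topspace X" "y \<in> U x" "h y \<noteq> h x" using E_sub by blast
      let ?T = "topspace P - {g \<in> topspace P. g y = g x}"
      have "closedin P {g \<in> topspace P. g y = g x}"
        using closedin_continuous_maps_eq[OF Hausdorff_space_discrete_topology proj[OF UX[OF xy(1,2)]] proj[OF xy(1)]] .
      then have "openin P ?T" by blast
      moreover have "h \<in> ?T" using h xy(3) by simp
      moreover have "?T \<subseteq> topspace P - ?E" using xy by blast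
      ultimately show "\<exists>T. openin P T \<and> h \<in> T \<and> T \<subseteq> topspace P - ?E" by blast
    qed
  qed
  then have cE: "compactin P ?E"
    using cP closedin_compact_space by blast
  \<comment> \<open>Finitely many \<open>U x\<close> cover a compact \<open>K\<close>, and on each
    of them a member of \<open>?E\<close> is known from its value at \<open>x\<close>. Within
    \<open>?E\<close>, agreement on \<open>K\<close> thus reduces to finitely many
    coordinates.\<close>
  have "continuous_map (subtopology P ?E) (Ck2 X) id"
    unfolding continuous_map_def
  proof (intro conjI allI impI)
    show "id \<in> topspace (subtopology P ?E) \<rightarrow> topspace (Ck2 X)" by auto
    fix W assume W: "openin (Ck2 X) W"
    show "openin (subtopology P ?E) {h \<in> topspace (subtopology P ?E). id h \<in> W}"
    proof (subst openin_subopen, intro ballI)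
      fix f assume f: "f \<in> {h \<in> topspace (subtopology P ?E). id h \<in> W}"
      then have "f \<in> W" by simp
      with W obtain K where K: "compactin X K" "agree X K f \<subseteq> W"
        unfolding openin_Ck2 by blast
      have KX: "K \<subseteq> topspace X" by (rule compactin_subset_topspace[OF K(1)])
      have "\<forall>x \<in> K. openin X (U x) \<and> x \<in> U x" using KX U by auto
      from compactin_finite_cover[OF K(1) this]
      obtain F where F: "finite F" "F \<subseteq> K" "K \<subseteq> \<Union>(U ` F)" by blast
      define T where "T = topspace P \<inter> (\<Inter>x\<in>F. {g \<in> topspace P. g x \<in> {f x}})"
      have "openin P {g \<in> topspace P. g x \<in> {f x}}" if "x \<in> F" for x
      proof (rule openin_continuous_map_preimage[OF proj])
        show "x \<in> topspace X" using that F(2) KX by blast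
        moreover have "f \<in> topspace P" using f by simp
        ultimately show "openin (discrete_topology {0, 1}) {f x}"
          by (auto simp: tP PiE_def Pi_def)
      qed
      then have T: "openin P T"
        unfolding T_def using F(1) by (cases "F = {}") (auto intro!: openin_Int openin_INT2)
      have "g \<in> W" if g: "g \<in> T" "g \<in> ?E" for g
      proof -
        have "g y = f y" if y: "y \<in> K" for y
        proof -
          obtain x where x: "x \<in> F" "y \<in> U x" using F(3) y by blast
          then have xX: "x \<in> topspace X" using F(2) KX by blast
          have "g y = g x" using g(2) xX x(2) by blast
          also have "g x = f x" using g(1) x(1) by (auto simp: T_def)
          also have "f x = f y" using f xX x(2) by auto
          finally show ?thesis .
        qed
        then have "g \<in> agree X K f" using g(2) by (simp add: agree_def)
        with K(2) show ?thesis by blast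
      qed
      moreover have "f \<in> T" using f by (auto simp: T_def)
      ultimately show "\<exists>T. openin (subtopology P ?E) T \<and> f \<in> T \<and>
          T \<subseteq> {h \<in> topspace (subtopology P ?E). id h \<in> W}"
        using T f openin_subset[OF T] by (intro exI[of _ "?E \<inter> T"]) (auto simp: openin_subtopology_Int2)
    qed
  qed
  moreover have "compactin (subtopology P ?E) ?E"
    unfolding compactin_subtopology using cE by blast
  ultimately have "compactin (Ck2 X) (id ` ?E)"
    by (rule image_compactin[rotated])
  then show ?thesis by simp
qed

text \<open>Openness of the trace of \<open>W\<close> on \<open>Q\<close> is passed on as
  compactness of \<open>Q - W\<close>, the form that \<open>compact_Ck2_pointwise\<close>
  consumes.\<close>

lemma k_space_Ck2I:
  assumes "\<And>W f. \<lbrakk>W \<subseteq> maps2 X; \<And>Q. compactin (Ck2 X) Q \<Longrightarrow> compactin (Ck2 X) (Q - W); f \<in> W\<rbrakk>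
    \<Longrightarrow> \<exists>K. compactin X K \<and> agree X K f \<subseteq> W"
  shows "k_space (Ck2 X)"
  unfolding k_space_open
proof (intro allI impI, elim conjE)
  fix W assume W: "W \<subseteq> topspace (Ck2 X)"
    "\<forall>Q. compactin (Ck2 X) Q \<longrightarrow> openin (subtopology (Ck2 X) Q) (Q \<inter> W)"
  have "compactin (Ck2 X) (Q - W)" if Q: "compactin (Ck2 X) Q" for Q
  proof -
    have "compactin (subtopology (Ck2 X) Q) (Q - Q \<inter> W)"
      using Q W(2) by (intro compactin_diff_open) (auto simp: compactin_subtopology)
    then show ?thesis by (simp add: compactin_subtopology Diff_Int)
  qed
  with W(1) assms show "openin (Ck2 X) W" by (simp add: openin_Ck2)
qed

text \<open>Maps that agree on a countable dense set are equal, so on a compact set of maps the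
  neighbourhoods of \<open>f\<close> are governed by countably many finite conditions. A closure
  point of \<open>Q \<inter> A\<close> is then the limit of a sequence from
  \<open>Q \<inter> A\<close>.\<close>

lemma k_space_Ck2_imp_sequential:
  assumes k: "k_space (Ck2 X)" and sep: "separable_space X"
  shows "sequential_space (Ck2 X)"
  unfolding sequential_space_def
proof (intro allI impI, elim conjE)
  fix A assume A: "A \<subseteq> topspace (Ck2 X)" "\<not> closedin (Ck2 X) A"
  then obtain Q where Q: "compactin (Ck2 X) Q" "\<not> closedin (subtopology (Ck2 X) Q) (Q \<inter> A)"
    using k unfolding k_space by blast
  have Qm: "Q \<subseteq> maps2 X" using compactin_subset_topspace[OF Q(1)] by simp
  have "Q \<inter> A \<subseteq> topspace (subtopology (Ck2 X) Q)" using Qm by auto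
  with Q(2) obtain f where "f \<in> subtopology (Ck2 X) Q closure_of (Q \<inter> A)" "f \<notin> Q \<inter> A"
    by (metis closure_of_eq closure_of_subset subsetI subset_antisym)
  then have f: "f \<in> Q" "f \<notin> A" "f \<in> Ck2 X closure_of (Q \<inter> A)"
    by (auto simp: closure_of_subtopology)
  have fm: "f \<in> maps2 X" using f Qm by blast
  obtain D where D: "countable D" "D \<subseteq> topspace X" "X closure_of D = topspace X"
    using sep unfolding separable_space_def by blast
  \<comment> \<open>The first points in an enumeration of \<open>D\<close>; intersecting with
    \<open>D\<close> discards the arbitrary value that \<open>from_nat_into\<close> returns when
    \<open>D\<close> is empty.\<close>
  define F where "F n = D \<inter> from_nat_into D ` {..n::nat}" for n
  have F: "finite (F n)" "F n \<subseteq> D" "F n \<subseteq> topspace X" for n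
    using D(2) by (auto simp: F_def)
  have "\<exists>g. g \<in> Q \<inter> A \<and> g \<in> agree X (F n) f" for n
  proof -
    have "openin (Ck2 X) (agree X (F n) f)"
      using F by (intro openin_agree fm finite_imp_compactin) auto
    with f(3) agree_self[OF fm] show ?thesis unfolding in_closure_of by blast
  qed
  then obtain g where g: "\<And>n. g n \<in> Q \<inter> A" "\<And>n. g n \<in> agree X (F n) f" by metis
  have "limitin (Ck2 X) g f sequentially"
    unfolding limitin_def
  proof (intro conjI allI impI)
    show "f \<in> topspace (Ck2 X)" using fm by simp
    fix W assume W: "openin (Ck2 X) W \<and> f \<in> W"
    show "\<forall>\<^sub>F n in sequentially. g n \<in> W"
    proof (rule ccontr)
      assume neg: "\<not> (\<forall>\<^sub>F n in sequentially. g n \<in> W)"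
      have QW: "compactin (Ck2 X) (Q - W)" using Q(1) W by (intro compactin_diff_open) auto
      \<comment> \<open>Infinitely many \<open>g n\<close> lie outside \<open>W\<close>, and those
        with large index match \<open>f\<close> on \<open>T\<close>. Compactness of
        \<open>Q - W\<close> then yields a map outside \<open>W\<close> that equals \<open>f\<close>
        on the dense set \<open>D\<close>.\<close>
      have fin: "\<exists>h \<in> Q - W. \<forall>x \<in> T. h x = f x" if T: "finite T" "T \<subseteq> D" for T
      proof -
        obtain N where N: "\<And>x. x \<in> T \<Longrightarrow> to_nat_on D x \<le> N"
          using finite_nat_set_iff_bounded_le[of "to_nat_on D ` T"] T(1) by auto
        obtain n where n: "n \<ge> N" "g n \<notin> W"
          using neg by (auto simp: eventually_sequentially)
        have "T \<subseteq> F n"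
        proof
          fix x assume x: "x \<in> T"
          then have "x = from_nat_into D (to_nat_on D x)" using T(2) D(1) by auto
          moreover have "to_nat_on D x \<le> n" using N[OF x] n(1) by linarith
          ultimately show "x \<in> F n" using x T(2) unfolding F_def by blast
        qed
        then have "\<forall>x \<in> T. g n x = f x" using g(2)[of n] unfolding agree_def by blast
        moreover have "g n \<in> Q - W" using g(1)[of n] n(2) by blast
        ultimately show ?thesis by blast
      qed
      obtain h where h: "h \<in> Q - W" "\<And>x. x \<in> D \<Longrightarrow> h x = f x"
        using compact_Ck2_pointwise[OF QW D(2) fm fin] by blast
      have hm: "h \<in> maps2 X" using h(1) Qm by blast
      have "closedin X {x \<in> topspace X. h x = f x}"
        using closedin_continuous_maps_eq[OF Hausdorff_space_discrete_topology, of X "{0,1}" h f] hm fm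
        by (simp add: continuous_maps_def)
      moreover have "D \<subseteq> {x \<in> topspace X. h x = f x}" using h(2) D(2) by auto
      ultimately have "topspace X \<subseteq> {x \<in> topspace X. h x = f x}"
        using closure_of_minimal D(3) by metis
      then have "h = f" by (intro maps2_ext[OF hm fm]) auto
      with h(1) W show False by blast
    qed
  qed
  moreover have "f \<in> Ck2 X closure_of A - A"
    using f closure_of_mono[of "Q \<inter> A" A "Ck2 X"] by blast
  ultimately show "\<exists>s :: nat \<Rightarrow> _. \<exists>a \<in> Ck2 X closure_of A - A. range s \<subseteq> A \<and> limitin (Ck2 X) s a sequentially"
    using g(1) by (intro exI[of _ g] bexI[of _ f]) auto
qed

text \<open>The compact set that shows \<open>W\<close> to be a neighbourhood of \<open>f\<close>
  arises in two stages: a finite \<open>F\<close> is enough in addition to all of \<open>L\<close>,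
  and a single \<open>K n\<close> can then replace \<open>L\<close>.\<close>

lemma k_space_Ck2_exhaustion:
  fixes K :: "nat \<Rightarrow> 'a set"
  assumes K: "\<And>n. compactin X (K n)" "\<And>n. openin X (K n)" "incseq K"
    and iso: "\<And>x. x \<in> topspace X - \<Union>(range K) \<Longrightarrow> openin X {x}"
  shows "k_space (Ck2 X)"
proof (rule k_space_Ck2I)
  fix W f
  assume W: "W \<subseteq> maps2 X" "\<And>Q. compactin (Ck2 X) Q \<Longrightarrow> compactin (Ck2 X) (Q - W)" and fW: "f \<in> W"
  define L where "L = \<Union>(range K)"
  have f: "f \<in> maps2 X" using W fW by blast
  have LX: "L \<subseteq> topspace X" using K(1) compactin_subset_topspace unfolding L_def by blast
  have Lo: "openin X L" unfolding L_def using K(2) by blast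
  have fo: "openin X {y \<in> topspace X. g y \<in> {g x}}" if "g \<in> maps2 X" for g x
    by (rule openin_maps2[OF that])
  obtain m where m: "\<And>x. x \<in> L \<Longrightarrow> x \<in> K (m x)" unfolding L_def by (metis UN_E)
  have H: "compactin (Ck2 X) (agree X L f)"
  proof -
    \<comment> \<open>Maps equal to \<open>f\<close> on \<open>L\<close> are constant there wherever
      \<open>f\<close> is, and points outside \<open>L\<close> are isolated. These neighbourhoods
      thus restrict nothing further, and all of \<open>agree X L f\<close> is compact.\<close>
    define U where "U x = (if x \<in> L then L \<inter> {y \<in> topspace X. f y \<in> {f x}} else {x})" for x
    have "compactin (Ck2 X) {h \<in> maps2 X. \<forall>x \<in> topspace X. \<forall>y \<in> U x. h y = h x}" (is "compactin _ ?E")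
      by (rule compactin_Ck2_equicontinuous) (use Lo fo[OF f] iso L_def in \<open>auto simp: U_def\<close>)
    moreover have "closedin (Ck2 X) (agree X L f)" by (rule closedin_Ck2_points[OF LX f])
    ultimately have "compactin (Ck2 X) (agree X L f \<inter> ?E)" by (intro closed_Int_compactin)
    moreover have "agree X L f \<inter> ?E = agree X L f"
      by (auto simp: agree_def U_def)
    ultimately show ?thesis by simp
  qed
  obtain F where F: "finite F" "F \<subseteq> topspace X" "agree X (L \<union> F) f \<subseteq> W"
  proof (rule ccontr)
    assume "\<not> thesis"
    with that have neg: "\<not> agree X (L \<union> F) f \<subseteq> W" if "finite F" "F \<subseteq> topspace X" for F
      using that by blast
    have fin: "\<exists>h \<in> agree X L f - W. \<forall>x \<in> F. h x = f x" if "finite F" "F \<subseteq> topspace X" for F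
      using neg[OF that] unfolding agree_def by blast
    obtain h where h: "h \<in> agree X L f - W" "\<And>x. x \<in> topspace X \<Longrightarrow> h x = f x"
      using compact_Ck2_pointwise[OF W(2)[OF H] subset_refl f fin] by blast
    then have "h = f" using f by (intro maps2_ext[of h X f]) (auto simp: agree_def)
    with h(1) fW show False by blast
  qed
  have "\<exists>n. agree X (K n \<union> F) f \<subseteq> W"
  proof (rule ccontr)
    assume "\<nexists>n. agree X (K n \<union> F) f \<subseteq> W"
    then have "\<forall>n. \<exists>g. g \<in> agree X (K n \<union> F) f \<and> g \<notin> W" by blast
    then obtain g where g: "\<And>n. g n \<in> agree X (K n \<union> F) f" "\<And>n. g n \<notin> W" by metis
    have gm: "g n \<in> maps2 X" for n using g by (simp add: agree_def)
    \<comment> \<open>One compact set has to contain all \<open>g n\<close>. On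
      \<open>K (m x)\<close> only the maps with \<open>n < m x\<close> can differ from
      \<open>f\<close>, since the others agree with \<open>f\<close> on
      \<open>K n \<supseteq> K (m x)\<close>; the neighbourhood of \<open>x\<close> thus has to
      respect only \<open>f\<close> and finitely many \<open>g n\<close>.\<close>
    define U where "U x = (if x \<in> L then K (m x) \<inter> {y \<in> topspace X. f y \<in> {f x}} \<inter>
        (topspace X \<inter> (\<Inter>n\<in>{..<m x}. {y \<in> topspace X. g n y \<in> {g n x}})) else {x})" for x
    define E where "E = {h \<in> maps2 X. \<forall>x \<in> topspace X. \<forall>y \<in> U x. h y = h x}"
    have "compactin (Ck2 X) E"
      unfolding E_def
    proof (rule compactin_Ck2_equicontinuous)
      fix x assume x: "x \<in> topspace X"
      show "x \<in> U x" using x m by (auto simp: U_def)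
      have "openin X (topspace X \<inter> (\<Inter>n\<in>{..<m x}. {y \<in> topspace X. g n y \<in> {g n x}}))"
        using fo[OF gm] by (cases "{..<m x} = {}") (auto intro!: openin_Int openin_INT2)
      then show "openin X (U x)"
        using K(2) fo[OF f] iso x unfolding L_def U_def by (auto intro!: openin_Int)
    qed
    moreover have gE: "g n \<in> E" for n
    proof -
      have "g n y = g n x" if xy: "x \<in> topspace X" "y \<in> U x" for x y
      proof (cases "x \<in> L")
        case True
        show ?thesis
        proof (cases "n < m x")
          case True
          with xy \<open>x \<in> L\<close> show ?thesis by (auto simp: U_def)
        next
          case False
          then have "K (m x) \<subseteq> K n" using K(3) by (simp add: incseqD)
          moreover have "x \<in> K (m x)" "y \<in> K (m x)" and fyx: "f y = f x" using True xy m by (auto simp: U_def)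
          ultimately have "g n x = f x" "g n y = f y" using g(1)[of n] unfolding agree_def by blast+
          with fyx show ?thesis by simp
        qed
      next
        case False
        with xy(2) show ?thesis by (simp add: U_def)
      qed
      with gm show ?thesis by (simp add: E_def)
    qed
    ultimately have EW: "compactin (Ck2 X) (E - W)" using W(2) by blast
    have fin: "\<exists>h \<in> E - W. \<forall>x \<in> T. h x = f x" if T: "finite T" "T \<subseteq> L \<union> F" for T
    proof -
      have "\<forall>\<^sub>F n in sequentially. x \<in> K n \<union> F" if "x \<in> T" for x
      proof (cases "x \<in> F")
        case False
        then have "x \<in> K (m x)" using that T(2) m by blast
        then have "\<forall>n \<ge> m x. x \<in> K n" using incseqD[OF K(3)] by blast
        then show ?thesis unfolding eventually_sequentially by blast
      qed simp
      then have "\<forall>\<^sub>F n in sequentially. \<forall>x \<in> T. x \<in> K n \<union> F"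
        by (intro eventually_ball_finite T(1)) auto
      then obtain n where "\<forall>x \<in> T. x \<in> K n \<union> F" by (auto simp: eventually_sequentially)
      then have "\<forall>x \<in> T. g n x = f x" using g(1)[of n] unfolding agree_def by blast
      moreover have "g n \<in> E - W" using g(2) gE by blast
      ultimately show ?thesis by blast
    qed
    have LF: "L \<union> F \<subseteq> topspace X" using LX F(2) by blast
    obtain h where h: "h \<in> E - W" "\<And>x. x \<in> L \<union> F \<Longrightarrow> h x = f x"
      using compact_Ck2_pointwise[OF EW LF f fin] by blast
    then have "h \<in> agree X (L \<union> F) f" by (auto simp: E_def agree_def)
    with h(1) F(3) show False by blast
  qed
  then obtain n where "agree X (K n \<union> F) f \<subseteq> W" by blast
  moreover have "compactin X (K n \<union> F)"
    by (rule compactin_Un[OF K(1) finite_imp_compactin[OF F(2,1)]])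
  ultimately show "\<exists>K. compactin X K \<and> agree X K f \<subseteq> W" by blast
qed

section \<open>Clopen neighbourhoods of compact sets, isolated points\<close>

lemma zero_dimensional_compact_clopen:
  assumes zd: "zero_dimensional_space X" and K: "compactin X K" and U: "openin X U" "K \<subseteq> U"
  obtains V where "openin X V" "closedin X V" "K \<subseteq> V" "V \<subseteq> U"
proof -
  obtain \<B> where \<B>: "\<forall>V \<in> \<B>. openin X V \<and> closedin X V"
      "\<forall>U x. openin X U \<and> x \<in> U \<longrightarrow> (\<exists>V \<in> \<B>. x \<in> V \<and> V \<subseteq> U)"
    using zd unfolding zero_dimensional_space_def by blast
  have "\<exists>V. openin X V \<and> closedin X V \<and> x \<in> V \<and> V \<subseteq> U" if "x \<in> K" for x
  proof -
    have "x \<in> U" using that U(2) by blast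
    with \<B>(2) U(1) obtain V where "V \<in> \<B>" "x \<in> V" "V \<subseteq> U" by blast
    with \<B>(1) show ?thesis by blast
  qed
  then obtain V where V: "\<And>x. x \<in> K \<Longrightarrow> openin X (V x) \<and> closedin X (V x) \<and> x \<in> V x \<and> V x \<subseteq> U"
    by metis
  then have "\<forall>x \<in> K. openin X (V x) \<and> x \<in> V x" by blast
  from compactin_finite_cover[OF K this] obtain F where F: "finite F" "F \<subseteq> K" "K \<subseteq> \<Union>(V ` F)"
    by blast
  show thesis
  proof
    show "openin X (\<Union>(V ` F))" using V F(2) by blast
    show "closedin X (\<Union>(V ` F))" using V F(1,2) by (intro closedin_Union) auto
    show "\<Union>(V ` F) \<subseteq> U" using V F(2) by blast
  qed (rule F(3))
qed

lemma locally_compact_compact_clopen: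
  assumes zd: "zero_dimensional_space X" and lc: "locally_compact_space X"
    and K: "compactin X K" and U: "openin X U" "K \<subseteq> U"
  obtains V where "openin X V" "closedin X V" "compactin X V" "K \<subseteq> V" "V \<subseteq> U"
proof -
  have "\<exists>T C. openin X T \<and> compactin X C \<and> x \<in> T \<and> T \<subseteq> C" if "x \<in> K" for x
    using lc that compactin_subset_topspace[OF K] unfolding locally_compact_space_def by blast
  then obtain T C where TC: "\<And>x. x \<in> K \<Longrightarrow> openin X (T x) \<and> compactin X (C x) \<and> x \<in> T x \<and> T x \<subseteq> C x"
    by metis
  then have "\<forall>x \<in> K. openin X (T x) \<and> x \<in> T x" by blast
  from compactin_finite_cover[OF K this] obtain F where F: "finite F" "F \<subseteq> K" "K \<subseteq> \<Union>(T ` F)"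
    by blast
  have "openin X (U \<inter> \<Union>(T ` F))" using TC F(2) U(1) by blast
  then obtain V where V: "openin X V" "closedin X V" "K \<subseteq> V" "V \<subseteq> U \<inter> \<Union>(T ` F)"
    using zero_dimensional_compact_clopen[OF zd K] F(3) U(2) by (metis le_inf_iff)
  have "compactin X (\<Union>(C ` F))" using TC F(1,2) by (intro compactin_Union) auto
  moreover have "V \<subseteq> \<Union>(C ` F)" using V(4) TC F(2) by blast
  ultimately have "compactin X V" using V(2) closed_compactin by blast
  with V that show thesis by blast
qed

lemma isolated_openin:
  assumes "x \<in> topspace X" "x \<notin> X derived_set_of topspace X"
  shows "openin X {x}"
proof -
  obtain T where T: "openin X T" "x \<in> T" "\<forall>y. y \<in> topspace X \<and> y \<in> T \<longrightarrow> y = x"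
    using assms unfolding in_derived_set_of by blast
  then have "T = {x}" using openin_subset[OF T(1)] by blast
  with T(1) show ?thesis by simp
qed

section \<open>Metric spaces: equicontinuity and compact derived sets\<close>

context Metric_space
begin

text \<open>A failure gives \<open>y n\<close> converging to \<open>x\<close> and \<open>F n\<close>
  in \<open>Q\<close> with \<open>F n (y n) \<noteq> F n x\<close>. On the compact set of
  \<open>x\<close> and all \<open>y n\<close>, the members of \<open>Q\<close> have only finitely
  many restrictions, and each of these equals its value at \<open>x\<close> from some index
  on.\<close>

lemma equicontinuous_compactin_Ck2:
  assumes Q: "compactin (Ck2 mtopology) Q" and x: "x \<in> M"
  shows "\<exists>r>0. \<forall>f \<in> Q. \<forall>y \<in> mball x r. f y = f x"
proof (rule ccontr)
  assume neg: "\<not> ?thesis"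
  have "\<exists>f y. f \<in> Q \<and> y \<in> mball x (inverse (Suc n)) \<and> f y \<noteq> f x" for n
  proof -
    have "0 < inverse (real (Suc n))" by simp
    with neg show ?thesis by blast
  qed
  then obtain F y where F: "\<And>n. F n \<in> Q" "\<And>n. y n \<in> mball x (inverse (Suc n))" "\<And>n. F n (y n) \<noteq> F n x"
    by metis
  have lim: "limitin mtopology y x sequentially"
    unfolding limitin_metric
  proof (intro conjI x allI impI)
    fix e :: real assume "0 < e"
    then have "\<forall>\<^sub>F n in sequentially. inverse (real (Suc n)) < e"
      by (rule Archimedean_eventually_inverse[THEN iffD2])
    then show "\<forall>\<^sub>F n in sequentially. y n \<in> M \<and> d (y n) x < e"
    proof eventually_elim
      case (elim n)
      with F(2)[of n] show ?case by (auto simp: commute)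
    qed
  qed
  define K where "K = insert x (range y)"
  have K: "compactin mtopology K"
    unfolding K_def using F(2) by (intro compactin_sequence_with_limit[OF lim]) auto
  have Qm: "Q \<subseteq> maps2 mtopology" using compactin_subset_topspace[OF Q] by simp
  have "\<forall>f \<in> Q. openin (Ck2 mtopology) (agree mtopology K f) \<and> f \<in> agree mtopology K f"
    using Qm openin_agree[OF K] agree_self by blast
  from compactin_finite_cover[OF Q this]
  obtain G where G: "finite G" "G \<subseteq> Q" "Q \<subseteq> \<Union>(agree mtopology K ` G)" by blast
  have "\<forall>\<^sub>F n in sequentially. g (y n) = g x" if "g \<in> G" for g
  proof -
    have "openin mtopology {z \<in> topspace mtopology. g z \<in> {g x}}"
      using that G(2) Qm by (intro openin_maps2) blast
    then have "\<forall>\<^sub>F n in sequentially. y n \<in> {z \<in> topspace mtopology. g z \<in> {g x}}"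
      using lim x unfolding limitin_def by fastforce
    then show ?thesis by eventually_elim simp
  qed
  then have "\<forall>\<^sub>F n in sequentially. \<forall>g \<in> G. g (y n) = g x"
    by (intro eventually_ball_finite G(1)) blast
  then obtain n where n: "\<And>g. g \<in> G \<Longrightarrow> g (y n) = g x"
    by (auto simp: eventually_sequentially)
  obtain g where g: "g \<in> G" "F n \<in> agree mtopology K g" using F(1)[of n] G(3) by blast
  have "F n (y n) = g (y n)" "F n x = g x" using g(2) by (auto simp: agree_def K_def)
  with n[OF g(1)] F(3)[of n] show False by simp
qed

text \<open>The required compact set is \<open>X'\<close> together with finite sets
  \<open>E n\<close> whose new points come ever closer to \<open>X'\<close>: what stage
  \<open>n\<close> adds lies in \<open>U n\<close>.\<close>

lemma k_space_Ck2_compact_derived: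
  assumes cX': "compactin mtopology (mtopology derived_set_of M)"
  shows "k_space (Ck2 mtopology)"
proof (rule k_space_Ck2I)
  fix W f
  assume W: "W \<subseteq> maps2 mtopology" "\<And>Q. compactin (Ck2 mtopology) Q \<Longrightarrow> compactin (Ck2 mtopology) (Q - W)"
    and fW: "f \<in> W"
  have f: "f \<in> maps2 mtopology" using W fW by blast
  define X' where "X' = mtopology derived_set_of M"
  have X'M: "X' \<subseteq> M" unfolding X'_def using derived_set_of_subset_topspace[of mtopology M] by simp
  have iso: "openin mtopology {x}" if "x \<in> M - X'" for x
    using that isolated_openin[of x mtopology] by (simp add: X'_def)
  \<comment> \<open>\<open>U 0\<close> is the whole space, so that the recursion can start from the
    trivial fact that agreement with \<open>f\<close> everywhere forces membership in
    \<open>W\<close>.\<close>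
  define U where "U n = (if n = 0 then M else \<Union>z\<in>X'. mball z (inverse (real n)))" for n
  have UM: "U n \<subseteq> M" and Uo: "openin mtopology (U n)" and X'U: "X' \<subseteq> U n" for n
    using X'M by (auto simp: U_def)
  have Umono: "U n \<subseteq> U m" if "m \<le> n" for m n
  proof (cases "m = 0")
    case False
    then have "inverse (real n) \<le> inverse (real m)" using that by simp
    then have "mball z (inverse (real n)) \<subseteq> mball z (inverse (real m))" for z
      by (rule mball_subset_concentric)
    with False that show ?thesis by (auto simp: U_def simp del: in_mball)
  qed (use UM U_def in auto)
  \<comment> \<open>Compactness of \<open>X'\<close> enters through a Lebesgue number for the single
    open set \<open>T\<close>.\<close>
  have nbhd: "\<exists>n. U n \<subseteq> T" if T: "openin mtopology T" "X' \<subseteq> T" for T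
  proof -
    obtain e where e: "e > 0" "\<And>x. x \<in> X' \<Longrightarrow> mball x e \<subseteq> T"
      using lebesgue_number[of X' "{T}"] cX' T by (auto simp: X'_def)
    obtain n where n: "n \<noteq> 0" "inverse (real n) < e"
      using real_arch_inverse[of e] e(1) by auto
    then have "U n \<subseteq> T" using e(2) mball_subset_concentric[of "inverse (real n)" e] by (fastforce simp: U_def)
    then show ?thesis ..
  qed
  have H: "compactin (Ck2 mtopology) (agree mtopology (U n) f)" for n
  proof -
    define V where "V x = (if x \<in> X' then U n \<inter> {y \<in> topspace mtopology. f y \<in> {f x}} else {x})" for x
    have "compactin (Ck2 mtopology) {h \<in> maps2 mtopology. \<forall>x \<in> topspace mtopology. \<forall>y \<in> V x. h y = h x}"
      (is "compactin _ ?E")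
    proof (rule compactin_Ck2_equicontinuous)
      fix x assume x: "x \<in> topspace mtopology"
      show "openin mtopology (V x)"
        using x iso[of x] Uo openin_maps2[OF f, of "{f x}"] by (auto simp: V_def simp del: singleton_iff)
      show "x \<in> V x" using x X'U by (auto simp: V_def)
    qed
    moreover have "closedin (Ck2 mtopology) (agree mtopology (U n) f)"
      using UM f by (intro closedin_Ck2_points) auto
    ultimately have "compactin (Ck2 mtopology) (agree mtopology (U n) f \<inter> ?E)" by (intro closed_Int_compactin)
    moreover have "agree mtopology (U n) f \<subseteq> ?E"
    proof
      fix g assume g: "g \<in> agree mtopology (U n) f"
      have "g y = g x" if "x \<in> topspace mtopology" "y \<in> V x" for x y
      proof (cases "x \<in> X'")
        case True
        then have "g x = f x" "g y = f y" "f y = f x" using that g X'U by (auto simp: V_def agree_def)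
        then show ?thesis by simp
      qed (use that in \<open>simp add: V_def\<close>)
      with g show "g \<in> ?E" by (auto simp: agree_def)
    qed
    then have "agree mtopology (U n) f \<inter> ?E = agree mtopology (U n) f" by blast
    ultimately show ?thesis by simp
  qed
  define ok where "ok n E \<longleftrightarrow> finite E \<and> E \<subseteq> M \<and> agree mtopology (U n \<union> E) f \<subseteq> W" for n E
  have ok0: "ok 0 {}"
  proof -
    have "g = f" if "g \<in> agree mtopology M f" for g
      using that f by (intro maps2_ext[of g mtopology f]) (auto simp: agree_def)
    with fW show ?thesis by (auto simp: ok_def U_def)
  qed
  \<comment> \<open>If no finite part of \<open>U n\<close> made up for shrinking \<open>U n\<close>
    to \<open>U (Suc n)\<close>, the compact set \<open>agree mtopology (U (Suc n)) f\<close> would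
    contain a map outside \<open>W\<close> that equals \<open>f\<close> on all of
    \<open>U n \<union> E\<close>, against \<open>ok n E\<close>.\<close>
  have step: "\<exists>E'. ok (Suc n) E' \<and> E \<subseteq> E' \<and> E' \<subseteq> E \<union> U n" if E: "ok n E" for E n
  proof (rule ccontr)
    assume neg: "\<not> ?thesis"
    have fin: "\<exists>h \<in> agree mtopology (U (Suc n)) f - W. \<forall>x \<in> F. h x = f x" if F: "finite F" "F \<subseteq> U n \<union> E" for F
    proof -
      have "\<not> ok (Suc n) (E \<union> (F \<inter> U n))" using neg by blast
      moreover have "finite (E \<union> (F \<inter> U n))" "E \<union> (F \<inter> U n) \<subseteq> M"
        using E F(1) UM unfolding ok_def by blast+
      ultimately obtain h where "h \<in> agree mtopology (U (Suc n) \<union> (E \<union> (F \<inter> U n))) f" "h \<notin> W"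
        unfolding ok_def by blast
      with F(2) show ?thesis unfolding agree_def by blast
    qed
    have "U n \<union> E \<subseteq> topspace mtopology" using UM E by (auto simp: ok_def)
    from compact_Ck2_pointwise[OF W(2)[OF H] this f fin] obtain h
      where h: "h \<in> agree mtopology (U (Suc n)) f - W" "\<forall>x \<in> U n \<union> E. h x = f x" by blast
    then have "h \<in> agree mtopology (U n \<union> E) f" unfolding agree_def by blast
    with h(1) E show False unfolding ok_def by blast
  qed
  have "\<exists>E. ok 0 E" using ok0 by blast
  from dependent_nat_choice[of ok "\<lambda>n A B. A \<subseteq> B \<and> B \<subseteq> A \<union> U n", OF this step]
  obtain E where "\<forall>n. ok n (E n) \<and> (E n \<subseteq> E (Suc n) \<and> E (Suc n) \<subseteq> E n \<union> U n)" ..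
  then have E: "ok n (E n)" "E n \<subseteq> E (Suc n) \<and> E (Suc n) \<subseteq> E n \<union> U n" for n by auto
  have Emono: "E m \<subseteq> E n" if "m \<le> n" for m n
    by (rule lift_Suc_mono_le[of E, OF _ that]) (use E(2) in blast)
  have Eup: "E m \<subseteq> E n \<union> U n" if "n \<le> m" for m n
    using that
  proof (induction m rule: dec_induct)
    case (step k)
    with E(2)[of k] Umono[of n k] show ?case by blast
  qed simp
  define K where "K = X' \<union> \<Union>(range E)"
  have EM: "E n \<subseteq> M" for n using E(1) by (simp add: ok_def)
  \<comment> \<open>An open cover of \<open>X'\<close> has a finite subfamily that covers some
    \<open>U n\<close>, and the points of \<open>K\<close> outside \<open>U n\<close> belong to the
    finite set \<open>E n\<close>.\<close>
  have "compactin mtopology K"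
    unfolding compactin_def
  proof (intro conjI allI impI)
    show "K \<subseteq> topspace mtopology" unfolding K_def using X'M EM by auto
    fix \<U> assume \<U>: "Ball \<U> (openin mtopology) \<and> K \<subseteq> \<Union>\<U>"
    then have op: "\<And>T. T \<in> \<U> \<Longrightarrow> openin mtopology T" and cov: "K \<subseteq> \<Union>\<U>" by auto
    have "X' \<subseteq> \<Union>\<U>" using cov by (simp add: K_def)
    then obtain \<V> where \<V>: "finite \<V>" "\<V> \<subseteq> \<U>" "X' \<subseteq> \<Union>\<V>"
      using compactinD[OF cX' op] unfolding X'_def by metis
    have "openin mtopology (\<Union>\<V>)" using op \<V>(2) by blast
    with nbhd \<V>(3) obtain n where n: "U n \<subseteq> \<Union>\<V>" by blast
    have "compactin mtopology (E n)"
      using E(1)[of n] by (intro finite_imp_compactin) (auto simp: ok_def)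
    moreover have "E n \<subseteq> \<Union>\<U>" using cov unfolding K_def by blast
    ultimately obtain \<V>' where \<V>': "finite \<V>'" "\<V>' \<subseteq> \<U>" "E n \<subseteq> \<Union>\<V>'"
      using compactinD[OF _ op] by metis
    have "E m \<subseteq> E n \<union> U n" for m
      using Emono[of m n] Eup[of n m] by (cases "m \<le> n") auto
    then have "K \<subseteq> \<Union>(\<V> \<union> \<V>')"
      using n \<V>(3) \<V>'(3) unfolding K_def by blast
    with \<V> \<V>' show "\<exists>\<F>. finite \<F> \<and> \<F> \<subseteq> \<U> \<and> K \<subseteq> \<Union>\<F>"
      by (intro exI[of _ "\<V> \<union> \<V>'"]) auto
  qed
  moreover have "agree mtopology K f \<subseteq> W"
  proof
    fix g assume g: "g \<in> agree mtopology K f"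
    then have gm: "g \<in> maps2 mtopology" by (simp add: agree_def)
    \<comment> \<open>The set where \<open>g\<close> and \<open>f\<close> coincide, split by value
      to show that it is open. It contains \<open>X'\<close>, hence some \<open>U n\<close>, and
      then \<open>ok n (E n)\<close> applies.\<close>
    let ?T = "{x \<in> topspace mtopology. g x \<in> {0}} \<inter> {x \<in> topspace mtopology. f x \<in> {0}} \<union>
      {x \<in> topspace mtopology. g x \<in> {1}} \<inter> {x \<in> topspace mtopology. f x \<in> {1}}"
    have "openin mtopology ?T"
      by (intro openin_Un openin_Int openin_maps2 gm f)
    moreover have "X' \<subseteq> ?T"
    proof
      fix x assume x: "x \<in> X'"
      then have "g x = f x" "x \<in> topspace mtopology" using g X'M by (auto simp: agree_def K_def)
      with maps2_value[OF f, of x] show "x \<in> ?T" by auto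
    qed
    ultimately obtain n where n: "U n \<subseteq> ?T" using nbhd by blast
    have "g \<in> agree mtopology (U n \<union> E n) f"
      using g n by (auto simp: agree_def K_def)
    with E(1)[of n] show "g \<in> W" unfolding ok_def by blast
  qed
  ultimately show "\<exists>K. compactin mtopology K \<and> agree mtopology K f \<subseteq> W" by blast
qed

section \<open>Sequences that leave every compact set, and separated sets\<close>

text \<open>Take a sequence in \<open>A\<close> without a subsequence that converges in
  \<open>A\<close>. Infinitely many indices with values in a compact \<open>K\<close> would give one
  inside the compact set \<open>A \<inter> K\<close>. Counting indices rather than values also rules
  out repetitions.\<close>

lemma noncompact_sequence:
  assumes A: "closedin mtopology A" "\<not> compactin mtopology A"
  shows "\<exists>s::nat \<Rightarrow> 'a. range s \<subseteq> A \<and> (\<forall>K. compactin mtopology K \<longrightarrow> finite {k. s k \<in> K})"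
proof -
  have "A \<subseteq> M" using closedin_subset[OF A(1)] by simp
  with A(2) obtain s :: "nat \<Rightarrow> 'a" where s: "range s \<subseteq> A"
    "\<And>l r. \<lbrakk>l \<in> A; strict_mono r\<rbrakk> \<Longrightarrow> \<not> limitin mtopology (s \<circ> r) l sequentially"
    unfolding compactin_sequentially by blast
  have "finite {k. s k \<in> K}" if K: "compactin mtopology K" for K
  proof (rule ccontr)
    assume "infinite {k. s k \<in> K}"
    from infinite_enumerate[OF this] obtain r :: "nat \<Rightarrow> nat"
      where r: "strict_mono r" "\<forall>n. r n \<in> {k. s k \<in> K}" by blast
    have "compactin mtopology (A \<inter> K)" using A(1) K by (intro closed_Int_compactin)
    moreover have "range (s \<circ> r) \<subseteq> A \<inter> K" using r(2) s(1) by auto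
    ultimately obtain l r' where l: "l \<in> A \<inter> K" "strict_mono r'" "limitin mtopology ((s \<circ> r) \<circ> r') l sequentially"
      unfolding compactin_sequentially by meson
    then have "limitin mtopology (s \<circ> (r \<circ> r')) l sequentially" by (simp add: comp_assoc)
    with s(2)[of l "r \<circ> r'"] l(1,2) r(1) show False by (simp add: strict_mono_o)
  qed
  with s(1) show ?thesis by blast
qed

lemma not_locally_compact_sequences:
  assumes "\<not> locally_compact_space mtopology"
  shows "\<exists>x0 \<in> M. \<exists>w::nat \<Rightarrow> nat \<Rightarrow> 'a. (\<forall>n k. w n k \<in> mcball x0 (inverse (Suc n))) \<and>
    (\<forall>n K. compactin mtopology K \<longrightarrow> finite {k. w n k \<in> K})"
proof -
  obtain x0 where x0: "x0 \<in> M"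
    and neg: "\<And>U K. \<lbrakk>openin mtopology U; compactin mtopology K; x0 \<in> U\<rbrakk> \<Longrightarrow> \<not> U \<subseteq> K"
    using assms unfolding locally_compact_space_def by auto
  have "\<not> compactin mtopology (mcball x0 (inverse (Suc n)))" for n
    using neg[of "mball x0 (inverse (Suc n))" "mcball x0 (inverse (Suc n))"] x0 mball_subset_mcball by auto
  then have "\<exists>s::nat \<Rightarrow> 'a. range s \<subseteq> mcball x0 (inverse (Suc n)) \<and>
      (\<forall>K. compactin mtopology K \<longrightarrow> finite {k. s k \<in> K})" for n
    by (intro noncompact_sequence) auto
  then obtain w :: "nat \<Rightarrow> nat \<Rightarrow> 'a" where "\<And>n. range (w n) \<subseteq> mcball x0 (inverse (Suc n)) \<and>
      (\<forall>K. compactin mtopology K \<longrightarrow> finite {k. w n k \<in> K})" by metis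
  with x0 show ?thesis by (intro bexI[of _ x0] exI[of _ w]) (auto simp: image_subset_iff)
qed

definition separated_set :: "real \<Rightarrow> 'a set \<Rightarrow> bool"
  where "separated_set \<epsilon> S \<longleftrightarrow> (\<forall>s \<in> S. \<forall>t \<in> S. s \<noteq> t \<longrightarrow> \<epsilon> \<le> d s t)"

text \<open>A maximal \<epsilon>-separated subset, given by Zorn's lemma, is an \<epsilon>-net, and
  the countable nets for \<epsilon> = 1/(n+1) together are dense. This reduces separability to a
  bound on separated sets, which is what the function space arguments provide.\<close>

lemma countable_dense_subset:
  assumes SM: "S \<subseteq> M"
    and cnt: "\<And>\<epsilon> T. \<lbrakk>0 < \<epsilon>; T \<subseteq> S; separated_set \<epsilon> T\<rbrakk> \<Longrightarrow> countable T"
  shows "\<exists>D. countable D \<and> D \<subseteq> S \<and> (\<forall>x \<in> S. \<forall>r>0. \<exists>y \<in> D. d x y < r)"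
proof -
  have "\<exists>T. T \<subseteq> S \<and> separated_set \<epsilon> T \<and> (\<forall>x \<in> S. \<exists>y \<in> T. d x y < \<epsilon>)" if "0 < \<epsilon>" for \<epsilon>
  proof -
    let ?A = "{T. T \<subseteq> S \<and> separated_set \<epsilon> T}"
    have zorn: "\<exists>T \<in> ?A. \<forall>T' \<in> ?A. T \<subseteq> T' \<longrightarrow> T' = T"
    proof (rule subset_Zorn')
      fix C assume C: "subset.chain ?A C"
      show "\<Union>C \<in> ?A"
      proof -
        have "\<epsilon> \<le> d s t" if st: "s \<in> \<Union>C" "t \<in> \<Union>C" "s \<noteq> t" for s t
        proof -
          obtain a b where ab: "a \<in> C" "s \<in> a" "b \<in> C" "t \<in> b" using st by blast
          then have "a \<subseteq> b \<or> b \<subseteq> a" using C by (auto simp: subset_chain_def)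
          then obtain c where c: "c \<in> C" "s \<in> c" "t \<in> c" using ab by blast
          then have "separated_set \<epsilon> c" using C by (auto simp: subset_chain_def)
          with c st(3) show ?thesis by (simp add: separated_set_def)
        qed
        moreover have "\<Union>C \<subseteq> S" using C by (auto simp: subset_chain_def)
        ultimately show ?thesis by (simp add: separated_set_def)
      qed
    qed
    obtain T where "T \<in> ?A" and max: "\<forall>T' \<in> ?A. T \<subseteq> T' \<longrightarrow> T' = T"
      using bexE[OF zorn] .
    then have T: "T \<subseteq> S" "separated_set \<epsilon> T" by auto
    have "\<exists>y \<in> T. d x y < \<epsilon>" if x: "x \<in> S" for x
    proof (rule ccontr)
      assume neg: "\<not> ?thesis"
      then have "separated_set \<epsilon> (insert x T)"
        using T(2) by (auto simp: separated_set_def not_less commute)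
      then have "insert x T \<in> ?A" using T(1) x by simp
      with max have "insert x T = T" by blast
      then have "x \<in> T" by blast
      moreover have "d x x < \<epsilon>" using SM x \<open>0 < \<epsilon>\<close> by (simp add: subsetD)
      ultimately show False using neg by blast
    qed
    with T show ?thesis by blast
  qed
  then have "\<forall>n::nat. \<exists>T. T \<subseteq> S \<and> separated_set (inverse (Suc n)) T \<and> (\<forall>x \<in> S. \<exists>y \<in> T. d x y < inverse (Suc n))"
    by simp
  then obtain T where T: "\<And>n::nat. T n \<subseteq> S" "\<And>n. separated_set (inverse (Suc n)) (T n)"
    "\<And>n x. x \<in> S \<Longrightarrow> \<exists>y \<in> T n. d x y < inverse (Suc n)" by metis
  have "countable (\<Union>(range T))"
    using cnt[OF _ T(1,2)] by (intro countable_UN) simp_all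
  moreover have "\<exists>y \<in> \<Union>(range T). d x y < r" if x: "x \<in> S" and "0 < r" for x r
  proof -
    obtain n :: nat where "inverse (real (Suc n)) < r" using reals_Archimedean \<open>0 < r\<close> by blast
    moreover obtain y where "y \<in> T n" "d x y < inverse (real (Suc n))"
      using T(3)[OF x, of n] by blast
    ultimately show ?thesis by (intro bexI[of _ y]) auto
  qed
  ultimately show ?thesis using T(1) by (intro exI[of _ "\<Union>(range T)"]) auto
qed

text \<open>Take a finite \<epsilon>/4-net of \<open>K\<close>. Each such \<open>s\<close> is at
  distance less than \<epsilon>/2 from a net point, and two points at distance at least \<epsilon>
  cannot share one.\<close>

lemma separated_set_compactin_finite:
  assumes K: "compactin mtopology K" and S: "S \<subseteq> M" "separated_set \<epsilon> S" and "0 < \<epsilon>"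
  shows "finite {s \<in> S. K \<inter> mball s (\<epsilon>/4) \<noteq> {}}"
proof -
  have "mtotally_bounded K" by (rule compactin_imp_mtotally_bounded[OF K])
  then obtain F where F: "finite F" "F \<subseteq> K" "K \<subseteq> (\<Union>x\<in>F. mball x (\<epsilon>/4))"
    unfolding mtotally_bounded_def using \<open>0 < \<epsilon>\<close> by (meson divide_pos_pos zero_less_numeral)
  let ?B = "{s \<in> S. K \<inter> mball s (\<epsilon>/4) \<noteq> {}}"
  have "\<forall>s \<in> ?B. \<exists>x. x \<in> F \<and> d x s < \<epsilon>/2"
  proof
    fix s assume s: "s \<in> ?B"
    obtain p where p: "p \<in> K" "p \<in> mball s (\<epsilon>/4)" using s by blast
    obtain x where x: "x \<in> F" "p \<in> mball x (\<epsilon>/4)" using F(3) p(1) by blast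
    have "d x s \<le> d x p + d s p" using p x by (intro triangle') auto
    with p x show "\<exists>x. x \<in> F \<and> d x s < \<epsilon>/2" by (intro exI[of _ x]) auto
  qed
  from bchoice[OF this] obtain \<phi> where "\<forall>s \<in> ?B. \<phi> s \<in> F \<and> d (\<phi> s) s < \<epsilon>/2" ..
  then have \<phi>: "\<phi> s \<in> F \<and> d (\<phi> s) s < \<epsilon>/2" if "s \<in> ?B" for s using that by blast
  show ?thesis
  proof (rule inj_on_finite[OF _ _ F(1)])
    show "\<phi> ` {s \<in> S. K \<inter> mball s (\<epsilon>/4) \<noteq> {}} \<subseteq> F" using \<phi> by blast
    show "inj_on \<phi> {s \<in> S. K \<inter> mball s (\<epsilon>/4) \<noteq> {}}"
    proof (rule inj_onI, rule ccontr)
      fix s t assume st: "s \<in> {s \<in> S. K \<inter> mball s (\<epsilon>/4) \<noteq> {}}" "t \<in> {s \<in> S. K \<inter> mball s (\<epsilon>/4) \<noteq> {}}"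
        "\<phi> s = \<phi> t" "s \<noteq> t"
      have "\<phi> s \<in> M" using \<phi>[OF st(1)] F(2) compactin_subset_topspace[OF K] by auto
      then have "d s t \<le> d (\<phi> s) s + d (\<phi> s) t" using st S(1) by (intro triangle'') auto
      moreover have "\<epsilon> \<le> d s t" using st S(2) by (auto simp: separated_set_def)
      ultimately show False using \<phi>[OF st(1)] \<phi>[OF st(2)] st(3) by simp
    qed
  qed
qed


section \<open>Necessary conditions on the space\<close>

abbreviation zero_map :: "'a \<Rightarrow> nat"
  where "zero_map \<equiv> clopen_ind mtopology {}"

lemma zero_map_maps2: "zero_map \<in> maps2 mtopology"
  by (rule clopen_ind_maps2) auto

lemma zero_map_eq: "x \<in> M \<Longrightarrow> zero_map x = 0"
  by (simp add: clopen_ind_def)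

lemma clopen_ind_eq: "x \<in> M \<Longrightarrow> clopen_ind mtopology V x = (if x \<in> V then 1 else 0)"
  by (simp add: clopen_ind_def)

lemma separating_clopen_ind:
  assumes zd: "zero_dimensional_space mtopology" and K: "compactin mtopology K"
    and F: "finite F" "F \<subseteq> M" "F \<inter> K = {}"
  obtains f where "f \<in> agree mtopology K zero_map" "\<And>x. x \<in> F \<Longrightarrow> f x = 1"
proof -
  have KM: "K \<subseteq> M" using compactin_subset_topspace[OF K] by simp
  have "closedin mtopology K"
    by (rule compactin_imp_closedin[OF Hausdorff_space_mtopology K])
  then have "openin mtopology (M - K)" by blast
  moreover have "compactin mtopology F" using F(1,2) by (intro finite_imp_compactin) auto
  ultimately obtain V where V: "openin mtopology V" "closedin mtopology V" "F \<subseteq> V" "V \<subseteq> M - K"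
    using zero_dimensional_compact_clopen[OF zd] F(2,3) by (metis Diff_eq_empty_iff Diff_Diff_Int Int_commute Diff_mono Diff_triv order_refl)
  show thesis
  proof
    have "clopen_ind mtopology V x = zero_map x" if "x \<in> K" for x
    proof -
      have "x \<in> M" "x \<notin> V" using that KM V(4) by auto
      then show ?thesis by (simp add: clopen_ind_eq)
    qed
    with clopen_ind_maps2[OF V(1,2)] show "clopen_ind mtopology V \<in> agree mtopology K zero_map"
      by (simp add: agree_def)
    show "clopen_ind mtopology V x = 1" if "x \<in> F" for x
    proof -
      have "x \<in> M" "x \<in> V" using that V(3) F(2) by auto
      then show ?thesis by (simp add: clopen_ind_eq)
    qed
  qed
qed

lemma zero_map_closure_of:
  assumes A: "\<And>K. compactin mtopology K \<Longrightarrow> \<exists>f \<in> A. f \<in> agree mtopology K zero_map"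
  shows "zero_map \<in> Ck2 mtopology closure_of A"
  unfolding in_closure_of
proof (intro conjI allI impI)
  show "zero_map \<in> topspace (Ck2 mtopology)" using zero_map_maps2 by simp
  fix T assume "zero_map \<in> T \<and> openin (Ck2 mtopology) T"
  then obtain K where "compactin mtopology K" "agree mtopology K zero_map \<subseteq> T"
    unfolding openin_Ck2 by blast
  with A show "\<exists>y. y \<in> A \<and> y \<in> T" by blast
qed

text \<open>The indicators of the sets \<open>U n k\<close> converge in \<open>Ck\<close> to the
  zero function, so together with it they form a compact set. Evaluation is discontinuous at the
  pair of the zero map and the zero function, because indicators of arbitrarily large index take the
  value 1 at maps arbitrarily close to the zero map.\<close>

lemma Ascoli_Ck2_imp:
  assumes zd: "zero_dimensional_space mtopology" and Asc: "Ascoli_space (Ck2 mtopology)"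
  shows "locally_compact_space mtopology \<or> compactin mtopology (mtopology derived_set_of M)"
proof (rule ccontr)
  assume "\<not> ?thesis"
  then have nlc: "\<not> locally_compact_space mtopology"
    and ncX': "\<not> compactin mtopology (mtopology derived_set_of M)" by auto
  let ?X' = "mtopology derived_set_of M" and ?Z = "Ck2 mtopology"
  obtain x0 w where x0: "x0 \<in> M" and w: "\<And>n k. w n k \<in> mcball x0 (inverse (Suc n))"
    and wfin: "\<And>n K. compactin mtopology K \<Longrightarrow> finite {k::nat. w (n::nat) k \<in> K}"
    using not_locally_compact_sequences[OF nlc] by blast
  have X'M: "?X' \<subseteq> M" using derived_set_of_subset_topspace[of mtopology M] by simp
  have "closedin mtopology ?X'"
    by (simp add: closedin_derived_set_of Hausdorff_space_mtopology)
  from noncompact_sequence[OF this ncX'] obtain y :: "nat \<Rightarrow> 'a"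
    where y: "range y \<subseteq> ?X'" and yfin: "\<And>K. compactin mtopology K \<Longrightarrow> finite {n. y n \<in> K}" by blast
  have yM: "y n \<in> M" for n using y X'M by blast
  have "\<exists>s. (\<forall>k::nat. s k \<in> M - {y n}) \<and> limitin mtopology s (y n) sequentially" for n
  proof -
    have "y n \<in> ?X'" using y by blast
    then show ?thesis unfolding derived_set_of_sequentially by blast
  qed
  then obtain s where s: "\<And>n k. s n (k::nat) \<in> M - {y n}" "\<And>n. limitin mtopology (s n) (y n) sequentially"
    by metis
  have wM: "w n k \<in> M" for n k using w[of n k] by simp
  have sM: "s n k \<in> M" for n k using s(1)[of n k] by simp
  define P where "P n k = {x0, w n k, y n, s n k}" for n k
  have P: "finite (P n k)" "P n k \<subseteq> topspace mtopology" for n k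
    using x0 wM yM sM by (auto simp: P_def)
  \<comment> \<open>On a compact set of maps, equicontinuity at \<open>x0\<close> bounds \<open>n\<close>, and then equicontinuity at \<open>y n\<close> bounds \<open>k\<close>.\<close>
  define U where "U n k = {f \<in> maps2 mtopology. f x0 = 0 \<and> f (w n k) = 1 \<and> f (y n) = 0 \<and> f (s n k) = 1}" for n k
  let ?cond = "\<lambda>n k u::'a \<Rightarrow> nat. u x0 = 0 \<and> u (w n k) = 1 \<and> u (y n) = 0 \<and> u (s n k) = 1"
  have Ueq: "{f \<in> maps2 mtopology. ?cond n k (restrict f (P n k))} = U n k" for n k
    by (simp add: U_def P_def)
  have Uo: "openin ?Z (U n k)" for n k
    using openin_Ck2_finite_cond[OF P(1)[of n k] P(2)[of n k], of "?cond n k"] by (simp only: Ueq)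
  have Uc: "closedin ?Z (U n k)" for n k
    using closedin_Ck2_finite_cond[OF P(1)[of n k] P(2)[of n k], of "?cond n k"] by (simp only: Ueq)
  have Ufin: "finite {(n,k). Q \<inter> U n k \<noteq> {}}" if Q: "compactin ?Z Q" for Q
  proof -
    obtain r where r: "r > 0" "\<forall>f \<in> Q. \<forall>y \<in> mball x0 r. f y = f x0"
      using equicontinuous_compactin_Ck2[OF Q x0] by blast
    obtain N :: nat where N: "inverse (real (Suc N)) < r" using reals_Archimedean r(1) by blast
    have "\<exists>m. \<forall>k\<ge>m. \<forall>f \<in> Q. f (s n k) = f (y n)" for n
    proof -
      obtain r' where r': "r' > 0" "\<forall>f \<in> Q. \<forall>z \<in> mball (y n) r'. f z = f (y n)"
        using equicontinuous_compactin_Ck2[OF Q yM] by blast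
      have "\<forall>\<^sub>F k in sequentially. s n k \<in> mball (y n) r'"
        using s(2)[of n] r'(1) yM[of n] openin_mball[of "y n" r'] unfolding limitin_def
        by (metis centre_in_mball_iff)
      with r'(2) show ?thesis unfolding eventually_sequentially by blast
    qed
    then obtain m where m: "\<And>n k f. \<lbrakk>k \<ge> m n; f \<in> Q\<rbrakk> \<Longrightarrow> f (s n k) = f (y n)" by metis
    have "{(n,k). Q \<inter> U n k \<noteq> {}} \<subseteq> Sigma {..<N} (\<lambda>n. {..<m n})"
    proof (rule subrelI)
      fix n k assume "(n, k) \<in> {(n,k). Q \<inter> U n k \<noteq> {}}"
      then obtain f where f: "f \<in> Q" "f \<in> U n k" by blast
      have "n < N"
      proof (rule ccontr)
        assume "\<not> n < N"
        then have "inverse (real (Suc n)) \<le> inverse (real (Suc N))" by simp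
        moreover have "d x0 (w n k) \<le> inverse (real (Suc n))" using w[of n k] by simp
        ultimately have "d x0 (w n k) < r" using N by linarith
        then have "w n k \<in> mball x0 r" using x0 wM by simp
        then have "f (w n k) = f x0" using r(2) f(1) by blast
        with f(2) show False by (auto simp: U_def)
      qed
      moreover have "k < m n"
        using m[of n k f] f by (force simp: U_def)
      ultimately show "(n, k) \<in> Sigma {..<N} (\<lambda>n. {..<m n})" by simp
    qed
    then show ?thesis by (rule finite_subset) auto
  qed
  let ?CM = "continuous_maps ?Z euclideanreal"
  define U' where "U' j = (case prod_decode j of (n, k) \<Rightarrow> U n k)" for j
  have U'o: "openin ?Z (U' j)" and U'c: "closedin ?Z (U' j)" for j
    using Uo Uc by (auto simp: U'_def split: prod.split)
  define g :: "nat \<Rightarrow> ('a \<Rightarrow> nat) \<Rightarrow> real"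
    where "g j = (\<lambda>f \<in> maps2 mtopology. if f \<in> U' j then 1 else 0)" for j
  define g0 :: "('a \<Rightarrow> nat) \<Rightarrow> real" where "g0 = (\<lambda>f \<in> maps2 mtopology. 0)"
  have gC: "g j \<in> ?CM" for j
  proof -
    have "continuous_map ?Z euclideanreal (g j)"
      unfolding continuous_map_real_iff
    proof (intro ballI allI impI)
      fix z and e :: real assume z: "z \<in> topspace ?Z" "0 < e"
      show "\<exists>V. openin ?Z V \<and> z \<in> V \<and> (\<forall>v \<in> V. \<bar>g j v - g j z\<bar> < e)"
      proof (cases "z \<in> U' j")
        case True
        with z U'o[of j] openin_subset[OF U'o[of j]] show ?thesis
          by (intro exI[of _ "U' j"]) (auto simp: g_def)
      next
        case False
        have "openin ?Z (maps2 mtopology - U' j)"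
          using U'c[of j] by (metis openin_diff openin_topspace topspace_Ck2)
        with z False show ?thesis
          by (intro exI[of _ "maps2 mtopology - U' j"]) (auto simp: g_def)
      qed
    qed
    then show ?thesis by (simp add: continuous_maps_def g_def)
  qed
  have g0C: "g0 \<in> ?CM"
  proof -
    have "continuous_map ?Z euclideanreal g0"
      by (rule continuous_map_eq[where f = "\<lambda>_. 0"]) (auto simp: g0_def)
    then show ?thesis by (simp add: continuous_maps_def g0_def)
  qed
  \<comment> \<open>A compact \<open>Q\<close> meets only finitely many \<open>U' j\<close>, so
    almost all \<open>g j\<close> vanish identically on \<open>Q\<close>.\<close>
  have lim: "limitin (Ck ?Z) g g0 sequentially"
    unfolding Ck_def
  proof (rule limitin_compact_open[OF g0C gC])
    fix Q assume Q: "compactin ?Z Q"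
    have "finite (prod_decode -` {(n,k). Q \<inter> U n k \<noteq> {}})"
      by (intro finite_vimageI Ufin Q inj_prod_decode)
    moreover have "{j. \<not> (\<forall>x \<in> Q. g j x = g0 x)} \<subseteq> prod_decode -` {(n,k). Q \<inter> U n k \<noteq> {}}"
    proof (rule subsetI)
      fix j assume "j \<in> {j. \<not> (\<forall>x \<in> Q. g j x = g0 x)}"
      then obtain x where x: "x \<in> Q" "g j x \<noteq> g0 x" by blast
      have "x \<in> U' j"
        using x(2) compactin_subset_topspace[OF Q] x(1) by (auto simp: g_def g0_def split: if_splits)
      with x(1) show "j \<in> prod_decode -` {(n,k). Q \<inter> U n k \<noteq> {}}"
        by (auto simp: U'_def split: prod.splits)
    qed
    ultimately have "finite {j. \<not> (\<forall>x \<in> Q. g j x = g0 x)}" by (rule finite_subset[rotated])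
    then show "\<forall>\<^sub>F j in sequentially. \<forall>x \<in> Q. g j x = g0 x"
      by (simp add: eventually_cofinite flip: cofinite_eq_sequentially)
  qed
  let ?R = "insert g0 (range g)"
  have "compactin (Ck ?Z) ?R"
    using gC by (intro compactin_sequence_with_limit[OF lim]) (auto simp: Ck_def)
  with Asc have ec: "evenly_continuous ?Z ?R" by (simp add: Ascoli_space_def)
  have z0: "(zero_map, g0) \<in> topspace (prod_topology ?Z (subtopology (Ck ?Z) ?R))"
    using zero_map_maps2 g0C by (simp add: Ck_def)
  from ec[unfolded evenly_continuous_def continuous_map_real_iff, rule_format, OF z0 zero_less_one]
  obtain T
    where T: "openin (prod_topology ?Z (subtopology (Ck ?Z) ?R)) T" "(zero_map, g0) \<in> T"
      "\<forall>t \<in> T. \<bar>(case t of (z, f) \<Rightarrow> f z) - (case (zero_map, g0) of (z, f) \<Rightarrow> f z)\<bar> < 1"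
    by (elim exE conjE)
  from T(1)[unfolded openin_prod_topology_alt, rule_format, OF T(2)]
  obtain A B where AB: "openin ?Z A" "openin (subtopology (Ck ?Z) ?R) B" "zero_map \<in> A" "g0 \<in> B" "A \<times> B \<subseteq> T"
    by (elim exE conjE)
  obtain B' where B': "openin (Ck ?Z) B'" "B = B' \<inter> ?R"
    using AB(2) unfolding openin_subtopology by blast
  have "\<forall>\<^sub>F j in sequentially. g j \<in> B'"
    using lim B' AB(4) unfolding limitin_def by blast
  then obtain N where N: "\<And>j. j \<ge> N \<Longrightarrow> g j \<in> B" using B'(2) unfolding eventually_sequentially by blast
  obtain K where K: "compactin mtopology K" "agree mtopology K zero_map \<subseteq> A"
    using AB(1,3) unfolding openin_Ck2 by blast
  have K0: "compactin mtopology (insert x0 K)"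
    using K(1) x0 compactin_Un[of mtopology "{x0}" K] by simp
  \<comment> \<open>Since \<open>n \<le> prod_encode (n, k)\<close>, taking \<open>n \<ge> N\<close>
    puts \<open>g j\<close> into \<open>B\<close> whatever \<open>k\<close> will be. This leaves
    \<open>k\<close> free to be so large that \<open>s n k\<close> and \<open>w n k\<close> avoid
    the points where the map has to vanish.\<close>
  obtain n where n: "n \<ge> N" "y n \<notin> insert x0 K"
  proof -
    have "finite ({n. y n \<in> insert x0 K} \<union> {..<N})" using yfin[OF K0] by simp
    then obtain n where "n \<notin> {n. y n \<in> insert x0 K} \<union> {..<N}" using ex_new_if_finite infinite_UNIV_nat by blast
    then show thesis by (intro that[of n]) auto
  qed
  have K1: "compactin mtopology (insert (y n) (insert x0 K))"
    using K0 yM[of n] compactin_Un[of mtopology "{y n}" "insert x0 K"] by (simp add: insert_commute)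
  have "closedin mtopology (insert x0 K)"
    by (rule compactin_imp_closedin[OF Hausdorff_space_mtopology K0])
  then have "openin mtopology (M - insert x0 K)" by blast
  then have "\<forall>\<^sub>F k in sequentially. s n k \<in> M - insert x0 K"
    using s(2)[of n] n(2) yM[of n] unfolding limitin_def by blast
  moreover have "\<forall>\<^sub>F k in sequentially. w n k \<notin> insert (y n) (insert x0 K)"
    using wfin[OF K1, of n] by (simp add: eventually_cofinite flip: cofinite_eq_sequentially)
  ultimately have "\<forall>\<^sub>F k in sequentially. s n k \<in> M - insert x0 K \<and> w n k \<notin> insert (y n) (insert x0 K)"
    by (rule eventually_conj)
  then obtain k where k: "s n k \<in> M - insert x0 K" "w n k \<notin> insert (y n) (insert x0 K)"
    by (auto simp: eventually_sequentially)
  have "{s n k, w n k} \<inter> insert (y n) (insert x0 K) = {}" using k s(1)[of n k] by auto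
  moreover have "{s n k, w n k} \<subseteq> M" using wM sM by simp
  ultimately obtain f where f: "f \<in> agree mtopology (insert (y n) (insert x0 K)) zero_map"
    "\<And>x. x \<in> {s n k, w n k} \<Longrightarrow> f x = 1"
    using separating_clopen_ind[OF zd K1, of "{s n k, w n k}"] by blast
  define j where "j = prod_encode (n, k)"
  have "f \<in> U' j"
    using f yM[of n] x0 by (simp add: U'_def U_def j_def agree_def zero_map_eq)
  moreover have "f \<in> maps2 mtopology" using f(1) by (simp add: agree_def)
  ultimately have "g j f = 1" by (simp add: g_def)
  moreover have "g0 zero_map = 0" using zero_map_maps2 by (simp add: g0_def)
  moreover have "(f, g j) \<in> T"
  proof -
    have "f \<in> agree mtopology K zero_map" using f(1) by (simp add: agree_def)
    then have "f \<in> A" using K(2) by blast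
    moreover have "j \<ge> N" using n(1) le_prod_encode_1[of n k] by (simp add: j_def)
    ultimately show ?thesis using AB(5) N by blast
  qed
  ultimately show False using bspec[OF T(3), of "(f, g j)"] by simp
qed

lemma Frechet_Urysohn_Ck2_imp_locally_compact:
  assumes zd: "zero_dimensional_space mtopology" and FU: "Frechet_Urysohn_space (Ck2 mtopology)"
  shows "locally_compact_space mtopology"
proof (rule ccontr)
  assume nlc: "\<not> ?thesis"
  let ?Z = "Ck2 mtopology"
  obtain x0 w where x0: "x0 \<in> M" and w: "\<And>n k. w n k \<in> mcball x0 (inverse (Suc n))"
    and wfin: "\<And>n K. compactin mtopology K \<Longrightarrow> finite {k::nat. w (n::nat) k \<in> K}"
    using not_locally_compact_sequences[OF nlc] by blast
  have wM: "w n k \<in> M" for n k using w[of n k] by simp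
  \<comment> \<open>Along a sequence in \<open>A\<close> converging to zero, \<open>f (w n k) = 1\<close> bounds \<open>n\<close> by equicontinuity at \<open>x0\<close>, while
    \<open>f (w 0 n) = 1\<close> makes \<open>n\<close> tend to infinity.\<close>
  define A where "A = {f \<in> maps2 mtopology. \<exists>n k. f (w 0 n) = 1 \<and> f (w n k) = 1}"
  have "zero_map \<in> ?Z closure_of A"
  proof (rule zero_map_closure_of)
    fix K assume K: "compactin mtopology K"
    obtain n where n: "w 0 n \<notin> K"
      using wfin[OF K, of 0] ex_new_if_finite infinite_UNIV_nat by blast
    obtain k where k: "w n k \<notin> K"
      using wfin[OF K, of n] ex_new_if_finite infinite_UNIV_nat by blast
    have "{w 0 n, w n k} \<inter> K = {}" "{w 0 n, w n k} \<subseteq> M" using n k wM by auto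
    then obtain f where f: "f \<in> agree mtopology K zero_map" "\<And>x. x \<in> {w 0 n, w n k} \<Longrightarrow> f x = 1"
      using separating_clopen_ind[OF zd K, of "{w 0 n, w n k}"] by blast
    then have "f \<in> A" unfolding A_def agree_def by blast
    with f(1) show "\<exists>f \<in> A. f \<in> agree mtopology K zero_map" by blast
  qed
  moreover have "A \<subseteq> topspace ?Z" by (auto simp: A_def)
  ultimately obtain s :: "nat \<Rightarrow> 'a \<Rightarrow> nat" where s: "range s \<subseteq> A" "limitin ?Z s zero_map sequentially"
    using FU unfolding Frechet_Urysohn_space_def by blast
  \<comment> \<open>With its limit the sequence is a compact set of maps, whence a single radius
    \<open>r\<close> for all of its members.\<close>
  have "compactin ?Z (insert zero_map (range s))"
    using s(1) by (intro compactin_sequence_with_limit[OF s(2)]) (auto simp: A_def)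
  from equicontinuous_compactin_Ck2[OF this x0] obtain r
    where r: "r > 0" "\<And>j z. z \<in> mball x0 r \<Longrightarrow> s j z = s j x0" by blast
  obtain N :: nat where N: "inverse (real (Suc N)) < r" using reals_Archimedean r(1) by blast
  define F where "F = insert x0 ((\<lambda>n. w 0 n) ` {..<N})"
  have F: "finite F" "F \<subseteq> M" using x0 wM by (auto simp: F_def)
  have "\<forall>\<^sub>F j in sequentially. \<forall>x \<in> F. s j x = zero_map x"
    using F by (intro limitin_Ck2_agree[OF s(2)] finite_imp_compactin) auto
  then obtain j where "\<forall>x \<in> F. s j x = zero_map x" by (auto simp: eventually_sequentially)
  then have j: "s j x = 0" if "x \<in> F" for x using that F(2) zero_map_eq by auto
  have "s j \<in> A" using s(1) by blast
  then obtain n k where nk: "s j (w 0 n) = 1" "s j (w n k) = 1" unfolding A_def by blast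
  show False
  proof (cases "n < N")
    case True
    then have "w 0 n \<in> F" by (simp add: F_def)
    with j nk(1) show False by simp
  next
    case False
    then have "inverse (real (Suc n)) \<le> inverse (real (Suc N))" by simp
    moreover have "d x0 (w n k) \<le> inverse (real (Suc n))" using w[of n k] by simp
        ultimately have "d x0 (w n k) < r" using N by linarith
        then have "w n k \<in> mball x0 r" using x0 wM by simp
    then have "s j (w n k) = s j x0" by (rule r(2))
    moreover have "s j x0 = 0" by (rule j) (simp add: F_def)
    ultimately show False using nk(2) by simp
  qed
qed

text \<open>Maps whose support meets \<open>S\<close> in a countable set form a sequentially closed
  set: on \<open>S\<close>, the support of a limit lies in the union of the supports of the terms.
  For uncountable \<open>S\<close> the constant map 1 is outside this set but in its closure, since
  a compact \<open>K\<close> has a clopen neighbourhood with only finitely many points of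
  \<open>S\<close>.\<close>

lemma sequential_Ck2_imp_separable:
  assumes zd: "zero_dimensional_space mtopology" and seq: "sequential_space (Ck2 mtopology)"
    and S: "S \<subseteq> M" "separated_set \<epsilon> S" and "0 < \<epsilon>"
  shows "countable S"
proof (rule ccontr)
  assume unc: "\<not> countable S"
  let ?Z = "Ck2 mtopology"
  define A where "A = {f \<in> maps2 mtopology. countable {s \<in> S. f s = 1}}"
  have A: "A \<subseteq> topspace ?Z" by (auto simp: A_def)
  have one: "clopen_ind mtopology M \<in> maps2 mtopology" by (rule clopen_ind_maps2) auto
  have "{s \<in> S. clopen_ind mtopology M s = 1} = S" using S(1) by (auto simp: clopen_ind_eq)
  with unc have oneA: "clopen_ind mtopology M \<notin> A" by (simp add: A_def)
  have "clopen_ind mtopology M \<in> ?Z closure_of A"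
    unfolding in_closure_of
  proof (intro conjI allI impI)
    show "clopen_ind mtopology M \<in> topspace ?Z" using one by simp
    fix T assume "clopen_ind mtopology M \<in> T \<and> openin ?Z T"
    then obtain K where K: "compactin mtopology K" "agree mtopology K (clopen_ind mtopology M) \<subseteq> T"
      unfolding openin_Ck2 by blast
    have KM: "K \<subseteq> M" using compactin_subset_topspace[OF K(1)] by simp
    have "openin mtopology (\<Union>x\<in>K. mball x (\<epsilon>/4))" by blast
    moreover have "K \<subseteq> (\<Union>x\<in>K. mball x (\<epsilon>/4))" using KM \<open>0 < \<epsilon>\<close> by auto
    ultimately obtain V where V: "openin mtopology V" "closedin mtopology V" "K \<subseteq> V" "V \<subseteq> (\<Union>x\<in>K. mball x (\<epsilon>/4))"
      using zero_dimensional_compact_clopen[OF zd K(1)] by metis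
    have "S \<inter> V \<subseteq> {s \<in> S. K \<inter> mball s (\<epsilon>/4) \<noteq> {}}"
    proof
      fix s assume s: "s \<in> S \<inter> V"
      then obtain x where "x \<in> K" "s \<in> mball x (\<epsilon>/4)" using V(4) by blast
      then have "x \<in> K \<inter> mball s (\<epsilon>/4)" by (simp add: commute)
      with s show "s \<in> {s \<in> S. K \<inter> mball s (\<epsilon>/4) \<noteq> {}}" by blast
    qed
    then have "finite (S \<inter> V)"
      using separated_set_compactin_finite[OF K(1) S \<open>0 < \<epsilon>\<close>] finite_subset by blast
    moreover have "{s \<in> S. clopen_ind mtopology V s = 1} \<subseteq> S \<inter> V"
      using S(1) by (auto simp: clopen_ind_eq split: if_splits)
    ultimately have "finite {s \<in> S. clopen_ind mtopology V s = 1}" by (rule finite_subset[rotated])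
    then have "clopen_ind mtopology V \<in> A"
      using clopen_ind_maps2[OF V(1,2)] unfolding A_def by (simp add: countable_finite)
    moreover have "clopen_ind mtopology V \<in> agree mtopology K (clopen_ind mtopology M)"
      using clopen_ind_maps2[OF V(1,2)] KM V(3) by (auto simp: agree_def clopen_ind_eq subset_iff)
    ultimately show "\<exists>f. f \<in> A \<and> f \<in> T" using K(2) by blast
  qed
  with oneA A have "\<not> closedin ?Z A" by (metis closure_of_eq)
  with seq A obtain s :: "nat \<Rightarrow> 'a \<Rightarrow> nat" and a where s: "a \<in> ?Z closure_of A - A" "range s \<subseteq> A"
    "limitin ?Z s a sequentially"
    unfolding sequential_space_def by meson
  have "{x \<in> S. a x = 1} \<subseteq> (\<Union>j. {x \<in> S. s j x = 1})"
  proof clarify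
    fix x assume x: "x \<in> S" "a x = 1"
    have "\<forall>\<^sub>F j in sequentially. \<forall>z \<in> {x}. s j z = a z"
      using x(1) S(1) by (intro limitin_Ck2_agree[OF s(3)]) auto
    then obtain j where "s j x = a x" by (auto simp: eventually_sequentially)
    with x show "x \<in> (\<Union>j. {x \<in> S. s j x = 1})" by auto
  qed
  moreover have "countable (\<Union>j. {x \<in> S. s j x = 1})"
    using s(2) by (intro countable_UN) (auto simp: A_def)
  ultimately have "countable {x \<in> S. a x = 1}" by (rule countable_subset)
  moreover have "a \<in> maps2 mtopology" using limitin_topspace[OF s(3)] by simp
  ultimately show False using s(1) by (simp add: A_def)
qed

text \<open>An adaptation of the standard proof that an uncountable power of \<open>\<nat>\<close> is not a k-space; the set
  \<open>\<Union>(range A)\<close> below has closed intersection with each compact set, but zero is in its closure.\<close>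

lemma k_space_Ck2_imp_derived_separable:
  assumes zd: "zero_dimensional_space mtopology" and k: "k_space (Ck2 mtopology)"
    and S: "S \<subseteq> mtopology derived_set_of M" "separated_set \<epsilon> S" and "0 < \<epsilon>"
  shows "countable S"
proof (rule ccontr)
  assume unc: "\<not> countable S"
  let ?Z = "Ck2 mtopology"
  have SM: "S \<subseteq> M" using S(1) derived_set_of_subset_topspace[of mtopology M] by simp
  \<comment> \<open>Each non-isolated \<open>s\<close> receives a sequence \<open>y s\<close>
    converging to it; the bound \<epsilon>/4 keeps the sequences of different \<open>s\<close>
    apart.\<close>
  have "\<forall>s \<in> S. \<exists>y. \<forall>n::nat. y n \<in> M \<and> y n \<noteq> s \<and> d s (y n) < \<epsilon>/4 \<and> d s (y n) < inverse (Suc n)"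
  proof
    fix s assume "s \<in> S"
    have "\<exists>y. y \<in> M \<and> y \<noteq> s \<and> d s y < \<epsilon>/4 \<and> d s y < inverse (Suc n)" for n :: nat
    proof -
      have "0 < min (\<epsilon>/4) (inverse (Suc n))" using \<open>0 < \<epsilon>\<close> by simp
      then have "\<exists>y\<in>M. y \<noteq> s \<and> y \<in> mball s (min (\<epsilon>/4) (inverse (Suc n)))"
        using \<open>s \<in> S\<close> S(1) unfolding metric_derived_set_of by blast
      then show ?thesis by auto
    qed
    then show "\<exists>y. \<forall>n::nat. y n \<in> M \<and> y n \<noteq> s \<and> d s (y n) < \<epsilon>/4 \<and> d s (y n) < inverse (Suc n)"
      by metis
  qed
  from bchoice[OF this] obtain y where
    "\<forall>s \<in> S. \<forall>n::nat. y s n \<in> M \<and> y s n \<noteq> s \<and> d s (y s n) < \<epsilon>/4 \<and> d s (y s n) < inverse (Suc n)" ..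
  then have y: "y s n \<in> M" "y s n \<noteq> s" "d s (y s n) < \<epsilon>/4" "d s (y s n) < inverse (Suc n)" if "s \<in> S" for s n
    using that by auto
  \<comment> \<open>In the model power of the natural numbers, \<open>E n f\<close> corresponds to
    the set of coordinates different from \<open>n\<close>, and \<open>A n\<close> to the points
    with at most \<open>n\<close> such coordinates.\<close>
  define E where "E n f = {s \<in> S. f (y s n) = f s}" for n and f :: "'a \<Rightarrow> nat"
  define A where "A n = {f \<in> maps2 mtopology. finite (E n f) \<and> card (E n f) \<le> n}" for n
  have Acl: "closedin ?Z (A n)" for n
    unfolding closedin_def
  proof (intro conjI)
    show "A n \<subseteq> topspace ?Z" by (auto simp: A_def)
    show "openin ?Z (topspace ?Z - A n)"
      unfolding openin_Ck2
    proof (intro conjI ballI)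
      fix f assume f: "f \<in> topspace ?Z - A n"
      \<comment> \<open>\<open>n + 1\<close> elements of \<open>E n f\<close> witness that
        \<open>f\<close> is outside \<open>A n\<close>, and they remain witnesses for every map that
        agrees with \<open>f\<close> at them and at their points \<open>y s n\<close>.\<close>
      obtain F where F: "F \<subseteq> E n f" "finite F" "card F = Suc n"
      proof (cases "finite (E n f)")
        case True
        with f have "Suc n \<le> card (E n f)" by (auto simp: A_def)
        then show ?thesis using that obtain_subset_with_card_n by metis
      next
        case False
        then show ?thesis using that infinite_arbitrarily_large by metis
      qed
      let ?K = "F \<union> (\<lambda>s. y s n) ` F"
      have FS: "F \<subseteq> S" using F(1) by (auto simp: E_def)
      have "?K \<subseteq> topspace mtopology" using FS SM y(1) by auto
      then have "compactin mtopology ?K" using F(2) by (intro finite_imp_compactin) auto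
      moreover have "agree mtopology ?K f \<subseteq> topspace ?Z - A n"
      proof
        fix g assume g: "g \<in> agree mtopology ?K f"
        have "F \<subseteq> E n g"
        proof
          fix s assume s: "s \<in> F"
          then have "g (y s n) = f (y s n)" "g s = f s" "f (y s n) = f s"
            using g F(1) by (auto simp: agree_def E_def)
          with s FS show "s \<in> E n g" by (auto simp: E_def)
        qed
        then have "finite (E n g) \<Longrightarrow> Suc n \<le> card (E n g)" using card_mono F(3) by metis
        with g show "g \<in> topspace ?Z - A n" by (auto simp: A_def agree_def)
      qed
      ultimately show "\<exists>K. compactin mtopology K \<and> agree mtopology K f \<subseteq> topspace ?Z - A n" by blast
    qed simp
  qed
  have "closedin ?Z (\<Union>(range A))"
  proof -
    have "closedin (subtopology ?Z Q) (Q \<inter> \<Union>(range A))" if Q: "compactin ?Z Q" for Q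
    proof -
      have "\<exists>b. \<forall>n\<ge>b. \<forall>f \<in> Q. f (y s n) = f s" if s: "s \<in> S" for s
      proof -
        have "s \<in> M" using s SM by blast
        from equicontinuous_compactin_Ck2[OF Q this] obtain r
          where r: "r > 0" "\<And>f z. f \<in> Q \<Longrightarrow> z \<in> mball s r \<Longrightarrow> f z = f s" by blast
        obtain b :: nat where b: "inverse (real (Suc b)) < r" using reals_Archimedean r(1) by blast
        have "y s n \<in> mball s r" if "n \<ge> b" for n
        proof -
          have "inverse (real (Suc n)) \<le> inverse (real (Suc b))" using that by simp
          with y(4)[OF s, of n] b have "d s (y s n) < r" by linarith
          with y(1)[OF s, of n] \<open>s \<in> M\<close> show ?thesis by simp
        qed
        with r(2) show ?thesis by blast
      qed
      then have "\<forall>s \<in> S. \<exists>b. \<forall>n\<ge>b. \<forall>f \<in> Q. f (y s n) = f s" by blast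
      from bchoice[OF this] obtain b where b: "\<forall>s \<in> S. \<forall>n\<ge>b s. \<forall>f \<in> Q. f (y s n) = f s" ..
      \<comment> \<open>Since \<open>S\<close> is uncountable, some bound \<open>m\<close> serves
        infinitely many \<open>s\<close>. For \<open>n \<ge> m\<close> the set \<open>E n f\<close>
        is then infinite for every \<open>f\<close> in \<open>Q\<close>, so only the
        \<open>A n\<close> with \<open>n < m\<close> can meet \<open>Q\<close>.\<close>
      have "\<exists>m. infinite {s \<in> S. b s = m}"
      proof (rule ccontr)
        assume "\<not> ?thesis"
        then have "countable (\<Union>m. {s \<in> S. b s = m})" by (intro countable_UN) (auto intro: countable_finite)
        moreover have "(\<Union>m. {s \<in> S. b s = m}) = S" by auto
        ultimately show False using unc by simp
      qed
      then obtain m where m: "infinite {s \<in> S. b s = m}" ..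
      have "Q \<inter> A n = {}" if "n \<ge> m" for n
      proof -
        have "infinite (E n f)" if "f \<in> Q" for f
        proof -
          have "{s \<in> S. b s = m} \<subseteq> E n f"
            using b \<open>n \<ge> m\<close> that unfolding E_def by blast
          with m show ?thesis using finite_subset by blast
        qed
        then show ?thesis by (auto simp: A_def)
      qed
      then have "n < m" if "x \<in> Q" "x \<in> A n" for x n
        using that by (meson disjoint_iff not_le)
      then have "Q \<inter> \<Union>(range A) = Q \<inter> \<Union>(A ` {..<m})" by blast
      moreover have "closedin ?Z (\<Union>(A ` {..<m}))" using Acl by (intro closedin_Union) auto
      ultimately show ?thesis by (metis closedin_subtopology_Int_closed)
    qed
    moreover have "\<Union>(range A) \<subseteq> topspace ?Z" by (auto simp: A_def)
    ultimately show ?thesis using k unfolding k_space by blast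
  qed
  moreover have "zero_map \<in> ?Z closure_of (\<Union>(range A))"
  proof (rule zero_map_closure_of)
    fix K assume K: "compactin mtopology K"
    have KM: "K \<subseteq> M" using compactin_subset_topspace[OF K] by simp
    define B where "B = {s \<in> S. K \<inter> mball s (\<epsilon>/4) \<noteq> {}}"
    have B: "finite B" unfolding B_def by (rule separated_set_compactin_finite[OF K SM S(2) \<open>0 < \<epsilon>\<close>])
    \<comment> \<open>The map built below can be controlled only at those \<open>s\<close> whose
      ball misses \<open>K\<close>; the others, collected in \<open>B\<close>, may all fall into
      \<open>E n\<close>. Their number depends on \<open>K\<close>, which is why the bound in
      \<open>A n\<close> grows with \<open>n\<close>.\<close>
    define n where "n = card B"
    have "\<forall>s \<in> S - B. \<exists>C. openin mtopology C \<and> closedin mtopology C \<and> y s n \<in> C \<and> C \<subseteq> mball s (\<epsilon>/4) - {s}"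
    proof
      fix s assume s: "s \<in> S - B"
      then have sM: "s \<in> M" "s \<in> S" using SM by auto
      have "closedin mtopology {s}" using sM(1) Hausdorff_space_mtopology by (simp add: closedin_Hausdorff_singleton)
      then have "openin mtopology (mball s (\<epsilon>/4) - {s})" by blast
      moreover have "{y s n} \<subseteq> mball s (\<epsilon>/4) - {s}" using y[OF sM(2), of n] sM(1) by simp
      moreover have "compactin mtopology {y s n}" using y(1)[OF sM(2)] by simp
      ultimately obtain C where "openin mtopology C" "closedin mtopology C" "{y s n} \<subseteq> C" "C \<subseteq> mball s (\<epsilon>/4) - {s}"
        using zero_dimensional_compact_clopen[OF zd] by metis
      then show "\<exists>C. openin mtopology C \<and> closedin mtopology C \<and> y s n \<in> C \<and> C \<subseteq> mball s (\<epsilon>/4) - {s}"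
        by blast
    qed
    from bchoice[OF this] obtain C where "\<forall>s \<in> S - B. openin mtopology (C s) \<and> closedin mtopology (C s) \<and>
        y s n \<in> C s \<and> C s \<subseteq> mball s (\<epsilon>/4) - {s}" ..
    then have C: "openin mtopology (C s)" "closedin mtopology (C s)" "y s n \<in> C s" "C s \<subseteq> mball s (\<epsilon>/4) - {s}"
      if "s \<in> S - B" for s using that by auto
    define V where "V = \<Union>(C ` (S - B))"
    have Vo: "openin mtopology V" unfolding V_def using C(1) by blast
    \<comment> \<open>Balls of radius \<epsilon>/4 about distinct points of \<open>S\<close> are at
      least \<epsilon>/2 apart, so a ball of radius \<epsilon>/4 about any point meets at most one
      \<open>C s\<close>. The family is discrete, and its union \<open>V\<close> is closed.\<close>
    have close: "s = t" if "s \<in> S" "t \<in> S" "p \<in> mball s (\<epsilon>/4)" "q \<in> mball t (\<epsilon>/4)" "d p q < \<epsilon>/2" for s t p q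
    proof (rule ccontr)
      assume "s \<noteq> t"
      then have "\<epsilon> \<le> d s t" using that S(2) by (simp add: separated_set_def)
      moreover have "d s t \<le> d s p + d p t" using that by (intro triangle) auto
      moreover have "d p t \<le> d p q + d t q" using that by (intro triangle') auto
      ultimately show False using that by simp
    qed
    have "closedin mtopology V"
      unfolding closedin_def
    proof (intro conjI)
      show "V \<subseteq> topspace mtopology" by (rule openin_subset[OF Vo])
      show "openin mtopology (topspace mtopology - V)"
      proof (subst openin_subopen, intro ballI)
        fix x assume x: "x \<in> topspace mtopology - V"
        then have xb: "x \<in> mball x (\<epsilon>/4)" using \<open>0 < \<epsilon>\<close> by simp
        show "\<exists>T. openin mtopology T \<and> x \<in> T \<and> T \<subseteq> topspace mtopology - V"
        proof (cases "mball x (\<epsilon>/4) \<inter> V = {}")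
          case True
          with xb show ?thesis by (intro exI[of _ "mball x (\<epsilon>/4)"]) auto
        next
          case False
          then obtain s p where s: "s \<in> S - B" "p \<in> C s" "p \<in> mball x (\<epsilon>/4)" unfolding V_def by blast
          have "mball x (\<epsilon>/4) \<inter> V \<subseteq> C s"
          proof
            fix q assume q: "q \<in> mball x (\<epsilon>/4) \<inter> V"
            then obtain t where t: "t \<in> S - B" "q \<in> C t" unfolding V_def by blast
            have "d p q \<le> d x p + d x q" using q s(3) by (intro triangle'') auto
            then have "d p q < \<epsilon>/2" using q s(3) by simp
            then have "s = t" using close[of s t p q] s t C(4) by blast
            with t show "q \<in> C s" by simp
          qed
          moreover have "openin mtopology (mball x (\<epsilon>/4) - C s)" using C(2)[OF s(1)] by blast
          moreover have "x \<notin> C s" using x s(1) unfolding V_def by blast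
          ultimately show ?thesis using xb
            by (intro exI[of _ "mball x (\<epsilon>/4) - C s"]) auto
        qed
      qed
    qed
    then have fm: "clopen_ind mtopology V \<in> maps2 mtopology" by (rule clopen_ind_maps2[OF Vo])
    have "clopen_ind mtopology V x = zero_map x" if x: "x \<in> K" for x
    proof -
      have "x \<notin> V" using x C(4) unfolding V_def B_def by blast
      with x KM show ?thesis by (auto simp: clopen_ind_eq)
    qed
    with fm have "clopen_ind mtopology V \<in> agree mtopology K zero_map" by (simp add: agree_def)
    moreover have "E n (clopen_ind mtopology V) \<subseteq> B"
    proof
      fix s assume s: "s \<in> E n (clopen_ind mtopology V)"
      then have sS: "s \<in> S" "s \<in> M" using SM by (auto simp: E_def)
      have "s \<notin> V"
      proof
        assume "s \<in> V"
        then obtain t where t: "t \<in> S - B" "s \<in> C t" unfolding V_def by blast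
        have "s \<in> mball t (\<epsilon>/4)" "s \<in> mball s (\<epsilon>/4)" using sS t C(4)[OF t(1)] \<open>0 < \<epsilon>\<close> by auto
        then have "s = t"
          using close[of s t s s] sS t(1) \<open>0 < \<epsilon>\<close> by simp
        with t C(4) show False by blast
      qed
      with s sS y(1) have "y s n \<notin> V" by (auto simp: E_def clopen_ind_eq split: if_splits)
      with sS C(3) show "s \<in> B" unfolding V_def by blast
    qed
    then have "clopen_ind mtopology V \<in> A n"
      using fm B card_mono[OF B] finite_subset[OF _ B] by (auto simp: A_def n_def)
    ultimately show "\<exists>f \<in> \<Union>(range A). f \<in> agree mtopology K zero_map" by blast
  qed
  moreover have "zero_map \<notin> \<Union>(range A)"
  proof -
    have "E n zero_map = S" for n using SM y(1) by (auto simp: E_def zero_map_eq)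
    moreover have "infinite S" using unc countable_finite by blast
    ultimately show ?thesis by (simp add: A_def)
  qed
  ultimately show False by (simp add: closure_of_closedin)
qed


section \<open>Locally compact spaces\<close>

lemma compactin_small_mcball:
  assumes lc: "locally_compact_space mtopology" and x: "x \<in> M" and c: "0 < c"
  shows "\<exists>n. compactin mtopology (mcball x (c * inverse (Suc n)))"
proof -
  obtain U K where UK: "openin mtopology U" "compactin mtopology K" "x \<in> U" "U \<subseteq> K"
    using lc x unfolding locally_compact_space_def by auto
  obtain r where r: "r > 0" "mcball x r \<subseteq> U"
    using UK(1,3) unfolding openin_mtopology_mcball by blast
  obtain n where n: "inverse (real (Suc n)) < r / c" using reals_Archimedean[of "r/c"] r(1) c by auto
  then have "c * inverse (real (Suc n)) \<le> r" using c by (simp add: field_simps)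
  then have "mcball x (c * inverse (real (Suc n))) \<subseteq> K"
    using r(2) UK(4) mcball_subset_concentric by blast
  then have "compactin mtopology (mcball x (c * inverse (real (Suc n))))"
    using UK(2) closed_compactin by blast
  then show ?thesis by blast
qed

text \<open>In a locally compact space the classes of the equivalence relation generated by
  \<open>near\<close> are clopen, and each of them is the union of an increasing sequence of compact sets.\<close>

definition near :: "'a \<Rightarrow> 'a \<Rightarrow> bool"
  where "near x y \<longleftrightarrow> x \<in> M \<and> y \<in> M \<and> (\<exists>n. d x y < inverse (real (Suc n)) \<and>
    compactin mtopology (mcball x (4 * inverse (real (Suc n)))) \<and>
    compactin mtopology (mcball y (4 * inverse (real (Suc n)))))"

lemma near_sym: "near x y \<Longrightarrow> near y x"
  unfolding near_def by (metis commute)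

lemma near_nbhd:
  assumes lc: "locally_compact_space mtopology" and x: "x \<in> M"
  shows "\<exists>r>0. \<forall>y \<in> mball x r. near x y"
proof -
  \<comment> \<open>Here 5 = 4 + 1: the ball of radius \<open>4 * ?t\<close> about a point closer to
    \<open>x\<close> than \<open>?t\<close> lies in the ball of radius \<open>5 * ?t\<close> about
    \<open>x\<close>.\<close>
  obtain n where n: "compactin mtopology (mcball x (5 * inverse (real (Suc n))))"
    using compactin_small_mcball[OF lc x, of 5] by auto
  let ?t = "inverse (real (Suc n))"
  have "near x y" if y: "y \<in> mball x ?t" for y
  proof -
    have "d y x + 4 * ?t \<le> 5 * ?t" using y by (simp add: commute)
    then have "mcball y (4 * ?t) \<subseteq> mcball x (5 * ?t)" using x by (rule mcball_subset)
    moreover have "mcball x (4 * ?t) \<subseteq> mcball x (5 * ?t)" by (rule mcball_subset_concentric) simp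
    ultimately have "compactin mtopology (mcball y (4 * ?t))" "compactin mtopology (mcball x (4 * ?t))"
      using closed_compactin[OF n] by auto
    with y show ?thesis unfolding near_def by auto
  qed
  then show ?thesis by (intro exI[of _ ?t]) auto
qed

text \<open>A point of \<open>A\<close> may have near points at any scale. Each centre
  \<open>a\<close> of a finite cover of \<open>A\<close> comes with a compact ball of scale
  \<open>N a\<close>: nearness at finer scales stays in that ball, and there are only finitely many
  coarser scales.\<close>

lemma near_compactin:
  assumes lc: "locally_compact_space mtopology" and A: "compactin mtopology A"
  shows "\<exists>C. compactin mtopology C \<and> (\<forall>y \<in> A. \<forall>z. near y z \<longrightarrow> z \<in> C)"
proof -
  let ?t = "\<lambda>n. inverse (real (Suc n))"
  have AM: "A \<subseteq> M" using compactin_subset_topspace[OF A] by simp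
  have "\<forall>a \<in> A. \<exists>n. compactin mtopology (mcball a (2 * ?t n))"
    using compactin_small_mcball[OF lc] AM by (metis subsetD zero_less_numeral)
  from bchoice[OF this] obtain N where N: "\<forall>a \<in> A. compactin mtopology (mcball a (2 * ?t (N a)))" ..
  have "\<forall>a \<in> A. openin mtopology (mball a (?t (N a))) \<and> a \<in> mball a (?t (N a))" using AM by auto
  from compactin_finite_cover[OF A this]
  obtain F where F: "finite F" "F \<subseteq> A" "A \<subseteq> \<Union>((\<lambda>a. mball a (?t (N a))) ` F)" by blast
  define \<C> where "\<C> = (\<Union>a\<in>F. (\<lambda>m. mcball a (2 * ?t m)) ` {m. m \<le> N a \<and> compactin mtopology (mcball a (2 * ?t m))})"
  have "finite \<C>" unfolding \<C>_def using F(1) by auto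
  then have "compactin mtopology (\<Union>\<C>)" by (rule compactin_Union) (auto simp: \<C>_def)
  moreover have "z \<in> \<Union>\<C>" if y: "y \<in> A" and yz: "near y z" for y z
  proof -
    obtain a where a: "a \<in> F" "y \<in> mball a (?t (N a))" using F(3) y by blast
    obtain n where n: "d y z < ?t n" "compactin mtopology (mcball y (4 * ?t n))" "z \<in> M" "y \<in> M"
      using yz unfolding near_def by blast
    have aM: "a \<in> M" using a(2) by simp
    have tri: "d a z \<le> d a y + d y z" using aM n by (intro triangle) auto
    have day: "d a y < ?t (N a)" using a(2) by simp
    show ?thesis
    proof (cases "n \<le> N a")
      \<comment> \<open>At the coarser scale \<open>n\<close>, the compact ball about
        \<open>y\<close> with factor 4 contains the ball about \<open>a\<close> with factor 2; this
        is what the factor 4 in \<open>near\<close> provides.\<close>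
      case True
      then have le: "?t (N a) \<le> ?t n" by simp
      have "0 < ?t n" by simp
      then have "d a y + 2 * ?t n \<le> 4 * ?t n" using day le by linarith
      then have "mcball a (2 * ?t n) \<subseteq> mcball y (4 * ?t n)" using n(4) by (rule mcball_subset)
      then have "compactin mtopology (mcball a (2 * ?t n))" using closed_compactin[OF n(2)] by auto
      moreover have "d a z \<le> 2 * ?t n" using tri day le n(1) by linarith
      ultimately show ?thesis using a(1) True aM n(3) unfolding \<C>_def by auto
    next
      case False
      then have le: "?t n \<le> ?t (N a)" by simp
      have "d a z \<le> 2 * ?t (N a)" using tri day le n(1) by linarith
      moreover have "a \<in> A" using a(1) F(2) by blast
      ultimately show ?thesis using a(1) N aM n(3) unfolding \<C>_def by auto
    qed
  qed
  ultimately show ?thesis by blast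
qed

text \<open>Each class is exhausted by compact open sets, and the part of one of them outside all
  earlier ones is a block. A block is compact as a compact set minus an open one, and open as an
  open set minus a compact one.\<close>

lemma compact_open_partition:
  assumes lc: "locally_compact_space mtopology" and zd: "zero_dimensional_space mtopology"
  shows "\<exists>\<pi>. \<forall>x \<in> M. x \<in> \<pi> x \<and> openin mtopology (\<pi> x) \<and> compactin mtopology (\<pi> x) \<and>
    (\<forall>y \<in> \<pi> x. \<pi> y = \<pi> x)"
proof -
  define Y where "Y x = {y. near\<^sup>*\<^sup>* x y}" for x
  have symp: "near\<^sup>*\<^sup>* y x" if "near\<^sup>*\<^sup>* x y" for x y
    using that by (induction rule: rtranclp_induct) (auto intro: near_sym converse_rtranclp_into_rtranclp)
  have Y_eq: "Y y = Y x" if "y \<in> Y x" for x y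
    using that symp unfolding Y_def by (auto intro: rtranclp_trans)
  have YM: "Y x \<subseteq> M" if "x \<in> M" for x
  proof
    fix y assume "y \<in> Y x"
    then have "near\<^sup>*\<^sup>* x y" by (simp add: Y_def)
    then show "y \<in> M" using that by (induction rule: rtranclp_induct) (auto simp: near_def)
  qed
  have Yself: "x \<in> Y x" for x by (simp add: Y_def)
  have Ynear: "z \<in> Y x" if "y \<in> Y x" "near y z" for x y z
    using that unfolding Y_def by auto
  have Yo: "openin mtopology (Y x)" if x: "x \<in> M" for x
    unfolding openin_mtopology
  proof (intro conjI YM x allI impI)
    fix y assume y: "y \<in> Y x"
    then have "y \<in> M" using YM[OF x] by blast
    from near_nbhd[OF lc this] y Ynear show "\<exists>r>0. mball y r \<subseteq> Y x" by blast
  qed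
  have Yc: "closedin mtopology (Y x)" if x: "x \<in> M" for x
  proof -
    have "\<Union>(Y ` (M - Y x)) \<subseteq> M - Y x"
    proof clarify
      fix a z assume a: "a \<in> M" "a \<notin> Y x" "z \<in> Y a"
      have "z \<notin> Y x" using a(2) Y_eq[OF a(3)] Y_eq[of z x] Yself[of a] by blast
      with a YM show "z \<in> M - Y x" by blast
    qed
    then have "M - Y x = \<Union>(Y ` (M - Y x))" using Yself by blast
    moreover have "openin mtopology (\<Union>(Y ` (M - Y x)))" using Yo by blast
    ultimately show ?thesis using YM[OF x] by (simp add: closedin_def)
  qed
  have "\<exists>K. (\<forall>n::nat. compactin mtopology (K n) \<and> openin mtopology (K n) \<and> K n \<subseteq> T) \<and> T \<subseteq> \<Union>(range K)"
    if TY: "T \<in> Y ` M" for T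
  proof -
    obtain x where x: "x \<in> M" "T = Y x" using TY by blast
    \<comment> \<open>A compact part of the class grows to a compact open one that contains all its
      near points. Iterated from \<open>{x}\<close>, this reaches every point joined to
      \<open>x\<close> by a finite chain.\<close>
    have step: "\<exists>V. compactin mtopology V \<and> openin mtopology V \<and> V \<subseteq> T \<and> A \<subseteq> V \<and>
        (\<forall>y \<in> A. \<forall>z. near y z \<longrightarrow> z \<in> V)" if A: "compactin mtopology A" "A \<subseteq> T" for A
    proof -
      obtain C where C: "compactin mtopology C" "\<forall>y \<in> A. \<forall>z. near y z \<longrightarrow> z \<in> C"
        using near_compactin[OF lc A(1)] by blast
      have "compactin mtopology (T \<inter> C)" using Yc[OF x(1)] C(1) x(2) by (simp add: closed_Int_compactin)
      then have "compactin mtopology (A \<union> T \<inter> C)" by (rule compactin_Un[OF A(1)])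
      moreover have "openin mtopology T" using Yo x by simp
      moreover have "A \<union> T \<inter> C \<subseteq> T" using A(2) by blast
      ultimately obtain V where "openin mtopology V" "compactin mtopology V" "A \<union> T \<inter> C \<subseteq> V" "V \<subseteq> T"
        using locally_compact_compact_clopen[OF zd lc] by metis
      moreover have "z \<in> T \<inter> C" if "y \<in> A" "near y z" for y z
        using that C(2) Ynear[of y x z] A(2) x(2) by blast
      ultimately show ?thesis by blast
    qed
    define ok where "ok n V \<longleftrightarrow> compactin mtopology V \<and> openin mtopology V \<and> V \<subseteq> T \<and> x \<in> V" for n :: nat and V
    have "compactin mtopology {x}" "{x} \<subseteq> T" using x Yself by auto
    from step[OF this] have ok0: "\<exists>V. ok 0 V" unfolding ok_def by auto
    have okS: "\<exists>V'. ok (Suc n) V' \<and> (\<forall>y \<in> V. \<forall>z. near y z \<longrightarrow> z \<in> V')" if "ok n V" for V n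
      using step[of V] that unfolding ok_def by blast
    from dependent_nat_choice[of ok "\<lambda>n V V'. \<forall>y \<in> V. \<forall>z. near y z \<longrightarrow> z \<in> V'", OF ok0 okS]
    obtain K where "\<forall>n. ok n (K n) \<and> (\<forall>y \<in> K n. \<forall>z. near y z \<longrightarrow> z \<in> K (Suc n))" ..
    then have K: "ok n (K n)" "\<forall>y \<in> K n. \<forall>z. near y z \<longrightarrow> z \<in> K (Suc n)" for n by auto
    have "y \<in> \<Union>(range K)" if "y \<in> T" for y
    proof -
      have "near\<^sup>*\<^sup>* x y" using that x(2) by (simp add: Y_def)
      then show ?thesis
      proof (induction rule: rtranclp_induct)
        case base
        show ?case using K(1)[of 0] unfolding ok_def by blast
      next
        case (step y z)
        with K(2) show ?case by blast
      qed
    qed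
    with K(1) show ?thesis unfolding ok_def by (intro exI[of _ K]) blast
  qed
  then have "\<forall>T \<in> Y ` M. \<exists>K. (\<forall>n::nat. compactin mtopology (K n) \<and> openin mtopology (K n) \<and> K n \<subseteq> T) \<and> T \<subseteq> \<Union>(range K)"
    by blast
  \<comment> \<open>The exhaustion is attached to the class rather than to the point, so that all
    points of a class use the same \<open>K\<close> and \<pi> is constant on each block.\<close>
  from bchoice[OF this] obtain K where K': "\<forall>T \<in> Y ` M. (\<forall>n::nat. compactin mtopology (K T n) \<and>
      openin mtopology (K T n) \<and> K T n \<subseteq> T) \<and> T \<subseteq> \<Union>(range (K T))" ..
  have K: "compactin mtopology (K (Y x) n)" "openin mtopology (K (Y x) n)" "K (Y x) n \<subseteq> Y x" "Y x \<subseteq> \<Union>(range (K (Y x)))"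
    if "x \<in> M" for x n using K' that by auto
  define N where "N x = (LEAST n. x \<in> K (Y x) n)" for x
  have N: "x \<in> K (Y x) (N x)" "\<And>m. m < N x \<Longrightarrow> x \<notin> K (Y x) m" if x: "x \<in> M" for x
  proof -
    have "\<exists>n. x \<in> K (Y x) n" using K(4)[OF x] Yself[of x] by blast
    then show "x \<in> K (Y x) (N x)" unfolding N_def by (rule LeastI_ex)
    show "\<And>m. m < N x \<Longrightarrow> x \<notin> K (Y x) m" unfolding N_def by (rule not_less_Least)
  qed
  define \<pi> where "\<pi> x = K (Y x) (N x) - \<Union>(K (Y x) ` {..<N x})" for x
  show ?thesis
  proof (intro exI[of _ \<pi>] ballI conjI)
    fix x assume x: "x \<in> M"
    show "x \<in> \<pi> x" using N[OF x] by (auto simp: \<pi>_def)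
    have "compactin mtopology (\<Union>(K (Y x) ` {..<N x}))" using K(1)[OF x] by (intro compactin_Union) auto
    then have "closedin mtopology (\<Union>(K (Y x) ` {..<N x}))"
      by (rule compactin_imp_closedin[OF Hausdorff_space_mtopology])
    then show "openin mtopology (\<pi> x)" unfolding \<pi>_def using K(2)[OF x] by blast
    have "openin mtopology (\<Union>(K (Y x) ` {..<N x}))" using K(2)[OF x] by blast
    then show "compactin mtopology (\<pi> x)" unfolding \<pi>_def using K(1)[OF x] by (intro compactin_diff_open)
    fix y assume y: "y \<in> \<pi> x"
    then have "y \<in> Y x" using K(3)[OF x] unfolding \<pi>_def by blast
    then have Yy: "Y y = Y x" and yM: "y \<in> M" using Y_eq YM[OF x] by auto
    have "y \<in> K (Y x) (N x)" "\<And>m. m < N x \<Longrightarrow> y \<notin> K (Y x) m" using y unfolding \<pi>_def by auto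
    then have "N y = N x"
      using N[OF yM] unfolding Yy by (meson linorder_neqE_nat)
    with Yy show "\<pi> y = \<pi> x" by (simp add: \<pi>_def)
  qed
qed

text \<open>Noble's argument for products, with the blocks of the partition in the role of the factors: a
  function on \<open>Ck2\<close> that is continuous on compact sets but not at \<open>p\<close> would stay away from its value
  at \<open>p\<close> along maps that differ from \<open>p\<close> only on pairwise disjoint finite unions of blocks.\<close>

lemma kR_space_Ck2_locally_compact:
  assumes lc: "locally_compact_space mtopology" and zd: "zero_dimensional_space mtopology"
  shows "kR_space (Ck2 mtopology)"
proof -
  let ?Z = "Ck2 mtopology"
  obtain \<pi> where "\<forall>x \<in> M. x \<in> \<pi> x \<and> openin mtopology (\<pi> x) \<and> compactin mtopology (\<pi> x) \<and>
      (\<forall>y \<in> \<pi> x. \<pi> y = \<pi> x)"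
    using compact_open_partition[OF lc zd] ..
  then have \<pi>: "x \<in> \<pi> x" "openin mtopology (\<pi> x)" "compactin mtopology (\<pi> x)"
    "\<And>y. y \<in> \<pi> x \<Longrightarrow> \<pi> y = \<pi> x" if "x \<in> M" for x
    using that by blast+
  have \<pi>M: "\<pi> x \<subseteq> M" if "x \<in> M" for x using openin_subset[OF \<pi>(2)[OF that]] by simp
  have cover: "\<exists>F. finite F \<and> F \<subseteq> M \<and> K \<subseteq> \<Union>(\<pi> ` F)" if K: "compactin mtopology K" for K
  proof -
    have KM: "K \<subseteq> M" using compactin_subset_topspace[OF K] by simp
    then have "\<forall>x \<in> K. openin mtopology (\<pi> x) \<and> x \<in> \<pi> x" using \<pi>(1,2) by blast
    from compactin_finite_cover[OF K this] obtain F where "finite F" "F \<subseteq> K" "K \<subseteq> \<Union>(\<pi> ` F)" by blast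
    then show ?thesis using KM by blast
  qed
  have block: "compactin mtopology (\<Union>(\<pi> ` F))" "openin mtopology (\<Union>(\<pi> ` F))" "closedin mtopology (\<Union>(\<pi> ` F))"
    if F: "finite F" "F \<subseteq> M" for F
  proof -
    show c: "compactin mtopology (\<Union>(\<pi> ` F))" using F \<pi>(3) by (intro compactin_Union) auto
    show "openin mtopology (\<Union>(\<pi> ` F))" using F \<pi>(2) by blast
    show "closedin mtopology (\<Union>(\<pi> ` F))"
      by (rule compactin_imp_closedin[OF Hausdorff_space_mtopology c])
  qed
  have sat: "x \<in> \<Union>(\<pi> ` F) \<longleftrightarrow> y \<in> \<Union>(\<pi> ` F)" if "F \<subseteq> M" "x \<in> M" "y \<in> \<pi> x" for F x y
  proof -
    have yM: "y \<in> M" and yx: "\<pi> y = \<pi> x" using that \<pi>M \<pi>(4) by blast+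
    have "z \<in> \<Union>(\<pi> ` F) \<longleftrightarrow> \<pi> z \<in> \<pi> ` F" if z: "z \<in> M" for z
    proof
      assume "z \<in> \<Union>(\<pi> ` F)"
      then obtain a where "a \<in> F" "z \<in> \<pi> a" by blast
      then show "\<pi> z \<in> \<pi> ` F" using \<pi>(4)[of a z] \<open>F \<subseteq> M\<close> by blast
    qed (use \<pi>(1)[OF z] in blast)
    then show ?thesis using yx yM that(2) by simp
  qed
  have "continuous_map ?Z euclideanreal f"
    if f: "\<And>Q. compactin ?Z Q \<Longrightarrow> continuous_map (subtopology ?Z Q) euclideanreal f" for f
    unfolding continuous_map_real_iff
  proof (intro ballI allI impI)
    fix p and \<epsilon> :: real
    assume "p \<in> topspace ?Z" and "0 < \<epsilon>"
    then have p: "p \<in> maps2 mtopology" by simp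
    have "\<exists>K. compactin mtopology K \<and> (\<forall>q \<in> agree mtopology K p. \<bar>f q - f p\<bar> < \<epsilon>)"
    proof (rule ccontr)
      assume "\<not> ?thesis"
      then have neg: "\<exists>q \<in> agree mtopology K p. \<epsilon> \<le> \<bar>f q - f p\<bar>" if "compactin mtopology K" for K
        using that by (meson not_le)
      have step: "\<exists>B q. finite B \<and> B \<subseteq> M \<and> q \<in> agree mtopology K p \<and>
          (\<forall>x \<in> M - \<Union>(\<pi> ` B). q x = p x) \<and> \<epsilon>/2 \<le> \<bar>f q - f p\<bar>" if K: "compactin mtopology K" for K
      proof -
        obtain q where q: "q \<in> agree mtopology K p" "\<epsilon> \<le> \<bar>f q - f p\<bar>" using neg[OF K] by blast
        then have qm: "q \<in> maps2 mtopology" by (simp add: agree_def)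
        \<comment> \<open>The resulting compact \<open>E\<close> contains \<open>q\<close> and every
          map that equals \<open>q\<close> on some blocks and \<open>p\<close> on the others. By
          continuity of \<open>f\<close> on \<open>E\<close>, cutting \<open>q\<close> down to
          suitable finitely many blocks changes the value of \<open>f\<close> by less than
          \<epsilon>/2.\<close>
        define U where "U x = \<pi> x \<inter> {y \<in> topspace mtopology. p y \<in> {p x}} \<inter> {y \<in> topspace mtopology. q y \<in> {q x}}" for x
        define E where "E = {h \<in> maps2 mtopology. \<forall>x \<in> topspace mtopology. \<forall>y \<in> U x. h y = h x}"
        have E: "compactin ?Z E"
          unfolding E_def
        proof (rule compactin_Ck2_equicontinuous)
          fix x assume x: "x \<in> topspace mtopology"
          show "openin mtopology (U x)"
            unfolding U_def using x \<pi>(2) by (intro openin_Int openin_maps2 p qm) simp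
          show "x \<in> U x" unfolding U_def using x \<pi>(1) by simp
        qed
        have qE: "q \<in> E" using qm by (auto simp: E_def U_def)
        then have "q \<in> topspace (subtopology ?Z E)" using qm by simp
        then obtain T where T: "openin (subtopology ?Z E) T" "q \<in> T" "\<forall>h \<in> T. \<bar>f h - f q\<bar> < \<epsilon>/2"
          using f[OF E] \<open>0 < \<epsilon>\<close> unfolding continuous_map_real_iff by (meson half_gt_zero)
        obtain T' where T': "openin ?Z T'" "T = T' \<inter> E" using T(1) unfolding openin_subtopology by blast
        obtain K' where K': "compactin mtopology K'" "agree mtopology K' q \<subseteq> T'"
          using T'(1) T(2) unfolding T'(2) openin_Ck2 by blast
        obtain B where B: "finite B" "B \<subseteq> M" "K' \<subseteq> \<Union>(\<pi> ` B)" using cover[OF K'(1)] by blast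
        define h where "h = (\<lambda>x \<in> topspace mtopology. if x \<in> \<Union>(\<pi> ` B) then q x else p x)"
        have hm: "h \<in> maps2 mtopology"
          unfolding h_def by (rule maps2_combine[OF qm p block(2,3)[OF B(1,2)]])
        have hx: "h x = (if x \<in> \<Union>(\<pi> ` B) then q x else p x)" if "x \<in> M" for x
          using that by (simp add: h_def)
        have "h y = h x" if xy: "x \<in> topspace mtopology" "y \<in> U x" for x y
        proof -
          have x: "x \<in> M" and y: "y \<in> \<pi> x" "y \<in> M" "p y = p x" "q y = q x" using xy by (auto simp: U_def)
          show ?thesis using sat[OF B(2) x y(1)] y by (simp only: hx[OF x] hx[OF y(2)])
        qed
        then have hE: "h \<in> E" using hm by (simp add: E_def)
        have "h x = q x" if "x \<in> K'" for x
        proof -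
          have "x \<in> M" "x \<in> \<Union>(\<pi> ` B)" using that B(3) compactin_subset_topspace[OF K'(1)] by auto
          then show ?thesis by (simp only: hx if_True)
        qed
        then have "h \<in> agree mtopology K' q" using hm by (simp add: agree_def)
        then have "h \<in> T" using K'(2) hE T'(2) by blast
        with T(3) have "\<bar>f h - f q\<bar> < \<epsilon>/2" by blast
        with q(2) have "\<epsilon>/2 \<le> \<bar>f h - f p\<bar>" by linarith
        moreover have "h x = p x" if "x \<in> K" for x
        proof -
          have "x \<in> M" "q x = p x" using that q(1) compactin_subset_topspace[OF K] by (auto simp: agree_def)
          then show ?thesis by (simp add: hx)
        qed
        then have "h \<in> agree mtopology K p" using hm by (simp add: agree_def)
        moreover have "\<forall>x \<in> M - \<Union>(\<pi> ` B). h x = p x" using hx by simp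
        ultimately show ?thesis using B by blast
      qed
      define ok where "ok n G \<longleftrightarrow> finite G \<and> G \<subseteq> M" for n :: nat and G
      \<comment> \<open>The map of each stage agrees with \<open>p\<close> on all blocks used so far
        and outside the enlarged finite collection, so a block carries a deviation from
        \<open>p\<close> for at most one index.\<close>
      define nx where "nx n G G' \<longleftrightarrow> G \<subseteq> G' \<and> (\<exists>q. q \<in> agree mtopology (\<Union>(\<pi> ` G)) p \<and>
          (\<forall>x \<in> M - \<Union>(\<pi> ` G'). q x = p x) \<and> \<epsilon>/2 \<le> \<bar>f q - f p\<bar>)" for n :: nat and G G'
      have ok0: "\<exists>G. ok 0 G" unfolding ok_def by blast
      have okS: "\<exists>G'. ok (Suc n) G' \<and> nx n G G'" if G: "ok n G" for G n
      proof -
        have "finite G" "G \<subseteq> M" using G by (auto simp: ok_def)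
        from step[OF block(1)[OF this]] obtain B q where Bq: "finite B" "B \<subseteq> M"
          "q \<in> agree mtopology (\<Union>(\<pi> ` G)) p" "\<forall>x \<in> M - \<Union>(\<pi> ` B). q x = p x" "\<epsilon>/2 \<le> \<bar>f q - f p\<bar>"
          by blast
        have "ok (Suc n) (G \<union> B)" using Bq G by (auto simp: ok_def)
        moreover have "nx n G (G \<union> B)" unfolding nx_def using Bq by blast
        ultimately show ?thesis by blast
      qed
      from dependent_nat_choice[of ok nx, OF ok0 okS]
      obtain G where "\<forall>n. ok n (G n) \<and> nx n (G n) (G (Suc n))" ..
      then have G: "G n \<subseteq> M" "G n \<subseteq> G (Suc n)"
        and ex: "\<exists>q. q \<in> agree mtopology (\<Union>(\<pi> ` G n)) p \<and>
          (\<forall>x \<in> M - \<Union>(\<pi> ` G (Suc n)). q x = p x) \<and> \<epsilon>/2 \<le> \<bar>f q - f p\<bar>" for n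
        unfolding ok_def nx_def by blast+
      from ex obtain q where q: "\<And>n. q n \<in> agree mtopology (\<Union>(\<pi> ` G n)) p"
        "\<And>n x. x \<in> M - \<Union>(\<pi> ` G (Suc n)) \<Longrightarrow> q n x = p x" "\<And>n. \<epsilon>/2 \<le> \<bar>f (q n) - f p\<bar>"
        by metis
      have qm: "q n \<in> maps2 mtopology" for n using q(1)[of n] by (simp add: agree_def)
      have Gmono: "G m \<subseteq> G n" if "m \<le> n" for m n
        by (rule lift_Suc_mono_le[of G, OF G(2) that])
      have lim: "limitin ?Z q p sequentially"
        unfolding Ck2_def
      proof (rule limitin_compact_open[OF p qm])
        fix K assume K: "compactin mtopology K"
        obtain F where F: "finite F" "F \<subseteq> M" "K \<subseteq> \<Union>(\<pi> ` F)" using cover[OF K] by blast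
        have one: "\<forall>\<^sub>F n in sequentially. \<forall>x \<in> \<pi> a. q n x = p x" if a: "a \<in> F" for a
        proof (cases "\<exists>m. a \<in> \<Union>(\<pi> ` G m)")
          case True
          then obtain m where m: "a \<in> \<Union>(\<pi> ` G m)" by blast
          have "\<forall>x \<in> \<pi> a. q n x = p x" if "n \<ge> m" for n
          proof
            fix x assume x: "x \<in> \<pi> a"
            have "x \<in> \<Union>(\<pi> ` G m)" using sat[OF G(1) _ x] a F(2) m by blast
            then have "x \<in> \<Union>(\<pi> ` G n)" using Gmono[OF that] by blast
            with q(1)[of n] show "q n x = p x" unfolding agree_def by blast
          qed
          then show ?thesis unfolding eventually_sequentially by blast
        next
          case False
          have "q n x = p x" if x: "x \<in> \<pi> a" for x n
          proof -
            have aM: "a \<in> M" using a F(2) by blast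
            have "x \<notin> \<Union>(\<pi> ` G (Suc n))" using sat[OF G(1) aM x] False by blast
            moreover have "x \<in> M" using \<pi>M[OF aM] x by blast
            ultimately show ?thesis using q(2) by blast
          qed
          then show ?thesis by simp
        qed
        have "\<forall>\<^sub>F n in sequentially. \<forall>a \<in> F. \<forall>x \<in> \<pi> a. q n x = p x"
          by (intro eventually_ball_finite F(1)) (use one in blast)
        then show "\<forall>\<^sub>F n in sequentially. \<forall>x \<in> K. q n x = p x"
          by eventually_elim (use F(3) in blast)
      qed
      let ?Q = "insert p (range q)"
      have "compactin ?Z ?Q"
        using qm by (intro compactin_sequence_with_limit[OF lim]) auto
      from f[OF this] have c: "continuous_map (subtopology ?Z ?Q) euclideanreal f" .
      have "limitin (subtopology ?Z ?Q) q p sequentially" using lim by (simp add: limitin_subtopology)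
      from continuous_map_limit[OF c this] have "(f \<circ> q) \<longlonglongrightarrow> f p" by simp
      from tendstoD[OF this, of "\<epsilon>/2"] \<open>0 < \<epsilon>\<close>
      have "\<forall>\<^sub>F n in sequentially. dist ((f \<circ> q) n) (f p) < \<epsilon>/2" by simp
      then obtain n where "dist ((f \<circ> q) n) (f p) < \<epsilon>/2" by (auto simp: eventually_sequentially)
      with q(3)[of n] show False by (simp add: dist_real_def)
    qed
    then obtain K where K: "compactin mtopology K" "\<forall>q \<in> agree mtopology K p. \<bar>f q - f p\<bar> < \<epsilon>" by blast
    then show "\<exists>U. openin ?Z U \<and> p \<in> U \<and> (\<forall>q \<in> U. \<bar>f q - f p\<bar> < \<epsilon>)"
      using openin_agree[OF K(1) p] agree_self[OF p] by (intro exI[of _ "agree mtopology K p"]) simp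
  qed
  then show ?thesis
    unfolding kR_space_def using continuous_map_from_subtopology by blast
qed


section \<open>Exhaustions, separability and complete metrizability\<close>

text \<open>Only countably many balls have their centre in \<open>D\<close> and radius 1/(n+1). For
  each that fits into a compact open set one such set is chosen, and the partial unions in an
  enumeration form the increasing sequence.\<close>

lemma compact_open_exhaustion:
  assumes lc: "locally_compact_space mtopology" and zd: "zero_dimensional_space mtopology"
    and S: "S \<subseteq> M" and D: "countable D" "D \<subseteq> M" "\<forall>x \<in> S. \<forall>r>0. \<exists>y \<in> D. d x y < r"
  shows "\<exists>K::nat \<Rightarrow> 'a set. (\<forall>n. compactin mtopology (K n) \<and> openin mtopology (K n)) \<and> incseq K \<and> S \<subseteq> \<Union>(range K)"
proof (cases "D = {}")
  case True
  with D(3) have "S = {}" by (meson ex_in_conv zero_less_one)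
  then show ?thesis by (intro exI[of _ "\<lambda>_. {}"]) auto
next
  case False
  define good where "good V \<longleftrightarrow> compactin mtopology V \<and> openin mtopology V" for V
  \<comment> \<open>The default for balls that fit into no compact open set.\<close>
  have "good {}" by (simp add: good_def)
  then have "\<forall>i. \<exists>V. good V \<and> ((\<exists>V'. good V' \<and> mball (fst i) (inverse (real (Suc (snd i)))) \<subseteq> V') \<longrightarrow>
      mball (fst i) (inverse (real (Suc (snd i)))) \<subseteq> V)" by blast
  from choice[OF this] obtain C where C: "\<forall>i. good (C i) \<and>
      ((\<exists>V'. good V' \<and> mball (fst i) (inverse (real (Suc (snd i)))) \<subseteq> V') \<longrightarrow>
      mball (fst i) (inverse (real (Suc (snd i)))) \<subseteq> C i)" ..
  have C_good: "good (C i)" for i using C by blast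
  have C_sub: "mball y (inverse (real (Suc n))) \<subseteq> C (y, n)"
    if "good V" "mball y (inverse (real (Suc n))) \<subseteq> V" for y n V
    using C[rule_format, of "(y, n)"] that unfolding fst_conv snd_conv by blast
  have cov: "x \<in> \<Union>(C ` (D \<times> UNIV))" if x: "x \<in> S" for x
  proof -
    have xM: "x \<in> M" using x S by blast
    then have "compactin mtopology {x}" by simp
    then obtain V where V: "openin mtopology V" "compactin mtopology V" "x \<in> V"
      using locally_compact_compact_clopen[OF zd lc, of "{x}" M] xM by (metis empty_subsetI insert_subset open_in_mspace)
    obtain r where r: "r > 0" "mball x r \<subseteq> V" using V(1,3) unfolding openin_mtopology by blast
    obtain n :: nat where n: "inverse (real (Suc n)) < r/2" using reals_Archimedean[of "r/2"] r(1) by auto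
    have "0 < inverse (real (Suc n))" by simp
    then obtain y where y: "y \<in> D" "d x y < inverse (real (Suc n))" using D(3) x by blast
    then have yM: "y \<in> M" using D(2) by blast
    have "d y x + inverse (real (Suc n)) \<le> r" using y(2) n commute[of y x] by linarith
    then have "mball y (inverse (real (Suc n))) \<subseteq> mball x r" using xM by (rule mball_subset)
    then have "mball y (inverse (Suc n)) \<subseteq> C (y, n)" using V r(2) by (intro C_sub[of V]) (auto simp: good_def)
    moreover have "x \<in> mball y (inverse (real (Suc n)))" using y xM yM by (simp add: commute)
    ultimately show ?thesis using y(1) by blast
  qed
  have cI: "countable (D \<times> (UNIV :: nat set))" "D \<times> (UNIV :: nat set) \<noteq> {}" using D(1) False by auto
  define e where "e = from_nat_into (D \<times> (UNIV :: nat set))"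
  have re: "range e = D \<times> UNIV" unfolding e_def by (rule range_from_nat_into[OF cI(2,1)])
  define K where "K n = (\<Union>i\<in>{..n}. C (e i))" for n
  have "compactin mtopology (K n)" "openin mtopology (K n)" for n
    unfolding K_def using C_good unfolding good_def by (intro compactin_Union openin_Union; blast)+
  moreover have "incseq K" unfolding K_def incseq_def by fastforce
  moreover have "S \<subseteq> \<Union>(range K)"
  proof
    fix x assume "x \<in> S"
    then obtain i where "x \<in> C (e i)" using cov re by (metis (no_types, lifting) UN_E imageE)
    then show "x \<in> \<Union>(range K)" unfolding K_def by blast
  qed
  ultimately show ?thesis by blast
qed

text \<open>On a compact \<open>K\<close>, a map is described by two finite families from a
  countable base: one covers the part of \<open>K\<close> where the map is 1, the other the part
  where it is 0, each inside the corresponding clopen set. One map for every realisable pair of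
  families gives a countable dense set.\<close>

lemma separable_Ck2:
  assumes D: "countable D" "D \<subseteq> M" "\<forall>x \<in> M. \<forall>r>0. \<exists>y \<in> D. d x y < r"
  shows "separable_space (Ck2 mtopology)"
proof -
  define \<B> where "\<B> = (\<lambda>(y, n::nat). mball y (inverse (Suc n))) ` (D \<times> UNIV)"
  have c\<B>: "countable \<B>" unfolding \<B>_def using D(1) by auto
  have \<B>o: "openin mtopology V" if "V \<in> \<B>" for V using that unfolding \<B>_def by auto
  have \<B>: "\<exists>V \<in> \<B>. x \<in> V \<and> V \<subseteq> U" if U: "openin mtopology U" "x \<in> U" for U x
  proof -
    have xM: "x \<in> M" using openin_subset[OF U(1)] U(2) by auto
    obtain r where r: "r > 0" "mball x r \<subseteq> U" using U unfolding openin_mtopology by blast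
    obtain n :: nat where n: "inverse (real (Suc n)) < r/2" using reals_Archimedean[of "r/2"] r(1) by auto
    have "0 < inverse (real (Suc n))" by simp
    then obtain y where y: "y \<in> D" "d x y < inverse (real (Suc n))" using D(3) xM by blast
    then have yM: "y \<in> M" using D(2) by blast
    have "d y x + inverse (real (Suc n)) \<le> r" using y(2) n commute[of y x] by linarith
    then have "mball y (inverse (real (Suc n))) \<subseteq> mball x r" using xM by (rule mball_subset)
    moreover have "x \<in> mball y (inverse (real (Suc n)))" using y xM yM by (simp add: commute)
    moreover have "mball y (inverse (real (Suc n))) \<in> \<B>"
      unfolding \<B>_def using y(1) by (intro image_eqI[where x = "(y, n)"]) auto
    ultimately show ?thesis using r(2) by blast
  qed
  have sub: "\<exists>\<F>. finite \<F> \<and> \<F> \<subseteq> \<B> \<and> K \<subseteq> \<Union>\<F> \<and> \<Union>\<F> \<subseteq> U"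
    if K: "compactin mtopology K" and U: "openin mtopology U" "K \<subseteq> U" for K U
  proof -
    have "\<forall>x \<in> K. \<exists>V \<in> \<B>. x \<in> V \<and> V \<subseteq> U" using \<B>[OF U(1)] U(2) by blast
    then have "\<forall>x \<in> K. \<exists>V. V \<in> \<B> \<and> x \<in> V \<and> V \<subseteq> U" by blast
    from bchoice[OF this] obtain V where V: "\<forall>x \<in> K. V x \<in> \<B> \<and> x \<in> V x \<and> V x \<subseteq> U" ..
    then have "\<forall>x \<in> K. openin mtopology (V x) \<and> x \<in> V x" using \<B>o by blast
    from compactin_finite_cover[OF K this] obtain F where F: "finite F" "F \<subseteq> K" "K \<subseteq> \<Union>(V ` F)" by blast
    then show ?thesis using V by (intro exI[of _ "V ` F"]) blast
  qed
  define P where "P = {\<F>. finite \<F> \<and> \<F> \<subseteq> \<B>}"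
  have cP: "countable P" unfolding P_def using countable_Collect_finite_subset[OF c\<B>] by simp
  define fits where "fits = (\<lambda>(\<U>, \<V>) f. f \<in> maps2 mtopology \<and> (\<forall>x \<in> \<Union>\<U>. f x = 1) \<and> (\<forall>x \<in> \<Union>\<V>. f x = 0))"
  define c where "c i = (SOME f. fits i f)" for i
  define E where "E = c ` {i \<in> P \<times> P. \<exists>f. fits i f}"
  have "countable {i \<in> P \<times> P. \<exists>f. fits i f}" using cP by (intro countable_subset[of "{i \<in> P \<times> P. \<exists>f. fits i f}" "P \<times> P"]) auto
  then have cE: "countable E" unfolding E_def by (rule countable_image)
  have fitsc: "fits i (c i)" if "\<exists>f. fits i f" for i
    unfolding c_def using that by (rule someI_ex)
  have Em: "E \<subseteq> maps2 mtopology"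
    using fitsc unfolding E_def fits_def by (auto split: prod.splits)
  have dense: "\<exists>g \<in> E. g \<in> agree mtopology K f" if f: "f \<in> maps2 mtopology" and K: "compactin mtopology K" for f K
  proof -
    let ?T = "\<lambda>a. {x \<in> topspace mtopology. f x \<in> {a}}"
    have KM: "K \<subseteq> M" using compactin_subset_topspace[OF K] by simp
    have "\<exists>\<F>. finite \<F> \<and> \<F> \<subseteq> \<B> \<and> ?T a \<inter> K \<subseteq> \<Union>\<F> \<and> \<Union>\<F> \<subseteq> ?T a" for a
      by (rule sub[OF closed_Int_compactin[OF closedin_maps2[OF f] K] openin_maps2[OF f]]) blast
    then have "\<forall>a. \<exists>\<F>. finite \<F> \<and> \<F> \<subseteq> \<B> \<and> ?T a \<inter> K \<subseteq> \<Union>\<F> \<and> \<Union>\<F> \<subseteq> ?T a" ..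
    from choice[OF this] obtain \<F>
      where "\<forall>a. finite (\<F> a) \<and> \<F> a \<subseteq> \<B> \<and> ?T a \<inter> K \<subseteq> \<Union>(\<F> a) \<and> \<Union>(\<F> a) \<subseteq> ?T a" ..
    then have \<F>: "\<And>a. finite (\<F> a)" "\<And>a. \<F> a \<subseteq> \<B>" "\<And>a. ?T a \<inter> K \<subseteq> \<Union>(\<F> a)" "\<And>a. \<Union>(\<F> a) \<subseteq> ?T a"
      by blast+
    have "fits (\<F> 1, \<F> 0) f"
    proof -
      have "f x = 1" if "x \<in> \<Union>(\<F> 1)" for x using \<F>(4)[of 1] that by blast
      moreover have "f x = 0" if "x \<in> \<Union>(\<F> 0)" for x using \<F>(4)[of 0] that by blast
      ultimately show ?thesis using f by (simp only: fits_def prod.case) blast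
    qed
    then have ex: "\<exists>f. fits (\<F> 1, \<F> 0) f" by blast
    moreover have "(\<F> 1, \<F> 0) \<in> P \<times> P" using \<F>(1,2) by (simp add: P_def)
    ultimately have gE: "c (\<F> 1, \<F> 0) \<in> E" unfolding E_def by blast
    have "c (\<F> 1, \<F> 0) x = f x" if x: "x \<in> K" for x
    proof -
      have xM: "x \<in> topspace mtopology" using x KM by auto
      have cc: "\<forall>x \<in> \<Union>(\<F> 1). c (\<F> 1, \<F> 0) x = 1" "\<forall>x \<in> \<Union>(\<F> 0). c (\<F> 1, \<F> 0) x = 0"
        using fitsc[OF ex] unfolding fits_def prod.case by blast+
      from maps2_value[OF f xM] show ?thesis
      proof
        assume "f x = 0"
        then have "x \<in> \<Union>(\<F> 0)" using \<F>(3)[of 0] x xM by blast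
        with cc(2) have "c (\<F> 1, \<F> 0) x = 0" by blast
        with \<open>f x = 0\<close> show ?thesis by simp
      next
        assume "f x = 1"
        then have "x \<in> \<Union>(\<F> 1)" using \<F>(3)[of 1] x xM by blast
        with cc(1) have "c (\<F> 1, \<F> 0) x = 1" by blast
        with \<open>f x = 1\<close> show ?thesis by simp
      qed
    qed
    with gE Em show ?thesis unfolding agree_def by blast
  qed
  have "maps2 mtopology \<subseteq> Ck2 mtopology closure_of E"
  proof
    fix f assume f: "f \<in> maps2 mtopology"
    show "f \<in> Ck2 mtopology closure_of E"
      unfolding in_closure_of
    proof (intro conjI allI impI)
      fix T assume "f \<in> T \<and> openin (Ck2 mtopology) T"
      then obtain K where "compactin mtopology K" "agree mtopology K f \<subseteq> T"
        unfolding openin_Ck2 by blast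
      with dense[OF f] show "\<exists>y. y \<in> E \<and> y \<in> T" by blast
    qed (use f in simp)
  qed
  moreover have "Ck2 mtopology closure_of E \<subseteq> maps2 mtopology"
    using closure_of_subset_topspace[of "Ck2 mtopology" E] by simp
  ultimately show ?thesis
    unfolding separable_space_def using cE Em by (intro exI[of _ E]) auto
qed

text \<open>The metric is 1/(n+1) for the first \<open>n\<close> such that the maps differ on
  \<open>K n\<close>. As the \<open>K n\<close> are open, increasing and cover the space, each
  compact set lies in one of them, so the sets \<open>agree mtopology (K n) f\<close> form a base at
  \<open>f\<close>.\<close>

lemma completely_metrizable_Ck2:
  fixes K :: "nat \<Rightarrow> 'a set"
  assumes K: "\<And>n. compactin mtopology (K n)" "\<And>n. openin mtopology (K n)" "incseq K" "\<Union>(range K) = M"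
  shows "completely_metrizable_space (Ck2 mtopology)"
proof -
  let ?C = "maps2 mtopology"
  define \<rho> :: "('a \<Rightarrow> nat) \<Rightarrow> ('a \<Rightarrow> nat) \<Rightarrow> real"
    where "\<rho> f g = (if f = g then 0 else inverse (real (Suc (LEAST n. \<exists>x \<in> K n. f x \<noteq> g x))))" for f g
  have KM: "K n \<subseteq> M" for n using compactin_subset_topspace[OF K(1)] by simp
  have Kmono: "K m \<subseteq> K n" if "m \<le> n" for m n using K(3) that by (rule incseqD)
  have \<rho>_nonneg: "0 \<le> \<rho> f g" for f g by (simp add: \<rho>_def)
  have differ: "\<exists>n. \<exists>x \<in> K n. f x \<noteq> g x" if fg: "f \<in> ?C" "g \<in> ?C" "f \<noteq> g" for f g
  proof (rule ccontr)
    assume neg: "\<not> ?thesis"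
    have "f x = g x" if "x \<in> topspace mtopology" for x
    proof -
      have "x \<in> \<Union>(range K)" using that K(4) by simp
      with neg show ?thesis by blast
    qed
    then have "f = g" by (rule maps2_ext[OF fg(1,2)])
    with fg(3) show False by simp
  qed
  \<comment> \<open>A first difference at \<open>n\<close> gives distance exactly 1/(n+1), which the
    strict inequality excludes; hence agreement up to and including \<open>K n\<close>.\<close>
  have key: "\<rho> f g < inverse (real (Suc n)) \<longleftrightarrow> (\<forall>x \<in> K n. f x = g x)" if fg: "f \<in> ?C" "g \<in> ?C" for f g n
  proof (cases "f = g")
    case False
    let ?L = "LEAST n. \<exists>x \<in> K n. f x \<noteq> g x"
    have L: "\<exists>x \<in> K ?L. f x \<noteq> g x" using differ[OF fg False] by (rule LeastI_ex)
    have "\<rho> f g < inverse (real (Suc n)) \<longleftrightarrow> n < ?L" by (simp add: \<rho>_def False)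
    also have "\<dots> \<longleftrightarrow> (\<forall>x \<in> K n. f x = g x)"
    proof
      assume "n < ?L"
      then show "\<forall>x \<in> K n. f x = g x" using not_less_Least by blast
    next
      assume R: "\<forall>x \<in> K n. f x = g x"
      show "n < ?L"
      proof (rule ccontr)
        assume "\<not> n < ?L"
        then have "K ?L \<subseteq> K n" by (intro Kmono) simp
        with L R show False by blast
      qed
    qed
    finally show ?thesis .
  qed (simp add: \<rho>_def)
  have sym: "\<rho> f g = \<rho> g f" for f g
    unfolding \<rho>_def by (simp add: eq_commute)
  interpret F: Metric_space ?C \<rho>
  proof
    show "0 \<le> \<rho> f g" for f g by (rule \<rho>_nonneg)
    show "\<rho> f g = \<rho> g f" for f g by (rule sym)
    show "\<rho> f g = 0 \<longleftrightarrow> f = g" for f g by (simp add: \<rho>_def)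
    show "\<rho> f h \<le> \<rho> f g + \<rho> g h" if C: "f \<in> ?C" "g \<in> ?C" "h \<in> ?C" for f g h
    proof (cases "f = h")
      case True
      then show ?thesis using \<rho>_nonneg by (simp add: \<rho>_def)
    next
      case False
      let ?L = "LEAST n. \<exists>x \<in> K n. f x \<noteq> h x"
      have "\<exists>x \<in> K ?L. f x \<noteq> h x" using differ[OF C(1,3) False] by (rule LeastI_ex)
      then obtain z where z: "z \<in> K ?L" "f z \<noteq> h z" by blast
      have fh: "\<rho> f h = inverse (real (Suc ?L))" by (simp add: \<rho>_def False)
      \<comment> \<open>The ultrametric inequality: a point of \<open>K ?L\<close> that separates
        \<open>f\<close> from \<open>h\<close> separates \<open>g\<close> from one of them.\<close>
      have "\<not> (\<rho> f g < inverse (real (Suc ?L)) \<and> \<rho> g h < inverse (real (Suc ?L)))"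
      proof (unfold key[OF C(1,2)] key[OF C(2,3)], intro notI, elim conjE)
        assume "\<forall>x \<in> K ?L. f x = g x" "\<forall>x \<in> K ?L. g x = h x"
        with z(1) have "f z = g z" "g z = h z" by blast+
        with z(2) show False by simp
      qed
      then show ?thesis using fh \<rho>_nonneg[of f g] \<rho>_nonneg[of g h] by linarith
    qed
  qed
  have ball: "F.mball f (inverse (real (Suc n))) = agree mtopology (K n) f" if "f \<in> ?C" for f n
  proof -
    have "g \<in> F.mball f (inverse (real (Suc n))) \<longleftrightarrow> g \<in> agree mtopology (K n) f" for g
    proof -
      have "g \<in> F.mball f (inverse (real (Suc n))) \<longleftrightarrow> g \<in> ?C \<and> (\<forall>x \<in> K n. f x = g x)"
        using that key[of f g n] unfolding F.in_mball by blast
      then show ?thesis by (auto simp: agree_def)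
    qed
    then show ?thesis by blast
  qed
  have inK: "\<exists>n. L \<subseteq> K n" if L: "compactin mtopology L" for L
  proof -
    have "\<forall>x \<in> L. \<exists>n. x \<in> K n" using compactin_subset_topspace[OF L] K(4) by auto
    from bchoice[OF this] obtain m where m: "\<forall>x \<in> L. x \<in> K (m x)" ..
    then have "\<forall>x \<in> L. openin mtopology (K (m x)) \<and> x \<in> K (m x)" using K(2) by blast
    from compactin_finite_cover[OF L this] obtain F where F: "finite F" "F \<subseteq> L" "L \<subseteq> (\<Union>x\<in>F. K (m x))" by blast
    obtain N where N: "\<forall>x \<in> F. m x \<le> N"
      using finite_nat_set_iff_bounded_le[of "m ` F"] F(1) by auto
    then have "(\<Union>x\<in>F. K (m x)) \<subseteq> K N" using Kmono by blast
    with F(3) show ?thesis by blast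
  qed
  have top: "F.mtopology = Ck2 mtopology"
    unfolding topology_eq
  proof (intro allI iffI)
    fix W assume W: "openin F.mtopology W"
    show "openin (Ck2 mtopology) W"
      unfolding openin_Ck2
    proof (intro conjI ballI)
      show "W \<subseteq> ?C" using openin_subset[OF W] unfolding F.topspace_mtopology .
      fix f assume f: "f \<in> W"
      then obtain r where r: "r > 0" "F.mball f r \<subseteq> W" using W unfolding F.openin_mtopology by blast
      obtain n :: nat where n: "inverse (real (Suc n)) < r" using reals_Archimedean r(1) by blast
      have "f \<in> ?C" using f \<open>W \<subseteq> ?C\<close> by blast
      then have "agree mtopology (K n) f \<subseteq> W"
        using r(2) F.mball_subset_concentric[of "inverse (real (Suc n))" r f] n ball[of f n] by auto
      with K(1) show "\<exists>K. compactin mtopology K \<and> agree mtopology K f \<subseteq> W" by blast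
    qed
  next
    fix W assume W: "openin (Ck2 mtopology) W"
    show "openin F.mtopology W"
      unfolding F.openin_mtopology
    proof (intro conjI allI impI)
      show WC: "W \<subseteq> ?C" using openin_subset[OF W] by simp
      fix f assume f: "f \<in> W"
      then obtain L where L: "compactin mtopology L" "agree mtopology L f \<subseteq> W"
        using W unfolding openin_Ck2 by blast
      obtain n where n: "L \<subseteq> K n" using inK[OF L(1)] by blast
      have "F.mball f (inverse (real (Suc n))) = agree mtopology (K n) f" using f WC by (intro ball) blast
      also have "\<dots> \<subseteq> agree mtopology L f" using n unfolding agree_def by blast
      finally show "\<exists>r>0. F.mball f r \<subseteq> W" using L(2) by (intro exI[of _ "inverse (real (Suc n))"]) auto
    qed
  qed
  have "F.mcomplete"
    unfolding F.mcomplete_def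
  proof (intro allI impI)
    fix \<sigma> assume \<sigma>: "F.MCauchy \<sigma>"
    have \<sigma>C: "\<sigma> n \<in> ?C" for n using \<sigma> unfolding F.MCauchy_def by auto
    \<comment> \<open>A Cauchy sequence is stationary on each \<open>K n\<close>, and its limit is
      continuous because the \<open>K n\<close> are open.\<close>
    have "\<exists>N. \<forall>m\<ge>N. \<forall>x \<in> K n. \<sigma> N x = \<sigma> m x" for n
    proof -
      have "0 < inverse (real (Suc n))" by simp
      then obtain N where N: "\<forall>m m'. N \<le> m \<longrightarrow> N \<le> m' \<longrightarrow> \<rho> (\<sigma> m) (\<sigma> m') < inverse (real (Suc n))"
        using \<sigma> unfolding F.MCauchy_def by blast
      have "\<forall>x \<in> K n. \<sigma> N x = \<sigma> m x" if "m \<ge> N" for m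
        using N that unfolding key[OF \<sigma>C \<sigma>C] by blast
      then show ?thesis by blast
    qed
    then obtain N where N: "\<And>n m x. \<lbrakk>m \<ge> N n; x \<in> K n\<rbrakk> \<Longrightarrow> \<sigma> (N n) x = \<sigma> m x" by metis
    have "\<forall>x \<in> M. \<exists>n. x \<in> K n" using K(4) by auto
    from bchoice[OF this] obtain k where k: "\<forall>x \<in> M. x \<in> K (k x)" ..
    define g where "g = (\<lambda>x \<in> M. \<sigma> (N (k x)) x)"
    have g: "g x = \<sigma> (N n) x" if x: "x \<in> K n" for x n
    proof -
      have xM: "x \<in> M" using x KM by blast
      let ?m = "max (N n) (N (k x))"
      have "\<sigma> (N (k x)) x = \<sigma> ?m x" using k xM by (intro N) auto
      moreover have "\<sigma> (N n) x = \<sigma> ?m x" using x by (intro N) auto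
      ultimately show ?thesis using xM by (simp add: g_def)
    qed
    have gC: "g \<in> ?C"
    proof (rule maps2I)
      show "g \<in> extensional (topspace mtopology)" by (simp add: g_def)
      fix x assume x: "x \<in> topspace mtopology"
      then have xk: "x \<in> K (k x)" using k by simp
      show "g x = 0 \<or> g x = 1" unfolding g[OF xk] by (rule maps2_value[OF \<sigma>C x])
      let ?V = "K (k x) \<inter> {y \<in> topspace mtopology. \<sigma> (N (k x)) y \<in> {\<sigma> (N (k x)) x}}"
      have "openin mtopology ?V" using K(2) openin_maps2[OF \<sigma>C] by blast
      moreover have "x \<in> ?V" using x xk by simp
      moreover have "g y = g x" if y: "y \<in> ?V" for y
      proof -
        have "y \<in> K (k x)" "\<sigma> (N (k x)) y = \<sigma> (N (k x)) x" using y by auto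
        then show ?thesis using g[OF xk] g[of y "k x"] by simp
      qed
      ultimately show "\<exists>U. openin mtopology U \<and> x \<in> U \<and> (\<forall>y \<in> U. g y = g x)" by blast
    qed
    have "limitin (Ck2 mtopology) \<sigma> g sequentially"
      unfolding Ck2_def
    proof (rule limitin_compact_open[OF gC \<sigma>C])
      fix L assume "compactin mtopology L"
      then obtain n where n: "L \<subseteq> K n" using inK by blast
      have "\<forall>x \<in> L. \<sigma> m x = g x" if "m \<ge> N n" for m
      proof
        fix x assume "x \<in> L"
        then have "x \<in> K n" using n by blast
        then show "\<sigma> m x = g x" using N[OF that] g by simp
      qed
      then show "\<forall>\<^sub>F m in sequentially. \<forall>x \<in> L. \<sigma> m x = g x" unfolding eventually_sequentially by blast
    qed
    then show "\<exists>x. limitin F.mtopology \<sigma> x sequentially" unfolding top by blast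
  qed
  then have "completely_metrizable_space F.mtopology" by (rule F.completely_metrizable_space_mtopology)
  then show ?thesis by (simp only: top)
qed

text \<open>In the completion, isolated points of \<open>M\<close> remain isolated, so \<open>M\<close> is the union of an open and a
  compact set.\<close>

lemma completely_metrizable_compact_derived:
  assumes cX': "compactin mtopology (mtopology derived_set_of M)"
  shows "completely_metrizable_space mtopology"
proof -
  let ?X' = "mtopology derived_set_of M"
  obtain f :: "['a,'a] \<Rightarrow> real" and m' where
    m': "mcomplete_of m'" and fim: "f \<in> M \<rightarrow> mspace m'"
    and clo: "mtopology_of m' closure_of f ` M = mspace m'"
    and iso: "\<And>x y. \<lbrakk>x \<in> M; y \<in> M\<rbrakk> \<Longrightarrow> mdist m' (f x) (f y) = d x y"
    by (metis metric_completion)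
  let ?Y = "mtopology_of m'"
  have emb: "embedding_map mtopology ?Y f"
    using fim iso unfolding mtopology_of_def
    by (metis Metric_space12.isometry_imp_embedding_map Metric_space12_mspace_mdist mdist_metric mspace_metric)
  have cY: "completely_metrizable_space ?Y"
    using m' unfolding mcomplete_of_def mtopology_of_def
    by (metis Metric_space.completely_metrizable_space_mtopology Metric_space_mspace_mdist)
  have metrY: "metrizable_space ?Y" using cY completely_metrizable_imp_metrizable_space by blast
  have HY: "Hausdorff_space ?Y" using metrY metrizable_imp_Hausdorff_space by blast
  have fc: "continuous_map mtopology ?Y f"
    using emb unfolding embedding_map_def
    by (meson continuous_map_into_fulltopology homeomorphic_imp_continuous_map)
  have "compactin ?Y (f ` ?X')" by (rule image_compactin[OF cX' fc])
  then have "closedin ?Y (f ` ?X')" by (rule compactin_imp_closedin[OF HY])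
  then have g1: "gdelta_in ?Y (f ` ?X')" using metrY by (rule closed_imp_gdelta_in[rotated])
  have "openin ?Y {f x}" if x: "x \<in> M - ?X'" for x
  proof -
    have "openin mtopology {x}" using x isolated_openin[of x mtopology] by simp
    then have "openin (subtopology ?Y (f ` M)) (f ` {x})"
      using emb unfolding embedding_map_def
      by (metis homeomorphic_imp_open_map open_map_def topspace_mtopology)
    then obtain T where T: "openin ?Y T" "{f x} = T \<inter> f ` M" unfolding openin_subtopology by auto
    have "f x \<in> topspace ?Y" using T(2) openin_subset[OF T(1)] by blast
    then have "closedin ?Y {f x}" by (rule closedin_Hausdorff_singleton[OF HY])
    then have "openin ?Y (T - {f x})" by (rule openin_diff[OF T(1)])
    moreover have "(T - {f x}) \<inter> f ` M = {}" using T(2) by blast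
    \<comment> \<open>Apart from \<open>f x\<close>, the open set \<open>T\<close> misses the image
      of \<open>M\<close>. The image is dense, so \<open>T\<close> is a singleton.\<close>
    ultimately have "(T - {f x}) \<inter> ?Y closure_of (f ` M) = {}"
      using openin_Int_closure_of_eq_empty by metis
    moreover have "T \<subseteq> ?Y closure_of (f ` M)"
      unfolding clo using openin_subset[OF T(1)] by simp
    ultimately have "T = {f x}" using T(2) by blast
    with T(1) show ?thesis by simp
  qed
  then have "openin ?Y (\<Union>x\<in>M - ?X'. {f x})" by blast
  then have g2: "gdelta_in ?Y (\<Union>x\<in>M - ?X'. {f x})" by (rule open_imp_gdelta_in)
  have "?X' \<subseteq> M" using derived_set_of_subset_topspace[of mtopology M] by simp
  then have "f ` M = f ` ?X' \<union> (\<Union>x\<in>M - ?X'. {f x})" by blast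
  with gdelta_in_Un[OF g1 g2] have "gdelta_in ?Y (f ` M)" by simp
  then have "completely_metrizable_space (subtopology ?Y (f ` M))"
    by (rule completely_metrizable_space_gdelta_in[OF cY])
  moreover have "mtopology homeomorphic_space subtopology ?Y (f ` M)"
    using emb by (metis embedding_map_imp_homeomorphic_space topspace_mtopology)
  ultimately show ?thesis using homeomorphic_completely_metrizable_space by blast
qed


section \<open>Topological sums and Polish function spaces\<close>

lemma separable_subspace_iff:
  assumes SM: "S \<subseteq> M"
  shows "separable_space (subtopology mtopology S) \<longleftrightarrow>
    (\<exists>D. countable D \<and> D \<subseteq> S \<and> (\<forall>x \<in> S. \<forall>r>0. \<exists>y \<in> D. d x y < r))"
proof
  have tS: "topspace (subtopology mtopology S) = S" using SM by auto
  {
    assume "separable_space (subtopology mtopology S)"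
    then obtain D where D: "countable D" "D \<subseteq> S" "subtopology mtopology S closure_of D = S"
      unfolding separable_space_def tS by blast
    have "\<exists>y \<in> D. d x y < r" if x: "x \<in> S" and r: "0 < r" for x r
    proof -
      have cl: "\<forall>T. x \<in> T \<and> openin (subtopology mtopology S) T \<longrightarrow> (\<exists>y. y \<in> D \<and> y \<in> T)"
        using x D(3) by (metis in_closure_of)
      have "x \<in> S \<inter> mball x r" using x r SM by auto
      moreover have "openin (subtopology mtopology S) (S \<inter> mball x r)"
        by (simp add: openin_subtopology_Int2)
      ultimately have "\<exists>y. y \<in> D \<and> y \<in> S \<inter> mball x r" by (intro cl[rule_format] conjI)
      then show ?thesis by auto
    qed
    with D(1,2) show "\<exists>D. countable D \<and> D \<subseteq> S \<and> (\<forall>x \<in> S. \<forall>r>0. \<exists>y \<in> D. d x y < r)"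
      by (intro exI[of _ D]) simp
  }
  {
    assume "\<exists>D. countable D \<and> D \<subseteq> S \<and> (\<forall>x \<in> S. \<forall>r>0. \<exists>y \<in> D. d x y < r)"
    then obtain D where D: "countable D" "D \<subseteq> S" "\<forall>x \<in> S. \<forall>r>0. \<exists>y \<in> D. d x y < r" by blast
    have "x \<in> subtopology mtopology S closure_of D" if x: "x \<in> S" for x
      unfolding in_closure_of tS
    proof (intro conjI x allI impI)
      fix T assume "x \<in> T \<and> openin (subtopology mtopology S) T"
      then obtain U where U: "openin mtopology U" "T = U \<inter> S" "x \<in> U" unfolding openin_subtopology by blast
      then obtain r where r: "r > 0" "mball x r \<subseteq> U" unfolding openin_mtopology by blast
      obtain y where y: "y \<in> D" "d x y < r" using D(3) x r(1) by blast
      then have "y \<in> mball x r" using x D(2) SM by auto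
      with y(1) r(2) U(2) D(2) show "\<exists>y. y \<in> D \<and> y \<in> T" by blast
    qed
    moreover have "subtopology mtopology S closure_of D \<subseteq> S"
      using closure_of_subset_topspace[of "subtopology mtopology S" D] tS by simp
    ultimately show "separable_space (subtopology mtopology S)"
      unfolding separable_space_def tS using D(1,2) by (intro exI[of _ D]) blast
  }
qed

text \<open>Exhausting \<open>L\<close> by compact open sets leaves over only points of
  \<open>D\<close>. The sum structure makes these isolated in the whole space, so
  \<open>k_space_Ck2_exhaustion\<close> applies.\<close>

lemma k_space_Ck2_topological_sum:
  assumes zd: "zero_dimensional_space mtopology" and sum: "topological_sum_of mtopology L D"
    and sep: "separable_space (subtopology mtopology L)"
    and lcL: "locally_compact_space (subtopology mtopology L)"
    and disc: "subtopology mtopology D = discrete_topology D"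
  shows "k_space (Ck2 mtopology)"
proof -
  have LD: "M = L \<union> D" "L \<inter> D = {}"
    and op: "\<And>U. U \<subseteq> M \<Longrightarrow> openin mtopology U \<longleftrightarrow>
      openin (subtopology mtopology L) (U \<inter> L) \<and> openin (subtopology mtopology D) (U \<inter> D)"
    using sum unfolding topological_sum_of_def by auto
  have LM: "L \<subseteq> M" using LD by blast
  have tL: "topspace (subtopology mtopology L) = L" using LM by auto
  have "openin (subtopology mtopology L) L" using openin_topspace[of "subtopology mtopology L"] tL by simp
  then have Lo: "openin mtopology L" using op[OF LM] LD(2) by simp
  have iso: "openin mtopology {x}" if x: "x \<in> D" for x
  proof -
    have "{x} \<subseteq> M" "{x} \<inter> L = {}" "{x} \<inter> D = {x}" using x LD by auto
    moreover have "openin (subtopology mtopology D) {x}" using x by (simp add: disc)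
    ultimately show ?thesis using op[of "{x}"] by simp
  qed
  have lc: "locally_compact_space mtopology"
    unfolding locally_compact_space_def
  proof
    fix x assume "x \<in> topspace mtopology"
    then have "x \<in> L \<union> D" unfolding topspace_mtopology by (simp only: LD(1))
    then consider "x \<in> L" | "x \<in> D" by blast
    then show "\<exists>U K. openin mtopology U \<and> compactin mtopology K \<and> x \<in> U \<and> U \<subseteq> K"
    proof cases
      case 1
      then obtain U K where "openin (subtopology mtopology L) U" "compactin (subtopology mtopology L) K" "x \<in> U" "U \<subseteq> K"
        using lcL unfolding locally_compact_space_def tL by blast
      moreover from this have "openin mtopology U" using Lo openin_trans_full by blast
      moreover have "compactin mtopology K" using calculation(2) by (simp add: compactin_subtopology)
      ultimately show ?thesis by blast
    next
      case 2
      then have "x \<in> M" using LD(1) by blast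
      then show ?thesis using iso[OF 2] by (intro exI[of _ "{x}"]) simp
    qed
  qed
  obtain C where C: "countable C" "C \<subseteq> L" "\<forall>x \<in> L. \<forall>r>0. \<exists>y \<in> C. d x y < r"
    using sep unfolding separable_subspace_iff[OF LM] by blast
  then have "C \<subseteq> M" using LM by blast
  from compact_open_exhaustion[OF lc zd LM C(1) this C(3)] obtain K :: "nat \<Rightarrow> 'a set"
    where K: "\<forall>n. compactin mtopology (K n) \<and> openin mtopology (K n)" "incseq K" "L \<subseteq> \<Union>(range K)" by blast
  show ?thesis
  proof (rule k_space_Ck2_exhaustion)
    show "openin mtopology {x}" if "x \<in> topspace mtopology - \<Union>(range K)" for x
    proof (rule iso)
      have "x \<in> L \<union> D" using that unfolding topspace_mtopology by (simp only: LD(1) Diff_iff)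
      then show "x \<in> D" using that K(3) by blast
    qed
  qed (use K in auto)
qed

text \<open>The derived set need not be open, so \<open>L\<close> is the union of compact open sets
  that cover it. The remaining points are isolated, which makes \<open>L\<close> clopen; a separated
  subset of \<open>L\<close> meets each \<open>K n\<close> in a finite set, so \<open>L\<close> is
  separable.\<close>

lemma topological_sum_of_k_space_Ck2:
  assumes zd: "zero_dimensional_space mtopology" and lc: "locally_compact_space mtopology"
    and k: "k_space (Ck2 mtopology)"
  shows "\<exists>L D. topological_sum_of mtopology L D \<and>
    separable_space (subtopology mtopology L) \<and> metrizable_space (subtopology mtopology L) \<and>
    locally_compact_space (subtopology mtopology L) \<and> subtopology mtopology D = discrete_topology D"
proof -
  let ?X' = "mtopology derived_set_of M"
  have X'M: "?X' \<subseteq> M" using derived_set_of_subset_topspace[of mtopology M] by simp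
  have "\<exists>C. countable C \<and> C \<subseteq> ?X' \<and> (\<forall>x \<in> ?X'. \<forall>r>0. \<exists>y \<in> C. d x y < r)"
  proof (rule countable_dense_subset[OF X'M])
    show "countable T" if "0 < \<epsilon>" "T \<subseteq> ?X'" "separated_set \<epsilon> T" for \<epsilon> T
      by (rule k_space_Ck2_imp_derived_separable[OF zd k that(2,3,1)])
  qed
  then obtain C where C: "countable C" "C \<subseteq> ?X'" "\<forall>x \<in> ?X'. \<forall>r>0. \<exists>y \<in> C. d x y < r"
    by (elim exE conjE)
  then have "C \<subseteq> M" using X'M by blast
  from compact_open_exhaustion[OF lc zd X'M C(1) this C(3)] obtain K :: "nat \<Rightarrow> 'a set"
    where K: "\<forall>n. compactin mtopology (K n) \<and> openin mtopology (K n)" "incseq K" "?X' \<subseteq> \<Union>(range K)" by blast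
  define L where "L = \<Union>(range K)"
  define D where "D = M - L"
  have Lo: "openin mtopology L" unfolding L_def using K(1) by blast
  have LM: "L \<subseteq> M" using openin_subset[OF Lo] by simp
  have iso: "openin mtopology {x}" if "x \<in> D" for x
    using that K(3) isolated_openin[of x mtopology] by (auto simp: D_def L_def)
  then have "openin mtopology (\<Union>x\<in>D. {x})" by blast
  then have Do: "openin mtopology D" by simp
  then have Lc: "closedin mtopology L"
    using LM by (simp add: closedin_def D_def)
  have "topological_sum_of mtopology L D"
    unfolding topological_sum_of_def
  proof (intro conjI allI impI)
    show "topspace mtopology = L \<union> D" "L \<inter> D = {}" using LM by (auto simp: D_def)
    fix U assume U: "U \<subseteq> topspace mtopology"
    have "U = (U \<inter> L) \<union> (U \<inter> D)" using U by (auto simp: D_def)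
    then have "openin mtopology U \<longleftrightarrow> openin mtopology (U \<inter> L) \<and> openin mtopology (U \<inter> D)"
      by (metis Do Lo openin_Int openin_Un)
    then show "openin mtopology U \<longleftrightarrow>
        openin (subtopology mtopology L) (U \<inter> L) \<and> openin (subtopology mtopology D) (U \<inter> D)"
      using openin_open_subtopology[OF Lo] openin_open_subtopology[OF Do] by simp
  qed
  moreover have "separable_space (subtopology mtopology L)"
    unfolding separable_subspace_iff[OF LM]
  proof (rule countable_dense_subset[OF LM])
    fix \<epsilon> T assume T: "0 < \<epsilon>" "T \<subseteq> L" "separated_set \<epsilon> T"
    then have TM: "T \<subseteq> M" using LM by blast
    have "T \<inter> K n \<subseteq> {s \<in> T. K n \<inter> mball s (\<epsilon>/4) \<noteq> {}}" for n
    proof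
      fix s assume s: "s \<in> T \<inter> K n"
      then have "s \<in> K n \<inter> mball s (\<epsilon>/4)" using T(1) TM by auto
      with s show "s \<in> {s \<in> T. K n \<inter> mball s (\<epsilon>/4) \<noteq> {}}" by blast
    qed
    then have "finite (T \<inter> K n)" for n
      using separated_set_compactin_finite[OF _ TM T(3,1)] K(1) finite_subset by metis
    then have "countable (\<Union>n. T \<inter> K n)" by (intro countable_UN) (auto intro: countable_finite)
    moreover have "(\<Union>n. T \<inter> K n) = T" using T(2) by (auto simp: L_def)
    ultimately show "countable T" by simp
  qed
  moreover have "metrizable_space (subtopology mtopology L)"
    by (simp add: metrizable_space_mtopology metrizable_space_subtopology)
  moreover have "locally_compact_space (subtopology mtopology L)"
    by (rule locally_compact_space_closed_subset[OF lc Lc])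
  moreover have "subtopology mtopology D = discrete_topology D"
  proof -
    have "D \<subseteq> M" by (auto simp: D_def)
    then have "discrete_topology D = subtopology mtopology D"
      unfolding discrete_topology_unique
      using iso openin_open_subtopology[OF Do] by auto
    then show ?thesis by simp
  qed
  ultimately show ?thesis by blast
qed

lemma separable_imp_exhaustion:
  assumes lc: "locally_compact_space mtopology" and zd: "zero_dimensional_space mtopology"
    and sep: "separable_space mtopology"
  shows "\<exists>K::nat \<Rightarrow> 'a set. (\<forall>n. compactin mtopology (K n) \<and> openin mtopology (K n)) \<and> incseq K \<and> \<Union>(range K) = M"
proof -
  obtain D where D: "countable D" "D \<subseteq> M" "\<forall>x \<in> M. \<forall>r>0. \<exists>y \<in> D. d x y < r"
    using sep separable_subspace_iff[OF subset_refl] by auto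
  from compact_open_exhaustion[OF lc zd subset_refl D] obtain K :: "nat \<Rightarrow> 'a set"
    where K: "\<forall>n. compactin mtopology (K n) \<and> openin mtopology (K n)" "incseq K" "M \<subseteq> \<Union>(range K)" by blast
  moreover have "K n \<subseteq> M" for n using K(1) compactin_subset_topspace[of mtopology "K n"] by simp
  ultimately show ?thesis by (intro exI[of _ K]) blast
qed

lemma Polish_Ck2:
  assumes lc: "locally_compact_space mtopology" and zd: "zero_dimensional_space mtopology"
    and sep: "separable_space mtopology"
  shows "Polish_space (Ck2 mtopology)"
proof -
  obtain K :: "nat \<Rightarrow> 'a set"
    where "\<forall>n. compactin mtopology (K n) \<and> openin mtopology (K n)" "incseq K" "\<Union>(range K) = M"
    using separable_imp_exhaustion[OF assms] by blast
  then have "completely_metrizable_space (Ck2 mtopology)"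
    by (intro completely_metrizable_Ck2[of K]) auto
  moreover have "separable_space (Ck2 mtopology)"
    using sep separable_subspace_iff[OF subset_refl] separable_Ck2 by auto
  ultimately show ?thesis by (simp add: Polish_space_def)
qed

end

section \<open>Cycles of implications behind the four characterisations\<close>

theorem theorem1p4:
  fixes M :: "'a set" and d :: "'a \<Rightarrow> 'a \<Rightarrow> real" and X :: "'a topology" and X' :: "'a set"
  assumes "Metric_space M d"
    and "X = Metric_space.mtopology M d"
    and "zero_dimensional_space X"
    and "X' = X derived_set_of topspace X"
  shows
    "((Ascoli_space (Ck2 X) \<longleftrightarrow> kR_space (Ck2 X)) \<and>
      (kR_space (Ck2 X) \<longleftrightarrow>
        locally_compact_space X \<or> (\<not> locally_compact_space X \<and> compactin X X')))
     \<and>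
     (k_space (Ck2 X) \<longleftrightarrow>
       (\<exists>L D. topological_sum_of X L D \<and>
          separable_space (subtopology X L) \<and> metrizable_space (subtopology X L) \<and>
          locally_compact_space (subtopology X L) \<and>
          subtopology X D = discrete_topology D)
       \<or> (\<not> locally_compact_space X \<and> compactin X X'))
     \<and>
     (sequential_space (Ck2 X) \<longleftrightarrow>
       Polish_space X \<and>
       (locally_compact_space X \<or> (\<not> locally_compact_space X \<and> compactin X X')))
     \<and>
     ((Frechet_Urysohn_space (Ck2 X) \<longleftrightarrow> Polish_space (Ck2 X)) \<and>
      (Polish_space (Ck2 X) \<longleftrightarrow> Polish_space X \<and> locally_compact_space X))"
proof -
  interpret Metric_space M d by fact
  have X: "X = mtopology" by fact
  have zd: "zero_dimensional_space mtopology" using assms(3) by (simp add: X)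
  have X': "X' = mtopology derived_set_of M" using assms(4) by (simp add: X)
  have kR_Asc: "Ascoli_space (Ck2 X)" if "kR_space (Ck2 X)"
    by (rule kR_space_imp_Ascoli[OF that regular_Ck2 Hausdorff_Ck2])
  have Asc: "locally_compact_space X \<or> compactin X X'" if "Ascoli_space (Ck2 X)"
    using Ascoli_Ck2_imp[OF zd] that by (simp add: X X')
  have k_kR: "kR_space (Ck2 X)" if "k_space (Ck2 X)"
    by (rule k_space_imp_kR_space[OF that])
  have lc_kR: "kR_space (Ck2 X)" if "locally_compact_space X"
    using kR_space_Ck2_locally_compact zd that by (simp add: X)
  have X'_k: "k_space (Ck2 X)" if "compactin X X'"
    using k_space_Ck2_compact_derived that by (simp add: X X')
  have seq_k: "k_space (Ck2 X)" if "sequential_space (Ck2 X)"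
    by (rule sequential_imp_k_space[OF that])
  have FU_seq: "sequential_space (Ck2 X)" if "Frechet_Urysohn_space (Ck2 X)"
    by (rule Frechet_Urysohn_imp_sequential[OF that])
  have compl: "completely_metrizable_space X" if "locally_compact_space X \<or> compactin X X'"
    using that locally_compact_imp_completely_metrizable_space completely_metrizable_compact_derived
    by (auto simp: X X')
  have seq_Polish: "Polish_space X" if seq: "sequential_space (Ck2 X)"
  proof -
    have "separable_space (subtopology mtopology M)"
      unfolding separable_subspace_iff[OF subset_refl]
    proof (rule countable_dense_subset[OF subset_refl])
      show "countable T" if "0 < \<epsilon>" "T \<subseteq> M" "separated_set \<epsilon> T" for \<epsilon> T
        by (rule sequential_Ck2_imp_separable[OF zd seq[unfolded X] that(2,3,1)])
    qed
    then have "separable_space X" by (simp add: X)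
    moreover have "completely_metrizable_space X"
      using seq seq_k k_kR kR_Asc Asc compl by blast
    ultimately show ?thesis by (simp add: Polish_space_def)
  qed
  have Polish_Polish: "Polish_space (Ck2 X)" if "Polish_space X" "locally_compact_space X"
    using Polish_Ck2 zd that by (simp add: X Polish_space_def)
  have Polish_FU: "Frechet_Urysohn_space (Ck2 X)" if "Polish_space (Ck2 X)"
    using that metrizable_imp_Frechet_Urysohn completely_metrizable_imp_metrizable_space
    unfolding Polish_space_def by blast
  have FU_lc: "locally_compact_space X" if "Frechet_Urysohn_space (Ck2 X)"
    using Frechet_Urysohn_Ck2_imp_locally_compact zd that by (simp add: X)
  have X'_seq: "sequential_space (Ck2 X)" if "Polish_space X" "compactin X X'"
    using k_space_Ck2_imp_sequential[OF X'_k] that by (simp add: Polish_space_def)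
  have sum_k: "k_space (Ck2 X)"
    if "topological_sum_of X L D" "separable_space (subtopology X L)"
      "locally_compact_space (subtopology X L)" "subtopology X D = discrete_topology D" for L D
    using k_space_Ck2_topological_sum[OF zd] that by (simp add: X)
  have k_sum: "\<exists>L D. topological_sum_of X L D \<and>
      separable_space (subtopology X L) \<and> metrizable_space (subtopology X L) \<and>
      locally_compact_space (subtopology X L) \<and> subtopology X D = discrete_topology D"
    if "k_space (Ck2 X)" "locally_compact_space X"
    using topological_sum_of_k_space_Ck2[OF zd] that by (simp add: X)
  show ?thesis
  proof (intro conjI iffI)
    show "kR_space (Ck2 X)" if "Ascoli_space (Ck2 X)"
      using Asc[OF that] lc_kR X'_k k_kR by blast
    show "locally_compact_space X \<or> \<not> locally_compact_space X \<and> compactin X X'" if "kR_space (Ck2 X)"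
      using Asc[OF kR_Asc[OF that]] by blast
    show "kR_space (Ck2 X)" if "locally_compact_space X \<or> \<not> locally_compact_space X \<and> compactin X X'"
      using that lc_kR X'_k k_kR by blast
    show "(\<exists>L D. topological_sum_of X L D \<and>
          separable_space (subtopology X L) \<and> metrizable_space (subtopology X L) \<and>
          locally_compact_space (subtopology X L) \<and> subtopology X D = discrete_topology D)
        \<or> (\<not> locally_compact_space X \<and> compactin X X')" if "k_space (Ck2 X)"
    proof (cases "locally_compact_space X")
      case True
      from k_sum[OF that True] show ?thesis ..
    next
      case False
      with Asc[OF kR_Asc[OF k_kR[OF that]]] show ?thesis by blast
    qed
    show "k_space (Ck2 X)" if "(\<exists>L D. topological_sum_of X L D \<and>
          separable_space (subtopology X L) \<and> metrizable_space (subtopology X L) \<and>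
          locally_compact_space (subtopology X L) \<and> subtopology X D = discrete_topology D)
        \<or> (\<not> locally_compact_space X \<and> compactin X X')"
      using that sum_k X'_k by blast
    show "locally_compact_space X \<or> \<not> locally_compact_space X \<and> compactin X X'"
      if "sequential_space (Ck2 X)"
      using Asc[OF kR_Asc[OF k_kR[OF seq_k[OF that]]]] by blast
    \<comment> \<open>For locally compact \<open>X\<close> the route leads through Polishness and
      the Frechet-Urysohn property of the function space, otherwise through its k-property and the
      separability of \<open>X\<close>.\<close>
    show "sequential_space (Ck2 X)"
      if "Polish_space X \<and> (locally_compact_space X \<or> \<not> locally_compact_space X \<and> compactin X X')"
      using that Polish_Polish Polish_FU FU_seq X'_seq by blast
    show "Polish_space (Ck2 X)" if "Frechet_Urysohn_space (Ck2 X)"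
      using Polish_Polish[OF seq_Polish[OF FU_seq[OF that]] FU_lc[OF that]] .
    show "Polish_space X" if "Polish_space (Ck2 X)"
      by (rule seq_Polish[OF FU_seq[OF Polish_FU[OF that]]])
    show "locally_compact_space X" if "Polish_space (Ck2 X)"
      by (rule FU_lc[OF Polish_FU[OF that]])
  qed (fact kR_Asc seq_Polish Polish_FU | use Polish_Polish in blast)+
qed

end
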